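(* Let $p$ be an odd prime. Suppose that $\alpha,z\in\mathbb Z_p$ with $z(1+z)$ prime to $p$. Then $$ {}_2F_1\bigg[\begin{matrix}\alpha&\alpha\\&1\end{matrix}\bigg|\,z^2\bigg]_{p-1}+z^{1-2\lambda_p(\alpha)}{}_2F_1\bigg[\begin{matrix}\alpha&\alpha\\&1\end{matrix}\bigg|\,\frac1{z^2}\bigg]_{p-1}\equiv(1+z)^{1-2\lambda_p(\alpha)}{}_2F_1\bigg[\begin{matrix}\alpha&\frac12\\&1\end{matrix}\bigg|\,\frac{4z}{(1+z)^2}\bigg]_{p-1}\pmod{p^2}. $$
   Context: $\mathbb Z_p$ denotes the $p$-adic integers and $\mathbb Z_p^\times$ its units. For $\alpha\in\mathbb Z_p$, $\langle\alpha\rangle_p$ is the unique integer in $\{0,1,\ldots,p-1\}$ congruent to $\alpha$ modulo $p$, and $\lambda_p(\alpha):=-\langle-\alpha\rangle_p+\frac{\alpha+\langle-\alpha\rangle_p}{p}\cdot(p-1)$. For $a\in\mathbb Z$, $s\in\mathbb Z_p$ and $w\in\mathbb Z_p^\times$, the power $w^{a+s(p-1)}$ is defined as $w^{a}\sum_{k=0}^\infty\binom{s}{k}(w^{p-1}-1)^k$ (this is well defined); in particular $w^{1-2\lambda_p(\alpha)}$ is defined for $w\in\mathbb Z_p^\times$. Pochhammer symbol: $(x)_0=1$, $(x)_k=x(x+1)\cdots(x+k-1)$. For $n\ge 0$, ${}_{2}F_1\Big[\begin{matrix}\alpha&\beta\\&\gamma\end{matrix}\Big|\,z\Big]_n=\sum_{k=0}^{n}\frac{(\alpha)_k(\beta)_k}{(\gamma)_k}\cdot\frac{z^k}{k!}$.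 For $x,y\in\mathbb Q_p$, $x\equiv y\pmod{p^2}$ means $x-y\in p^2\mathbb Z_p$. *)

theory Defs
  imports "HOL-Analysis.Analysis" "Berlekamp_Zassenhaus.Finite_Field"
begin

section \<open>The $p$-adic absolute value on the rationals\<close>

definition padic_abs :: "nat \<Rightarrow> rat \<Rightarrow> real" where
  "padic_abs p q =
     (if q = 0 then 0
      else let (a, b) = quotient_of q
           in real p powi (int (multiplicity (int p) b) - int (multiplicity (int p) a)))"

lemma padic_abs_0 [simp]: "padic_abs p 0 = 0"
  by (simp add: padic_abs_def)

context
  fixes p :: nat
  assumes p: "prime p"
begin

lemma padic_abs_Fract:
  assumes "a \<noteq> 0" "b \<noteq> 0"
  shows "padic_abs p (of_int a / of_int b) =
    real p powi (int (multiplicity (int p) b) - int (multiplicity (int p) a))"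
proof -
  define q :: rat where "q = of_int a / of_int b"
  obtain c d where cd: "quotient_of q = (c, d)" by force
  have d: "d > 0" using quotient_of_denom_pos[OF cd] .
  have q: "q = of_int c / of_int d" using quotient_of_div[OF cd] .
  have q0: "q \<noteq> 0" using assms by (simp add: q_def)
  have c: "c \<noteq> 0" using q q0 by auto
  have "(of_int (a * d) :: rat) = of_int (c * b)"
    using q assms d by (simp add: q_def field_simps)
  hence eq: "a * d = c * b" by (simp only: of_int_eq_iff)
  have pe: "prime_elem (int p)" using p by simp
  have "multiplicity (int p) a + multiplicity (int p) d = multiplicity (int p) (a * d)"
    using prime_elem_multiplicity_mult_distrib[OF pe] assms d by simp
  also have "\<dots> = multiplicity (int p) c + multiplicity (int p) b"
    unfolding eq using prime_elem_multiplicity_mult_distrib[OF pe] assms c by simp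
  finally have "int (multiplicity (int p) d) - int (multiplicity (int p) c) =
    int (multiplicity (int p) b) - int (multiplicity (int p) a)" by linarith
  thus ?thesis using q0 cd unfolding q_def by (simp add: padic_abs_def)
qed

lemma padic_abs_of_int:
  "a \<noteq> 0 \<Longrightarrow> padic_abs p (of_int a) = real p powi (- int (multiplicity (int p) a))"
  using padic_abs_Fract[of a 1] by simp

lemma padic_abs_pos: "q \<noteq> 0 \<Longrightarrow> padic_abs p q > 0"
  using prime_gt_0_nat[OF p] by (auto simp: padic_abs_def Let_def case_prod_unfold)

lemma padic_abs_ge_0 [simp]: "padic_abs p q \<ge> 0"
  using padic_abs_pos[of q] by (cases "q = 0") auto

lemma padic_abs_eq_0_iff [simp]: "padic_abs p q = 0 \<longleftrightarrow> q = 0"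
  using padic_abs_pos[of q] by (cases "q = 0") auto

lemma padic_abs_mult: "padic_abs p (q * r) = padic_abs p q * padic_abs p r"
proof (cases "q = 0 \<or> r = 0")
  case False
  obtain a b where ab: "quotient_of q = (a, b)" by force
  obtain c d where cd: "quotient_of r = (c, d)" by force
  have q: "q = of_int a / of_int b" and r: "r = of_int c / of_int d"
    using quotient_of_div[OF ab] quotient_of_div[OF cd] by auto
  have nz: "b \<noteq> 0" "d \<noteq> 0" "a \<noteq> 0" "c \<noteq> 0"
    using quotient_of_denom_pos[OF ab] quotient_of_denom_pos[OF cd] False q r by auto
  have pe: "prime_elem (int p)" using p by simp
  have p0: "real p \<noteq> 0" using p by auto
  have "q * r = of_int (a * c) / of_int (b * d)" by (simp add: q r)
  hence "padic_abs p (q * r) = real p powi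
      (int (multiplicity (int p) (b * d)) - int (multiplicity (int p) (a * c)))"
    using padic_abs_Fract[of "a * c" "b * d"] nz by simp
  also have "\<dots> = padic_abs p q * padic_abs p r"
    unfolding q r using nz p0
    by (simp add: padic_abs_Fract prime_elem_multiplicity_mult_distrib[OF pe]
        flip: power_int_add) (simp add: algebra_simps)
  finally show ?thesis .
qed auto

lemma padic_abs_1 [simp]: "padic_abs p 1 = 1"
  using padic_abs_of_int[of 1] by simp

lemma padic_abs_minus [simp]: "padic_abs p (- q) = padic_abs p q"
proof -
  have "multiplicity (int p) (- 1) = 0"
    using multiplicity_unit_right[of "- 1" "int p"] by simp
  hence "padic_abs p (-1) = 1" using padic_abs_of_int[of "-1"] by simp
  thus ?thesis using padic_abs_mult[of "-1" q] by simp
qed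

lemma padic_abs_diff_commute: "padic_abs p (q - r) = padic_abs p (r - q)"
  using padic_abs_minus[of "q - r"] by simp

lemma padic_abs_inverse: "padic_abs p (inverse q) = inverse (padic_abs p q)"
proof (cases "q = 0")
  case False
  thus ?thesis using padic_abs_mult[of q "inverse q"]
    by (simp add: field_simps)
qed auto

lemma padic_abs_add_int:
  "padic_abs p (of_int (a + b)) \<le> max (padic_abs p (of_int a)) (padic_abs p (of_int b))"
proof (cases "a = 0 \<or> b = 0 \<or> a + b = 0")
  case True
  hence "a = 0 \<or> b = 0 \<or> of_int (a + b) = (0::rat)" by (metis of_int_0)
  thus ?thesis by (elim disjE) (simp_all only: padic_abs_0, auto simp: le_max_iff_disj)
next
  case False
  define m where "m = min (multiplicity (int p) a) (multiplicity (int p) b)"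
  have "int p ^ m dvd a" "int p ^ m dvd b"
    by (auto simp: m_def intro: multiplicity_dvd')
  hence "int p ^ m dvd a + b" by simp
  moreover have "\<not> is_unit (int p)" using p by auto
  ultimately have "m \<le> multiplicity (int p) (a + b)"
    using False by (intro multiplicity_geI) auto
  hence "real p powi (- int (multiplicity (int p) (a + b))) \<le> real p powi (- int m)"
    using prime_ge_1_nat[OF p] by (intro power_int_increasing) auto
  also have "\<dots> \<le> max (padic_abs p (of_int a)) (padic_abs p (of_int b))"
    using False by (auto simp: padic_abs_of_int m_def min_def)
  finally show ?thesis using padic_abs_of_int[of "a + b"] False by simp
qed

lemma padic_abs_add: "padic_abs p (q + r) \<le> max (padic_abs p q) (padic_abs p r)"
proof -
  obtain a b where ab: "quotient_of q = (a, b)" by force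
  obtain c d where cd: "quotient_of r = (c, d)" by force
  have q: "q = of_int a / of_int b" and r: "r = of_int c / of_int d"
    using quotient_of_div[OF ab] quotient_of_div[OF cd] by auto
  have nz: "b \<noteq> 0" "d \<noteq> 0"
    using quotient_of_denom_pos[OF ab] quotient_of_denom_pos[OF cd] by auto
  define u :: rat where "u = inverse (of_int (b * d))"
  have q': "q = of_int (a * d) * u" and r': "r = of_int (c * b) * u"
    using nz by (simp_all add: q r u_def field_simps)
  have "q + r = of_int (a * d + c * b) * u" by (simp add: q' r' algebra_simps)
  hence "padic_abs p (q + r) = padic_abs p (of_int (a * d + c * b)) * padic_abs p u"
    by (simp only: padic_abs_mult)
  also have "\<dots> \<le> max (padic_abs p (of_int (a * d))) (padic_abs p (of_int (c * b))) * padic_abs p u"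
    by (intro mult_right_mono padic_abs_add_int) auto
  also have "\<dots> = max (padic_abs p q) (padic_abs p r)"
    by (simp only: q' r' padic_abs_mult max_mult_distrib_right) simp
  finally show ?thesis .
qed

lemma padic_abs_triangle: "padic_abs p (q + r) \<le> padic_abs p q + padic_abs p r"
  using padic_abs_add[of q r] padic_abs_ge_0[of q] padic_abs_ge_0[of r] by linarith

lemma padic_abs_diff_abs: "\<bar>padic_abs p q - padic_abs p r\<bar> \<le> padic_abs p (q - r)"
  using padic_abs_triangle[of "q - r" r] padic_abs_triangle[of "r - q" q]
  by (simp add: padic_abs_diff_commute[of r q])

end


section \<open>The field of $p$-adic numbers\<close>

definition padic_Cauchy :: "nat \<Rightarrow> (nat \<Rightarrow> rat) \<Rightarrow> bool" where
  "padic_Cauchy p X \<longleftrightarrow> (\<forall>e>0. \<exists>N. \<forall>m\<ge>N. \<forall>n\<ge>N. padic_abs p (X m - X n) < e)"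

definition padic_vanishes :: "nat \<Rightarrow> (nat \<Rightarrow> rat) \<Rightarrow> bool" where
  "padic_vanishes p X \<longleftrightarrow> (\<lambda>n. padic_abs p (X n)) \<longlonglongrightarrow> 0"

lemma padic_Cauchy_const: "padic_Cauchy p (\<lambda>_. c)"
  by (simp add: padic_Cauchy_def)

context
  fixes p :: nat
  assumes p: "prime p"
begin

lemma padic_Cauchy_iff:
  "padic_Cauchy p X \<longleftrightarrow>
     ((\<lambda>(m, n). padic_abs p (X m - X n)) \<longlongrightarrow> 0) (sequentially \<times>\<^sub>F sequentially)"
proof -
  have *: "dist (case mn of (m, n) \<Rightarrow> padic_abs p (X m - X n)) 0 =
      (case mn of (m, n) \<Rightarrow> padic_abs p (X m - X n))" for mn
    using padic_abs_ge_0[OF p] by (cases mn) simp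
  show ?thesis
    unfolding tendsto_iff * eventually_prod_sequentially padic_Cauchy_def
    by simp (subst padic_abs_diff_commute[OF p], rule refl)
qed

lemma padic_Cauchy_convergent:
  assumes "padic_Cauchy p X"
  shows "convergent (\<lambda>n. padic_abs p (X n))"
proof -
  have "Cauchy (\<lambda>n. padic_abs p (X n))"
  proof (rule metric_CauchyI)
    fix e :: real assume "e > 0"
    then obtain N where "\<forall>m\<ge>N. \<forall>n\<ge>N. padic_abs p (X m - X n) < e"
      using assms unfolding padic_Cauchy_def by blast
    thus "\<exists>M. \<forall>m\<ge>M. \<forall>n\<ge>M. dist (padic_abs p (X m)) (padic_abs p (X n)) < e"
      unfolding dist_real_def using padic_abs_diff_abs[OF p] by (meson le_less_trans)
  qed
  thus ?thesis by (simp add: Cauchy_convergent_iff)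
qed

lemma padic_Cauchy_bounded:
  assumes "padic_Cauchy p X"
  obtains B where "B > 0" "\<And>n. padic_abs p (X n) \<le> B"
proof -
  have "Bseq (\<lambda>n. padic_abs p (X n))"
    by (rule convergent_imp_Bseq[OF padic_Cauchy_convergent[OF assms]])
  then obtain B where "B > 0" "\<forall>n. norm (padic_abs p (X n)) \<le> B" unfolding Bseq_def by blast
  thus ?thesis using that[of B] padic_abs_ge_0[OF p] by simp
qed

lemma padic_Cauchy_le:
  assumes "((\<lambda>(m, n). g m n) \<longlongrightarrow> 0) (sequentially \<times>\<^sub>F sequentially)"
    and "\<forall>\<^sub>F (m, n) in sequentially \<times>\<^sub>F sequentially. padic_abs p (X m - X n) \<le> g m n"
  shows "padic_Cauchy p X"
  unfolding padic_Cauchy_iff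
  by (rule tendsto_sandwich[OF _ _ tendsto_const assms(1)])
     (use assms(2) padic_abs_ge_0[OF p] in \<open>auto simp: case_prod_unfold\<close>)

lemma padic_Cauchy_add:
  assumes "padic_Cauchy p X" "padic_Cauchy p Y"
  shows "padic_Cauchy p (\<lambda>n. X n + Y n)"
proof (rule padic_Cauchy_le)
  show "((\<lambda>(m, n). padic_abs p (X m - X n) + padic_abs p (Y m - Y n)) \<longlongrightarrow> 0)
          (sequentially \<times>\<^sub>F sequentially)"
    using tendsto_add[OF assms[unfolded padic_Cauchy_iff]] by (simp add: case_prod_unfold)
  show "\<forall>\<^sub>F (m, n) in sequentially \<times>\<^sub>F sequentially. padic_abs p ((X m + Y m) - (X n + Y n))
          \<le> padic_abs p (X m - X n) + padic_abs p (Y m - Y n)"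
    unfolding add_diff_add by (rule always_eventually) (simp add: padic_abs_triangle[OF p])
qed

lemma padic_Cauchy_minus: "padic_Cauchy p X \<Longrightarrow> padic_Cauchy p (\<lambda>n. - X n)"
  unfolding padic_Cauchy_def
  by (simp only: minus_diff_minus padic_abs_minus[OF p])

lemma padic_Cauchy_mult:
  assumes "padic_Cauchy p X" "padic_Cauchy p Y"
  shows "padic_Cauchy p (\<lambda>n. X n * Y n)"
proof -
  obtain B where B: "B > 0" "\<And>n. padic_abs p (X n) \<le> B" using padic_Cauchy_bounded[OF assms(1)] by blast
  obtain C where C: "C > 0" "\<And>n. padic_abs p (Y n) \<le> C" using padic_Cauchy_bounded[OF assms(2)] by blast
  show ?thesis
  proof (rule padic_Cauchy_le)
    show "((\<lambda>(m, n). B * padic_abs p (Y m - Y n) + padic_abs p (X m - X n) * C) \<longlongrightarrow> 0)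
            (sequentially \<times>\<^sub>F sequentially)"
      using tendsto_add[OF tendsto_mult_left[OF assms(2)[unfolded padic_Cauchy_iff], of B]
          tendsto_mult_right[OF assms(1)[unfolded padic_Cauchy_iff], of C]]
      by (simp add: case_prod_unfold)
    have "padic_abs p (X m * Y m - X n * Y n)
            \<le> B * padic_abs p (Y m - Y n) + padic_abs p (X m - X n) * C" for m n
    proof -
      have "padic_abs p (X m * Y m - X n * Y n)
          = padic_abs p (X m * (Y m - Y n) + (X m - X n) * Y n)" by (simp add: algebra_simps)
      also have "\<dots> \<le> padic_abs p (X m * (Y m - Y n)) + padic_abs p ((X m - X n) * Y n)"
        by (rule padic_abs_triangle[OF p])
      also have "\<dots> \<le> B * padic_abs p (Y m - Y n) + padic_abs p (X m - X n) * C"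
        unfolding padic_abs_mult[OF p] using B C padic_abs_ge_0[OF p]
        by (intro add_mono mult_mono) auto
      finally show ?thesis .
    qed
    thus "\<forall>\<^sub>F (m, n) in sequentially \<times>\<^sub>F sequentially. padic_abs p (X m * Y m - X n * Y n)
            \<le> B * padic_abs p (Y m - Y n) + padic_abs p (X m - X n) * C" by (intro always_eventually) auto
  qed
qed

lemma padic_not_vanishesE:
  assumes "padic_Cauchy p X" "\<not> padic_vanishes p X"
  obtains L where "L > 0" "\<forall>\<^sub>F n in sequentially. padic_abs p (X n) > L"
proof -
  obtain L where L: "(\<lambda>n. padic_abs p (X n)) \<longlonglongrightarrow> L"
    using padic_Cauchy_convergent[OF assms(1)] unfolding convergent_def by blast
  have "L \<noteq> 0" using L assms(2) unfolding padic_vanishes_def by auto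
  moreover have "L \<ge> 0" by (rule LIMSEQ_le_const[OF L]) (use padic_abs_ge_0[OF p] in auto)
  ultimately have "L > 0" by simp
  thus ?thesis using that[of "L / 2"] order_tendstoD(1)[OF L, of "L / 2"] by simp
qed

lemma padic_inverse_diff:
  assumes "padic_abs p x > L" "padic_abs p y > L" "L > 0"
  shows "padic_abs p (inverse x - inverse y) \<le> padic_abs p (x - y) / L\<^sup>2"
proof -
  have nz: "x \<noteq> 0" "y \<noteq> 0" using assms by auto
  hence "inverse x - inverse y = (y - x) * (inverse x * inverse y)" by (simp add: field_simps)
  hence "padic_abs p (inverse x - inverse y)
      = padic_abs p (x - y) * (inverse (padic_abs p x) * inverse (padic_abs p y))"
    by (simp only: padic_abs_mult[OF p] padic_abs_inverse[OF p] padic_abs_diff_commute[OF p, of y x])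
  also have "\<dots> \<le> padic_abs p (x - y) * (inverse L * inverse L)"
    using assms padic_abs_ge_0[OF p] by (intro mult_left_mono mult_mono le_imp_inverse_le) auto
  finally show ?thesis by (simp add: field_simps power2_eq_square)
qed

lemma padic_Cauchy_inverse:
  assumes "padic_Cauchy p X" "\<not> padic_vanishes p X"
  shows "padic_Cauchy p (\<lambda>n. inverse (X n))"
proof -
  obtain L where L: "L > 0" "\<forall>\<^sub>F n in sequentially. padic_abs p (X n) > L"
    using padic_not_vanishesE[OF assms] .
  show ?thesis
  proof (rule padic_Cauchy_le)
    show "((\<lambda>(m, n). padic_abs p (X m - X n) / L\<^sup>2) \<longlongrightarrow> 0) (sequentially \<times>\<^sub>F sequentially)"
      using tendsto_mult_right[OF assms(1)[unfolded padic_Cauchy_iff], of "inverse (L\<^sup>2)"]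
      by (simp add: case_prod_unfold field_simps)
    show "\<forall>\<^sub>F (m, n) in sequentially \<times>\<^sub>F sequentially.
            padic_abs p (inverse (X m) - inverse (X n)) \<le> padic_abs p (X m - X n) / L\<^sup>2"
      using eventually_prodI[OF L(2) L(2)]
      by eventually_elim (use padic_inverse_diff L(1) in auto)
  qed
qed

lemma padic_vanishes_le:
  assumes "g \<longlonglongrightarrow> 0" "\<forall>\<^sub>F n in sequentially. padic_abs p (X n) \<le> g n"
  shows "padic_vanishes p X"
  unfolding padic_vanishes_def
  by (rule tendsto_sandwich[OF _ assms(2) tendsto_const assms(1)]) (use padic_abs_ge_0[OF p] in auto)

lemma padic_vanishes_swap:
  "padic_vanishes p (\<lambda>n. X n - Y n) \<Longrightarrow> padic_vanishes p (\<lambda>n. Y n - X n)"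
  unfolding padic_vanishes_def by (subst padic_abs_diff_commute[OF p])

lemma padic_vanishes_add:
  assumes "padic_vanishes p X" "padic_vanishes p Y"
  shows "padic_vanishes p (\<lambda>n. X n + Y n)"
  by (rule padic_vanishes_le[of "\<lambda>n. padic_abs p (X n) + padic_abs p (Y n)"])
     (use tendsto_add[OF assms[unfolded padic_vanishes_def]] padic_abs_triangle[OF p] in auto)

lemma padic_vanishes_mult_bounded:
  assumes "padic_Cauchy p X" "padic_vanishes p Y"
  shows "padic_vanishes p (\<lambda>n. X n * Y n)"
proof -
  obtain B where B: "B > 0" "\<And>n. padic_abs p (X n) \<le> B" using padic_Cauchy_bounded[OF assms(1)] by blast
  show ?thesis
  proof (rule padic_vanishes_le)
    show "(\<lambda>n. B * padic_abs p (Y n)) \<longlonglongrightarrow> 0"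
      using tendsto_mult_left[OF assms(2)[unfolded padic_vanishes_def], of B] by simp
    show "\<forall>\<^sub>F n in sequentially. padic_abs p (X n * Y n) \<le> B * padic_abs p (Y n)"
      using B padic_abs_ge_0[OF p]
      by (auto simp: padic_abs_mult[OF p] intro!: always_eventually mult_right_mono)
  qed
qed

end

definition padicrel :: "nat \<Rightarrow> (nat \<Rightarrow> rat) \<Rightarrow> (nat \<Rightarrow> rat) \<Rightarrow> bool" where
  "padicrel p X Y \<longleftrightarrow>
     padic_Cauchy p X \<and> padic_Cauchy p Y \<and> padic_vanishes p (\<lambda>n. X n - Y n)"

lemma padicrel_refl: "padicrel p X X \<longleftrightarrow> padic_Cauchy p X"
  by (simp add: padicrel_def padic_vanishes_def)

lemma part_equivp_padicrel: "prime p \<Longrightarrow> part_equivp (padicrel p)"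
proof (rule part_equivpI)
  assume p: "prime p"
  show "\<exists>X. padicrel p X X"
    by (rule exI[of _ "\<lambda>_. 0"]) (simp add: padicrel_refl padic_Cauchy_const)
  show "symp (padicrel p)"
    by (rule sympI) (simp add: padicrel_def padic_vanishes_def padic_abs_diff_commute[OF p])
  show "transp (padicrel p)"
  proof (rule transpI)
    fix X Y Z assume "padicrel p X Y" "padicrel p Y Z"
    thus "padicrel p X Z"
      unfolding padicrel_def using padic_vanishes_add[OF p, of "\<lambda>n. X n - Y n" "\<lambda>n. Y n - Z n"] by simp
  qed
qed

text \<open>
  The prime is passed as the cardinality of a type argument; \<open>'p padic\<close> is the field
  $\mathbb{Q}_p$ for $p = \mathrm{CARD}('p)$, i.e. the completion of the rationals.
\<close>

typedef (overloaded) ('p :: prime_card) padic =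
  "{C. \<exists>X. padicrel CARD('p) X X \<and> C = Collect (padicrel CARD('p) X)}"
  by (rule exI[of _ "Collect (padicrel CARD('p) (\<lambda>_. 0))"])
     (auto intro!: exI[of _ "\<lambda>_. 0"] simp: padicrel_refl padic_Cauchy_const)

definition Padic :: "(nat \<Rightarrow> rat) \<Rightarrow> 'p::prime_card padic" where
  "Padic X = Abs_padic (Collect (padicrel CARD('p) X))"

definition rep_padic :: "'p::prime_card padic \<Rightarrow> (nat \<Rightarrow> rat)" where
  "rep_padic x = (SOME X. X \<in> Rep_padic x)"

definition cr_padic :: "(nat \<Rightarrow> rat) \<Rightarrow> 'p::prime_card padic \<Rightarrow> bool" where
  "cr_padic X x \<longleftrightarrow> padicrel CARD('p) X X \<and> Padic X = x"

lemma Quotient_padic: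
  "Quotient (padicrel CARD('p)) (Padic :: _ \<Rightarrow> 'p::prime_card padic) rep_padic cr_padic"
proof -
  interpret quot_type "padicrel CARD('p)" "Abs_padic :: _ \<Rightarrow> 'p padic" Rep_padic
    using type_definition_padic[where ?'p = 'p] part_equivp_padicrel[OF prime_card, where ?'a1 = 'p]
    by unfold_locales (auto simp: type_definition_def Rep_padic_inject)
  have "abs = Padic" "rep = rep_padic"
    by (auto simp: abs_def Padic_def rep_def rep_padic_def fun_eq_iff)
  hence "Quotient3 (padicrel CARD('p)) (Padic :: _ \<Rightarrow> 'p padic) rep_padic"
    using Quotient by simp
  thus ?thesis
    by (rule Quotient3_to_Quotient) (simp add: cr_padic_def[abs_def])
qed

setup_lifting Quotient_padic

lemma cr_padic_eq:
  "pcr_padic = (\<lambda>x (y :: 'p::prime_card padic). padic_Cauchy CARD('p) x \<and> Padic x = y)"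
  unfolding padic.pcr_cr_eq cr_padic_def[abs_def] padicrel_refl by auto

lemma Padic_cases [cases type: padic]:
  fixes x :: "'p::prime_card padic"
  obtains X where "x = Padic X" "padic_Cauchy CARD('p) X"
  using that[of "rep_padic x"] Quotient_abs_rep[OF Quotient_padic, of x]
    Quotient_rep_reflp[OF Quotient_padic, of x] padicrel_refl by metis

instantiation padic :: (prime_card) field
begin

lift_definition zero_padic :: "'a padic" is "\<lambda>_. 0"
  by (simp add: padicrel_refl padic_Cauchy_const)

lift_definition one_padic :: "'a padic" is "\<lambda>_. 1"
  by (simp add: padicrel_refl padic_Cauchy_const)

lift_definition plus_padic :: "'a padic \<Rightarrow> 'a padic \<Rightarrow> 'a padic" is "\<lambda>X Y n. X n + Y n"
  unfolding padicrel_def add_diff_add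
  by (simp add: padic_Cauchy_add prime_card padic_vanishes_add)

lift_definition uminus_padic :: "'a padic \<Rightarrow> 'a padic" is "\<lambda>X n. - X n"
  unfolding padicrel_def minus_diff_minus
  by (auto simp: padic_Cauchy_minus prime_card intro: padic_vanishes_swap[OF prime_card])

lift_definition times_padic :: "'a padic \<Rightarrow> 'a padic \<Rightarrow> 'a padic" is "\<lambda>X Y n. X n * Y n"
proof -
  fix X X' Y Y' :: "nat \<Rightarrow> rat"
  assume *: "padicrel CARD('a) X X'" "padicrel CARD('a) Y Y'"
  have "padic_vanishes CARD('a) (\<lambda>n. X n * (Y n - Y' n) + Y' n * (X n - X' n))"
    using * unfolding padicrel_def
    by (intro padic_vanishes_add padic_vanishes_mult_bounded prime_card) auto
  moreover have "X n * (Y n - Y' n) + Y' n * (X n - X' n) = X n * Y n - X' n * Y' n" for n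
    by (simp add: algebra_simps)
  ultimately show "padicrel CARD('a) (\<lambda>n. X n * Y n) (\<lambda>n. X' n * Y' n)"
    using * unfolding padicrel_def by (simp add: padic_Cauchy_mult prime_card)
qed

lift_definition inverse_padic :: "'a padic \<Rightarrow> 'a padic"
  is "\<lambda>X. if padic_vanishes CARD('a) X then (\<lambda>_. 0) else (\<lambda>n. inverse (X n))"
proof -
  fix X Y :: "nat \<Rightarrow> rat"
  assume *: "padicrel CARD('a) X Y"
  hence X: "padic_Cauchy CARD('a) X" and Y: "padic_Cauchy CARD('a) Y"
    and XY: "padic_vanishes CARD('a) (\<lambda>n. X n - Y n)" by (auto simp: padicrel_def)
  have YX: "padic_vanishes CARD('a) (\<lambda>n. Y n - X n)"
    using XY by (rule padic_vanishes_swap[OF prime_card])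
  have iff: "padic_vanishes CARD('a) X \<longleftrightarrow> padic_vanishes CARD('a) Y"
    using padic_vanishes_add[OF prime_card XY, of Y] padic_vanishes_add[OF prime_card YX, of X]
    by auto
  show "padicrel CARD('a)
      (if padic_vanishes CARD('a) X then (\<lambda>_. 0) else (\<lambda>n. inverse (X n)))
      (if padic_vanishes CARD('a) Y then (\<lambda>_. 0) else (\<lambda>n. inverse (Y n)))"
  proof (cases "padic_vanishes CARD('a) X")
    case True
    thus ?thesis using iff by (simp add: padicrel_refl padic_Cauchy_const)
  next
    case False
    hence nY: "\<not> padic_vanishes CARD('a) Y" using iff by simp
    obtain L where L: "L > 0" "\<forall>\<^sub>F n in sequentially. padic_abs CARD('a) (X n) > L"
      using padic_not_vanishesE[OF prime_card X False] .
    obtain M where M: "M > 0" "\<forall>\<^sub>F n in sequentially. padic_abs CARD('a) (Y n) > M"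
      using padic_not_vanishesE[OF prime_card Y nY] .
    have "padic_vanishes CARD('a) (\<lambda>n. inverse (X n) - inverse (Y n))"
    proof (rule padic_vanishes_le[OF prime_card])
      show "(\<lambda>n. padic_abs CARD('a) (X n - Y n) * inverse ((min L M)\<^sup>2)) \<longlonglongrightarrow> 0"
        using tendsto_mult_right[OF XY[unfolded padic_vanishes_def]] by fastforce
      show "\<forall>\<^sub>F n in sequentially. padic_abs CARD('a) (inverse (X n) - inverse (Y n))
          \<le> padic_abs CARD('a) (X n - Y n) * inverse ((min L M)\<^sup>2)"
        using L(2) M(2)
        by eventually_elim
           (use L(1) M(1) in \<open>auto intro!: padic_inverse_diff[OF prime_card]
             simp flip: divide_inverse\<close>)
    qed
    thus ?thesis using False nY X Y
      by (simp add: padicrel_def padic_Cauchy_inverse prime_card)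
  qed
qed

definition "x - y = x + - y" for x y :: "'a padic"

definition "x div y = x * inverse y" for x y :: "'a padic"

instance
proof
  fix a b c :: "'a padic"
  show "a + b = b + a"
    by transfer (simp add: ac_simps padicrel_def padic_Cauchy_add prime_card padic_vanishes_def)
  show "(a + b) + c = a + (b + c)"
    by transfer (simp add: ac_simps padicrel_def padic_Cauchy_add prime_card padic_vanishes_def)
  show "0 + a = a"
    by transfer (simp add: padicrel_def padic_vanishes_def)
  show "- a + a = 0"
    by transfer (simp add: padicrel_def padic_vanishes_def padic_Cauchy_const)
  show "a - b = a + - b"
    by (rule minus_padic_def)
  show "(a * b) * c = a * (b * c)"
    by transfer (simp add: ac_simps padicrel_def padic_Cauchy_mult prime_card padic_vanishes_def)
  show "a * b = b * a"
    by transfer (simp add: ac_simps padicrel_def padic_Cauchy_mult prime_card padic_vanishes_def)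
  show "1 * a = a"
    by transfer (simp add: padicrel_def padic_vanishes_def)
  show "(a + b) * c = a * c + b * c"
    by transfer (simp add: distrib_right padicrel_refl padic_Cauchy_add padic_Cauchy_mult prime_card)
  show "(0 :: 'a padic) \<noteq> 1"
    by transfer (simp add: padicrel_def padic_vanishes_def padic_abs_1 padic_abs_minus prime_card
        LIMSEQ_const_iff)
  show "inverse a * a = 1" if "a \<noteq> 0"
    using that
  proof transfer
    fix X :: "nat \<Rightarrow> rat"
    assume *: "padicrel CARD('a) X X" "\<not> padicrel CARD('a) X (\<lambda>_. 0)"
    hence X: "padic_Cauchy CARD('a) X" and nv: "\<not> padic_vanishes CARD('a) X"
      by (auto simp: padicrel_def padic_Cauchy_const)
    obtain L where L: "L > 0" "\<forall>\<^sub>F n in sequentially. padic_abs CARD('a) (X n) > L"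
      using padic_not_vanishesE[OF prime_card X nv] .
    have "padic_vanishes CARD('a) (\<lambda>n. inverse (X n) * X n - 1)"
      unfolding padic_vanishes_def
    proof (rule tendsto_eventually)
      show "\<forall>\<^sub>F n in sequentially. padic_abs CARD('a) (inverse (X n) * X n - 1) = 0"
        using L(2)
      proof eventually_elim
        case (elim n)
        hence "X n \<noteq> 0" using L(1) by auto
        thus ?case by simp
      qed
    qed
    thus "padicrel CARD('a)
        (\<lambda>n. (if padic_vanishes CARD('a) X then (\<lambda>_. 0) else (\<lambda>n. inverse (X n))) n * X n) (\<lambda>_. 1)"
      using nv X by (simp add: padicrel_def padic_Cauchy_mult padic_Cauchy_inverse
          padic_Cauchy_const prime_card)
  qed
  show "a div b = a * inverse b"
    by (rule divide_padic_def)
  show "inverse (0 :: 'a padic) = 0"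
    by transfer (simp add: padicrel_refl padic_vanishes_def padic_Cauchy_const)
qed

end

lemma Padic_add:
  assumes "padic_Cauchy CARD('p) X" "padic_Cauchy CARD('p) Y"
  shows "Padic X + (Padic Y :: 'p::prime_card padic) = Padic (\<lambda>n. X n + Y n)"
  using assms plus_padic.transfer[where ?'a = 'p] by (simp add: cr_padic_eq rel_fun_def)

lemma Padic_minus:
  assumes "padic_Cauchy CARD('p) X"
  shows "- (Padic X :: 'p::prime_card padic) = Padic (\<lambda>n. - X n)"
  using assms uminus_padic.transfer[where ?'a = 'p] by (simp add: cr_padic_eq rel_fun_def)

lemma Padic_diff:
  assumes "padic_Cauchy CARD('p) X" "padic_Cauchy CARD('p) Y"
  shows "Padic X - (Padic Y :: 'p::prime_card padic) = Padic (\<lambda>n. X n - Y n)"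
  using assms by (simp add: minus_padic_def Padic_minus Padic_add padic_Cauchy_minus prime_card)

lemma Padic_mult:
  assumes "padic_Cauchy CARD('p) X" "padic_Cauchy CARD('p) Y"
  shows "Padic X * (Padic Y :: 'p::prime_card padic) = Padic (\<lambda>n. X n * Y n)"
  using assms times_padic.transfer[where ?'a = 'p] by (simp add: cr_padic_eq rel_fun_def)

lemma Padic_eq_iff:
  assumes "padic_Cauchy CARD('p) X" "padic_Cauchy CARD('p) Y"
  shows "(Padic X :: 'p::prime_card padic) = Padic Y \<longleftrightarrow> padic_vanishes CARD('p) (\<lambda>n. X n - Y n)"
  using assms Quotient_rel[OF Quotient_padic[where 'p = 'p], of X Y]
  by (simp add: padicrel_refl) (simp add: padicrel_def)

lemma Padic_of_nat: "(of_nat k :: 'p::prime_card padic) = Padic (\<lambda>_. of_nat k)"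
  by (induction k) (simp_all add: zero_padic_def one_padic_def Padic_add padic_Cauchy_const)

instance padic :: (prime_card) field_char_0
proof
  have "k = l" if "(of_nat k :: 'a padic) = of_nat l" for k l
    using that
    by (simp add: prime_card Padic_of_nat Padic_eq_iff padic_Cauchy_const padic_vanishes_def LIMSEQ_const_iff)
  thus "inj (of_nat :: nat \<Rightarrow> 'a padic)" by (rule injI)
qed

lemma Padic_of_int: "(of_int k :: 'p::prime_card padic) = Padic (\<lambda>_. of_int k)"
  by (cases k rule: int_cases2) (simp_all add: Padic_of_nat Padic_minus padic_Cauchy_const)

lemma Padic_of_rat: "(of_rat q :: 'p::prime_card padic) = Padic (\<lambda>_. q)"
proof -
  obtain a b where ab: "quotient_of q = (a, b)" by force
  have b: "b > 0" and q: "q = of_int a / of_int b"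
    using quotient_of_div[OF ab] quotient_of_denom_pos[OF ab] by auto
  have "Padic (\<lambda>_. q) * (of_int b :: 'p padic) = of_int a"
    using b by (simp add: Padic_of_int Padic_mult padic_Cauchy_const q)
  moreover have "of_rat q * (of_int b :: 'p padic) = of_int a"
    using b by (simp add: q of_rat_divide)
  moreover have "(of_int b :: 'p padic) \<noteq> 0" using b by simp
  ultimately show ?thesis by (metis mult_right_cancel)
qed

text \<open>
  The absolute value of $\mathbb{Q}_p$, extending the one on the rationals by continuity; it
  makes \<open>'p padic\<close> a metric space.
\<close>

lift_definition padic_norm :: "'a::prime_card padic \<Rightarrow> real" is "\<lambda>X. lim (\<lambda>n. padic_abs CARD('a) (X n))"
proof -
  fix X Y :: "nat \<Rightarrow> rat"
  assume *: "padicrel CARD('a) X Y"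
  have "(\<lambda>n. padic_abs CARD('a) (X n) - padic_abs CARD('a) (Y n)) \<longlonglongrightarrow> 0"
    by (rule tendsto_rabs_zero_cancel, rule tendsto_sandwich[OF _ _ tendsto_const])
       (use * in \<open>auto simp: padicrel_def padic_vanishes_def
          intro!: always_eventually padic_abs_diff_abs[OF prime_card]\<close>)
  moreover have "convergent (\<lambda>n. padic_abs CARD('a) (Y n))"
    using * padic_Cauchy_convergent[OF prime_card] by (auto simp: padicrel_def)
  then obtain L where L: "(\<lambda>n. padic_abs CARD('a) (Y n)) \<longlonglongrightarrow> L"
    unfolding convergent_def by blast
  ultimately have "(\<lambda>n. padic_abs CARD('a) (X n)) \<longlonglongrightarrow> L"
    using tendsto_add[of _ 0 _ _ L] by fastforce
  thus "lim (\<lambda>n. padic_abs CARD('a) (X n)) = lim (\<lambda>n. padic_abs CARD('a) (Y n))"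
    using L by (simp add: limI)
qed

lemma padic_norm_LIMSEQ:
  assumes "padic_Cauchy CARD('p) X"
  shows "(\<lambda>n. padic_abs CARD('p) (X n)) \<longlonglongrightarrow> padic_norm (Padic X :: 'p::prime_card padic)"
proof -
  have "padic_norm (Padic X :: 'p padic) = lim (\<lambda>n. padic_abs CARD('p) (X n))"
    using assms padic_norm.transfer[where ?'a = 'p] by (simp add: cr_padic_eq rel_fun_def)
  thus ?thesis using padic_Cauchy_convergent[OF prime_card assms] convergent_LIMSEQ_iff by metis
qed

lemma padic_norm_ge_0: "padic_norm x \<ge> 0" for x :: "'p::prime_card padic"
proof (cases x)
  case (1 X)
  show ?thesis
    using LIMSEQ_le_const[OF padic_norm_LIMSEQ[OF 1(2)]] padic_abs_ge_0[OF prime_card] 1(1) by blast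
qed

lemma padic_norm_eq_0_iff: "padic_norm x = 0 \<longleftrightarrow> x = 0" for x :: "'p::prime_card padic"
proof (cases x)
  case (1 X)
  have "x = 0 \<longleftrightarrow> padic_vanishes CARD('p) X"
    using 1 by (simp add: zero_padic_def Padic_eq_iff padic_Cauchy_const)
  thus ?thesis using padic_norm_LIMSEQ[OF 1(2)] 1(1) LIMSEQ_unique
    unfolding padic_vanishes_def by auto
qed

lemma padic_norm_minus: "padic_norm (- x) = padic_norm x" for x :: "'p::prime_card padic"
proof (cases x)
  case (1 X)
  have "(\<lambda>n. padic_abs CARD('p) (- X n)) \<longlonglongrightarrow> padic_norm (- x)"
    using padic_norm_LIMSEQ[OF padic_Cauchy_minus[OF prime_card 1(2)]] 1 by (simp add: Padic_minus)
  moreover have "(\<lambda>n. padic_abs CARD('p) (- X n)) \<longlonglongrightarrow> padic_norm x"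
    using padic_norm_LIMSEQ[OF 1(2)] 1(1) by (simp add: padic_abs_minus prime_card)
  ultimately show ?thesis by (rule LIMSEQ_unique)
qed

lemma padic_norm_mult: "padic_norm (x * y) = padic_norm x * padic_norm y" for x y :: "'p::prime_card padic"
proof (cases x; cases y)
  fix X Y
  assume *: "x = Padic X" "padic_Cauchy CARD('p) X" "y = Padic Y" "padic_Cauchy CARD('p) Y"
  have "(\<lambda>n. padic_abs CARD('p) (X n * Y n)) \<longlonglongrightarrow> padic_norm (x * y)"
    using padic_norm_LIMSEQ[OF padic_Cauchy_mult[OF prime_card *(2,4)]] * by (simp add: Padic_mult)
  moreover have "(\<lambda>n. padic_abs CARD('p) (X n * Y n)) \<longlonglongrightarrow> padic_norm x * padic_norm y"
    using tendsto_mult[OF padic_norm_LIMSEQ[OF *(2)] padic_norm_LIMSEQ[OF *(4)]] *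
    by (simp add: padic_abs_mult prime_card)
  ultimately show ?thesis by (rule LIMSEQ_unique)
qed

lemma padic_norm_add: "padic_norm (x + y) \<le> max (padic_norm x) (padic_norm y)" for x y :: "'p::prime_card padic"
proof (cases x; cases y)
  fix X Y
  assume *: "x = Padic X" "padic_Cauchy CARD('p) X" "y = Padic Y" "padic_Cauchy CARD('p) Y"
  have "(\<lambda>n. padic_abs CARD('p) (X n + Y n)) \<longlonglongrightarrow> padic_norm (x + y)"
    using padic_norm_LIMSEQ[OF padic_Cauchy_add[OF prime_card *(2,4)]] * by (simp add: Padic_add)
  moreover have "(\<lambda>n. max (padic_abs CARD('p) (X n)) (padic_abs CARD('p) (Y n)))
      \<longlonglongrightarrow> max (padic_norm x) (padic_norm y)"
    using tendsto_max[OF padic_norm_LIMSEQ[OF *(2)] padic_norm_LIMSEQ[OF *(4)]] * by simp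
  ultimately show ?thesis
    by (rule LIMSEQ_le) (use padic_abs_add[OF prime_card] in auto)
qed

instantiation padic :: (prime_card) metric_space
begin

definition "dist x y = padic_norm (x - y)" for x y :: "'a padic"

definition uniformity_padic_def:
  "(uniformity :: ('a padic \<times> 'a padic) filter) =
     (INF e\<in>{0 <..}. principal {(x, y). dist x y < e})"

definition open_padic_def:
  "open (U :: 'a padic set) \<longleftrightarrow>
     (\<forall>x\<in>U. eventually (\<lambda>(x', y). x' = x \<longrightarrow> y \<in> U) uniformity)"

instance
proof
  fix x y z :: "'a padic"
  show "uniformity = (INF e\<in>{0 <..}. principal {(x, y :: 'a padic). dist x y < e})"
    by (rule uniformity_padic_def)
  show "open U \<longleftrightarrow> (\<forall>x\<in>U. eventually (\<lambda>(x', y). x' = x \<longrightarrow> y \<in> U) uniformity)"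
    for U :: "'a padic set" by (rule open_padic_def)
  show "dist x y = 0 \<longleftrightarrow> x = y" by (simp add: dist_padic_def padic_norm_eq_0_iff)
  show "dist x y \<le> dist x z + dist y z"
    using padic_norm_add[of "x - z" "z - y"] padic_norm_minus[of "z - y"]
      padic_norm_ge_0[of "x - z"] padic_norm_ge_0[of "y - z"]
    by (simp add: dist_padic_def)
qed

end

lemma padic_norm_of_rat: "padic_norm (of_rat q :: 'p::prime_card padic) = padic_abs CARD('p) q"
  using padic_norm_LIMSEQ[OF padic_Cauchy_const, where ?'p = 'p] by (simp add: Padic_of_rat LIMSEQ_const_iff)

lemma padic_rat_dense:
  fixes x :: "'p::prime_card padic"
  assumes "e > 0"
  obtains q where "padic_norm (x - of_rat q) < e"
proof (cases x)
  case (1 X)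
  obtain N where N: "\<And>m n. m \<ge> N \<Longrightarrow> n \<ge> N \<Longrightarrow> padic_abs CARD('p) (X m - X n) < e / 2"
    using 1(2) assms unfolding padic_Cauchy_def by (metis half_gt_zero)
  have c: "padic_Cauchy CARD('p) (\<lambda>n. X n - X N)"
    using padic_Cauchy_add[OF prime_card 1(2) padic_Cauchy_const[of _ "- X N"]] by simp
  have "(\<lambda>n. padic_abs CARD('p) (X n - X N)) \<longlonglongrightarrow> padic_norm (x - of_rat (X N))"
    using padic_norm_LIMSEQ[OF c] 1 by (simp add: Padic_of_rat Padic_diff padic_Cauchy_const)
  hence "padic_norm (x - of_rat (X N)) \<le> e / 2"
    by (rule LIMSEQ_le_const2) (use N in \<open>auto intro!: exI[of _ N] less_imp_le\<close>)
  thus ?thesis using that[of "X N"] assms by simp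
qed

instance padic :: (prime_card) complete_space
proof
  fix x :: "nat \<Rightarrow> 'a padic"
  assume x: "Cauchy x"
  have "\<exists>q. padic_norm (x n - of_rat q) < inverse (real (Suc n))" for n
    using padic_rat_dense[of "inverse (real (Suc n))" "x n"] by auto
  then obtain q where q: "\<And>n. padic_norm (x n - of_rat (q n)) < inverse (real (Suc n))" by metis
  have q': "(\<lambda>n. dist (x n) (of_rat (q n))) \<longlonglongrightarrow> 0"
    by (rule tendsto_sandwich[OF _ _ tendsto_const LIMSEQ_inverse_real_of_nat])
       (use q in \<open>auto simp: dist_padic_def padic_norm_ge_0 intro!: always_eventually less_imp_le\<close>)
  have C: "padic_Cauchy CARD('a) q"
    unfolding padic_Cauchy_def
  proof (intro allI impI)
    fix e :: real assume e: "e > 0"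
    obtain M where M: "\<And>m n. m \<ge> M \<Longrightarrow> n \<ge> M \<Longrightarrow> dist (x m) (x n) < e / 3"
      using metric_CauchyD[OF x, of "e / 3"] e by auto
    obtain K where K: "\<And>n. n \<ge> K \<Longrightarrow> dist (x n) (of_rat (q n)) < e / 3"
      using order_tendstoD(2)[OF q', of "e / 3"] e by (auto simp: eventually_sequentially)
    have "padic_abs CARD('a) (q m - q n) < e" if "m \<ge> max M K" "n \<ge> max M K" for m n
    proof -
      have "padic_abs CARD('a) (q m - q n) = dist (of_rat (q m) :: 'a padic) (of_rat (q n))"
        by (simp add: dist_padic_def padic_norm_of_rat flip: of_rat_diff)
      also have "\<dots> \<le> dist (x m) (of_rat (q m)) + dist (x m) (x n) + dist (x n) (of_rat (q n))"
        by metric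
      also have "\<dots> < e" using M[of m n] K[of m] K[of n] that by simp
      finally show ?thesis .
    qed
    thus "\<exists>N. \<forall>m\<ge>N. \<forall>n\<ge>N. padic_abs CARD('a) (q m - q n) < e" by blast
  qed
  have "(\<lambda>n. dist (x n) (Padic q)) \<longlonglongrightarrow> 0"
  proof (rule metric_LIMSEQ_I)
    fix e :: real assume e: "e > 0"
    obtain N where N: "\<And>m n. m \<ge> N \<Longrightarrow> n \<ge> N \<Longrightarrow> padic_abs CARD('a) (q m - q n) < e / 3"
      using C e unfolding padic_Cauchy_def by (metis divide_pos_pos zero_less_numeral)
    obtain K where K: "\<And>n. n \<ge> K \<Longrightarrow> dist (x n) (of_rat (q n)) < e / 3"
      using order_tendstoD(2)[OF q', of "e / 3"] e by (auto simp: eventually_sequentially)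
    have "dist (x n) (Padic q) < e" if n: "n \<ge> max N K" for n
    proof -
      have c: "padic_Cauchy CARD('a) (\<lambda>m. q m - q n)"
        using padic_Cauchy_add[OF prime_card C padic_Cauchy_const[of _ "- q n"]] by simp
      have "(\<lambda>m. padic_abs CARD('a) (q m - q n)) \<longlonglongrightarrow> dist (Padic q) (of_rat (q n) :: 'a padic)"
        using padic_norm_LIMSEQ[OF c] C
        by (simp add: dist_padic_def Padic_of_rat Padic_diff padic_Cauchy_const)
      hence "dist (Padic q) (of_rat (q n) :: 'a padic) \<le> e / 3"
        by (rule LIMSEQ_le_const2) (use N n in \<open>auto intro!: exI[of _ N] less_imp_le\<close>)
      moreover have "dist (x n) (Padic q)
          \<le> dist (x n) (of_rat (q n)) + dist (Padic q) (of_rat (q n) :: 'a padic)"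
        by (rule dist_triangle2)
      ultimately show ?thesis using K[of n] n e by simp
    qed
    thus "\<exists>no. \<forall>n\<ge>no. dist (dist (x n) (Padic q)) 0 < e"
      by (intro exI[of _ "max N K"]) simp
  qed
  thus "convergent x" unfolding convergent_def using tendsto_dist_iff by blast
qed


section \<open>$p$-adic integers, residues and powers\<close>

definition Zp :: "'p::prime_card padic set" where
  "Zp = {x. padic_norm x \<le> 1}"

definition padic_cong :: "'p::prime_card padic \<Rightarrow> 'p padic \<Rightarrow> nat \<Rightarrow> bool" where
  "padic_cong x y m \<longleftrightarrow> (\<exists>u\<in>Zp. x - y = of_nat m * u)"

definition padic_residue :: "'p::prime_card padic \<Rightarrow> nat" where
  "padic_residue x = (THE r. r < CARD('p) \<and> padic_cong x (of_nat r) CARD('p))"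

text \<open>
  The power $w^{a + s(p-1)}$ is a function of the pair $(a, s)$, not of the $p$-adic number
  $a + s(p-1)$ alone: $p - 1$ is a unit, so that number can be written with any integer $a$
  whatsoever and a suitable $s$, whereas the power depends on $a$ modulo $p-1$.
\<close>

definition padic_power :: "'p::prime_card padic \<Rightarrow> int \<Rightarrow> 'p padic \<Rightarrow> 'p padic" where
  "padic_power w a s = w powi a * (\<Sum>k. (s gchoose k) * (w ^ (CARD('p) - 1) - 1) ^ k)"

text \<open>
  Accordingly $\lambda_p(\alpha) = a + s(p-1)$ is recorded together with the presentation
  \<open>a = lambda_int \<alpha>\<close>, \<open>s = lambda_coeff \<alpha>\<close> in which it is defined.
\<close>

definition lambda_int :: "'p::prime_card padic \<Rightarrow> int" where
  "lambda_int \<alpha> = - int (padic_residue (- \<alpha>))"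

definition lambda_coeff :: "'p::prime_card padic \<Rightarrow> 'p padic" where
  "lambda_coeff \<alpha> = (\<alpha> + of_nat (padic_residue (- \<alpha>))) / of_nat CARD('p)"

definition padic_lambda :: "'p::prime_card padic \<Rightarrow> 'p padic" where
  "padic_lambda \<alpha> = of_int (lambda_int \<alpha>) + lambda_coeff \<alpha> * of_nat (CARD('p) - 1)"

lemma one_minus_two_lambda:
  fixes \<alpha> :: "'p::prime_card padic"
  shows "1 - 2 * padic_lambda \<alpha> =
    of_int (1 - 2 * lambda_int \<alpha>) + (- 2 * lambda_coeff \<alpha>) * of_nat (CARD('p) - 1)"
  by (simp add: padic_lambda_def algebra_simps)

definition trunc_hyp2F1 :: "'a::field_char_0 \<Rightarrow> 'a \<Rightarrow> 'a \<Rightarrow> 'a \<Rightarrow> nat \<Rightarrow> 'a" where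
  "trunc_hyp2F1 \<alpha> \<beta> \<gamma> z n =
     (\<Sum>k\<le>n. pochhammer \<alpha> k * pochhammer \<beta> k / pochhammer \<gamma> k * (z ^ k / fact k))"


subsection \<open>Residues and the binomial series are well defined\<close>

lemma padic_norm_0 [simp]: "padic_norm 0 = 0"
  by (simp add: padic_norm_eq_0_iff)

lemma padic_norm_of_int: "padic_norm (of_int a :: 'p::prime_card padic) = padic_abs CARD('p) (of_int a)"
  using padic_norm_of_rat[of "of_int a", where 'p = 'p] by simp

lemma padic_norm_of_int_le_1: "padic_norm (of_int a) \<le> 1"
  for a :: int
proof (cases "a = 0")
  case False
  thus ?thesis
    using prime_ge_1_nat[OF prime_card, where 'a1 = 'a]
    by (simp add: padic_norm_of_int padic_abs_of_int[OF prime_card] power_int_minus inverse_le_1_iff)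
qed auto

lemma padic_norm_1 [simp]: "padic_norm 1 = 1"
  using padic_norm_of_int[of 1] by (simp add: padic_abs_1 prime_card)

lemma padic_norm_diff: "padic_norm (x - y) \<le> max (padic_norm x) (padic_norm y)"
  using padic_norm_add[of x "- y"] by (simp add: padic_norm_minus)

lemma padic_norm_diff_commute: "padic_norm (x - y) = padic_norm (y - x)"
  using padic_norm_minus[of "x - y"] by simp

lemma padic_norm_inverse: "padic_norm (inverse x) = inverse (padic_norm x)"
proof (cases "x = 0")
  case False
  hence "padic_norm x * padic_norm (inverse x) = 1" by (simp flip: padic_norm_mult)
  thus ?thesis by (metis inverse_unique)
qed auto

lemma padic_norm_power: "padic_norm (x ^ n) = padic_norm x ^ n"
  by (induction n) (simp_all add: padic_norm_mult)

lemma padic_norm_CARD: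
  "padic_norm (of_nat CARD('p) :: 'p::prime_card padic) = inverse (real CARD('p))"
proof -
  have "multiplicity (int CARD('p)) (int CARD('p)) = 1"
    using prime_card[where 'a = 'p] by (intro multiplicity_self) auto
  thus ?thesis
    using padic_norm_of_int[of "int CARD('p)", where 'p = 'p]
      padic_abs_of_int[of "CARD('p)" "int CARD('p)"] prime_card[where 'a = 'p]
    by (simp add: power_int_minus)
qed

lemma Zp_of_int [simp]: "of_int a \<in> Zp"
  by (simp add: Zp_def padic_norm_of_int_le_1)

lemma Zp_of_nat [simp]: "of_nat a \<in> Zp"
  using Zp_of_int[of "int a"] by simp

lemma Zp_0 [simp]: "0 \<in> Zp" and Zp_1 [simp]: "1 \<in> Zp"
  by (simp_all add: Zp_def)

lemma Zp_add: "x \<in> Zp \<Longrightarrow> y \<in> Zp \<Longrightarrow> x + y \<in> Zp"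
  using padic_norm_add[of x y] by (simp add: Zp_def)

lemma Zp_diff: "x \<in> Zp \<Longrightarrow> y \<in> Zp \<Longrightarrow> x - y \<in> Zp"
  using padic_norm_diff[of x y] by (simp add: Zp_def)

lemma Zp_minus: "x \<in> Zp \<Longrightarrow> - x \<in> Zp"
  by (simp add: Zp_def padic_norm_minus)

lemma Zp_mult: "x \<in> Zp \<Longrightarrow> y \<in> Zp \<Longrightarrow> x * y \<in> Zp"
  using mult_le_one[of "padic_norm x" "padic_norm y"]
  by (simp add: Zp_def padic_norm_mult padic_norm_ge_0)

lemma Zp_power: "x \<in> Zp \<Longrightarrow> x ^ n \<in> Zp"
  by (induction n) (auto intro: Zp_mult)

lemma padic_norm_eq_rat:
  fixes x :: "'p::prime_card padic"
  assumes "x \<noteq> 0"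
  obtains q where "q \<noteq> 0" "padic_norm x = padic_abs CARD('p) q"
proof -
  obtain q where q: "padic_norm (x - of_rat q) < padic_norm x"
    using padic_rat_dense[of "padic_norm x" x] assms padic_norm_ge_0[of x]
    by (metis less_eq_real_def padic_norm_eq_0_iff)
  have "padic_norm x \<le> max (padic_norm (x - of_rat q)) (padic_norm (of_rat q :: 'p padic))"
    using padic_norm_add[of "x - of_rat q" "of_rat q"] by simp
  moreover have "padic_norm (of_rat q :: 'p padic) \<le> max (padic_norm x) (padic_norm (x - of_rat q))"
    using padic_norm_diff[of x "x - of_rat q"] by simp
  ultimately have "padic_norm x = padic_norm (of_rat q :: 'p padic)" using q by auto
  thus ?thesis using that[of q] assms
    by (metis padic_norm_of_rat of_rat_0 padic_norm_eq_0_iff)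
qed

lemma padic_norm_less_1_iff:
  fixes x :: "'p::prime_card padic"
  shows "padic_norm x < 1 \<longleftrightarrow> padic_cong x 0 CARD('p)"
proof
  have p0: "real CARD('p) > 1" using prime_gt_1_nat[OF prime_card, where 'a1 = 'p] by simp
  {
    assume "padic_cong x 0 CARD('p)"
    then obtain u where u: "u \<in> Zp" "x = of_nat CARD('p) * u" by (auto simp: padic_cong_def)
    have "padic_norm x = inverse (real CARD('p)) * padic_norm u"
      unfolding u(2) padic_norm_mult padic_norm_CARD ..
    also have "\<dots> \<le> inverse (real CARD('p)) * 1"
      using u(1) by (intro mult_left_mono) (auto simp: Zp_def)
    also have "\<dots> < 1" using p0 by (simp add: field_simps)
    finally show "padic_norm x < 1" .
  next
    assume lt: "padic_norm x < 1"
    show "padic_cong x 0 CARD('p)"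
    proof (cases "x = 0")
      case True
      thus ?thesis by (auto simp: padic_cong_def intro!: bexI[of _ 0])
    next
      case False
      then obtain q where q: "q \<noteq> 0" "padic_norm x = padic_abs CARD('p) q"
        using padic_norm_eq_rat by blast
      define k where "k = (case quotient_of q of (a, b) \<Rightarrow>
        int (multiplicity (int CARD('p)) b) - int (multiplicity (int CARD('p)) a))"
      have k: "padic_norm x = real CARD('p) powi k"
        using q by (simp add: padic_abs_def k_def case_prod_unfold Let_def)
      have "k < 0"
      proof (rule ccontr)
        assume "\<not> k < 0"
        hence "real CARD('p) powi 0 \<le> real CARD('p) powi k"
          using p0 by (intro power_int_increasing) auto
        thus False using lt k by simp
      qed
      hence "real CARD('p) powi k \<le> real CARD('p) powi (-1)"
        using p0 by (intro power_int_increasing) auto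
      hence le: "padic_norm x * real CARD('p) \<le> 1"
        using k p0 by (simp add: field_simps power_int_minus)
      have nz: "(of_nat CARD('p) :: 'p padic) \<noteq> 0" using p0 by (metis of_nat_eq_0_iff of_nat_0 not_one_less_zero)
      have "x * inverse (of_nat CARD('p)) \<in> Zp"
        unfolding Zp_def using le by (simp add: padic_norm_mult padic_norm_inverse padic_norm_CARD)
      moreover have "x - 0 = of_nat CARD('p) * (x * inverse (of_nat CARD('p)))"
        using nz by simp
      ultimately show ?thesis unfolding padic_cong_def by blast
    qed
  }
qed

lemma Zp_approx_nat:
  fixes x :: "'p::prime_card padic"
  assumes "x \<in> Zp" "e > 0"
  obtains n :: nat where "padic_norm (x - of_nat n) < e"
proof -
  define p where "p = int CARD('p)"
  have pp: "prime p" using prime_card[where 'a = 'p] by (simp add: p_def)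
  have p1: "real CARD('p) > 1" using prime_gt_1_nat[OF prime_card, where 'a1 = 'p] by simp
  obtain k where k: "inverse (real CARD('p)) ^ k < e"
    using real_arch_pow_inv[of e "inverse (real CARD('p))"] assms(2) p1 by (auto simp: field_simps)
  obtain q where q: "padic_norm (x - of_rat q) < min e 1"
    using padic_rat_dense[of "min e 1" x] assms by auto
  have q1: "padic_norm (of_rat q :: 'p padic) \<le> 1"
    using padic_norm_diff[of x "x - of_rat q"] q assms(1) by (auto simp: Zp_def)
  obtain a b where ab: "quotient_of q = (a, b)" by force
  have b: "b > 0" and qab: "q = of_int a / of_int b" and cop: "coprime a b"
    using quotient_of_div[OF ab] quotient_of_denom_pos[OF ab] quotient_of_coprime[OF ab] by auto
  have pb: "\<not> p dvd b"
  proof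
    assume dvd: "p dvd b"
    hence "\<not> p dvd a" using cop pp by (meson coprime_common_divisor not_prime_unit)
    hence a0: "a \<noteq> 0" and "multiplicity p a = 0" by (auto simp: not_dvd_imp_multiplicity_0)
    moreover have "multiplicity p b \<ge> 1" using dvd b pp
      by (metis One_nat_def Suc_leI less_irrefl not_prime_unit prime_multiplicity_gt_zero_iff prime_imp_prime_elem)
    moreover have "padic_norm (of_rat q :: 'p padic) =
        real CARD('p) powi (int (multiplicity p b) - int (multiplicity p a))"
      unfolding padic_norm_of_rat qab p_def using a0 b by (intro padic_abs_Fract prime_card) auto
    ultimately have "padic_norm (of_rat q :: 'p padic) \<ge> real CARD('p) powi 1"
      using p1 by (simp only:) (intro power_int_increasing, auto)
    thus False using q1 p1 by simp
  qed
  hence "coprime p b" using pp by (intro prime_imp_coprime)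
  hence "coprime b (p ^ k)" by (simp add: coprime_commute)
  then obtain c where c: "[b * c = 1] (mod p ^ k)" using cong_solve_coprime_int by blast
  define n where "n = (a * c) mod p ^ k"
  have n0: "n \<ge> 0" using pp by (simp add: n_def prime_gt_0_int)
  have "[b * n = a * (b * c)] (mod p ^ k)" unfolding n_def by (simp add: cong_def mod_simps ac_simps)
  also have "[a * (b * c) = a * 1] (mod p ^ k)" using c by (rule cong_scalar_left)
  finally have "p ^ k dvd b * n - a" by (simp add: cong_iff_dvd_diff)
  then obtain t where t: "b * n - a = p ^ k * t" by (elim dvdE)
  have nb: "padic_norm (of_int b :: 'p padic) = 1"
    using pb b by (simp add: padic_norm_of_int padic_abs_of_int[OF prime_card]
        not_dvd_imp_multiplicity_0 p_def)
  have "padic_norm (of_nat (nat n) - of_rat q :: 'p padic)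
      = padic_norm (of_int b * (of_nat (nat n) - of_rat q) :: 'p padic)"
    by (simp add: padic_norm_mult nb)
  also have "of_int b * (of_nat (nat n) - of_rat q) = (of_int (b * n - a) :: 'p padic)"
    using b n0 by (simp add: qab of_rat_divide field_simps)
  also have "\<dots> = of_nat CARD('p) ^ k * of_int t" unfolding t by (simp add: p_def)
  also have "padic_norm \<dots> \<le> inverse (real CARD('p)) ^ k * 1"
    unfolding padic_norm_mult padic_norm_power padic_norm_CARD
    by (intro mult_left_mono padic_norm_of_int_le_1) auto
  also have "\<dots> < e" using k by simp
  finally have *: "padic_norm (of_rat q - of_nat (nat n) :: 'p padic) < e"
    by (simp add: padic_norm_diff_commute)
  have "padic_norm (x - of_nat (nat n)) < e"
    using padic_norm_add[of "x - of_rat q" "of_rat q - of_nat (nat n)"] * q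
    by (auto simp: max_def split: if_splits)
  thus ?thesis using that by blast
qed

lemma padic_cong_CARD_iff:
  fixes x :: "'p::prime_card padic"
  shows "padic_cong x y CARD('p) \<longleftrightarrow> padic_norm (x - y) < 1"
  unfolding padic_norm_less_1_iff by (simp add: padic_cong_def)

lemma padic_norm_of_int_less_1_iff:
  "padic_norm (of_int a :: 'p::prime_card padic) < 1 \<longleftrightarrow> int CARD('p) dvd a"
proof (cases "a = 0")
  case False
  have p1: "real CARD('p) > 1" using prime_gt_1_nat[OF prime_card, where 'a1 = 'p] by simp
  have "int CARD('p) dvd a \<longleftrightarrow> multiplicity (int CARD('p)) a > 0"
    using False prime_card[where 'a = 'p] by (simp add: prime_multiplicity_gt_zero_iff)
  moreover have "1 < real CARD('p) ^ m \<longleftrightarrow> m > 0" for m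
    using p1 by (cases "m = 0") (auto intro: one_less_power)
  moreover have "\<not> real CARD('p) ^ m \<le> 0" for m using p1 by (simp add: not_le)
  ultimately show ?thesis using False
    by (simp add: padic_norm_of_int padic_abs_of_int[OF prime_card] power_int_minus inverse_less_1_iff
        del: of_nat_power)
qed auto

lemma padic_residue_ex1:
  fixes x :: "'p::prime_card padic"
  assumes "x \<in> Zp"
  shows "\<exists>!r. r < CARD('p) \<and> padic_cong x (of_nat r) CARD('p)"
proof -
  have *: "padic_norm (of_nat m - of_nat n :: 'p padic) < 1 \<longleftrightarrow> m mod CARD('p) = n mod CARD('p)" for m n
  proof -
    have "padic_norm (of_nat m - of_nat n :: 'p padic) < 1 \<longleftrightarrow> int CARD('p) dvd int m - int n"
      using padic_norm_of_int_less_1_iff[of "int m - int n", where 'p = 'p] by simp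
    thus ?thesis by (metis mod_eq_dvd_iff of_nat_eq_iff zmod_int)
  qed
  obtain n where n: "padic_norm (x - of_nat n) < 1" using Zp_approx_nat[OF assms, of 1] by auto
  have iff: "padic_norm (x - of_nat r) < 1 \<longleftrightarrow> n mod CARD('p) = r mod CARD('p)" for r
  proof
    assume "padic_norm (x - of_nat r) < 1"
    hence "padic_norm ((x - of_nat r) - (x - of_nat n)) < 1"
      using n padic_norm_diff[of "x - of_nat r" "x - of_nat n"] by simp
    thus "n mod CARD('p) = r mod CARD('p)" using *[of n r] by simp
  next
    assume "n mod CARD('p) = r mod CARD('p)"
    hence "padic_norm (of_nat n - of_nat r :: 'p padic) < 1" using * by blast
    thus "padic_norm (x - of_nat r) < 1"
      using n padic_norm_add[of "x - of_nat n" "of_nat n - of_nat r"] by simp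
  qed
  show ?thesis unfolding padic_cong_CARD_iff iff
    by (rule ex1I[of _ "n mod CARD('p)"]) auto
qed

lemma padic_residue:
  fixes x :: "'p::prime_card padic"
  assumes "x \<in> Zp"
  shows "padic_residue x < CARD('p)" "padic_cong x (of_nat (padic_residue x)) CARD('p)"
  using theI'[OF padic_residue_ex1[OF assms]] unfolding padic_residue_def by auto

lemma lambda_coeff_Zp:
  fixes \<alpha> :: "'p::prime_card padic"
  assumes "\<alpha> \<in> Zp"
  shows "lambda_coeff \<alpha> \<in> Zp"
proof -
  obtain u where u: "u \<in> Zp" "- \<alpha> - of_nat (padic_residue (- \<alpha>)) = of_nat CARD('p) * u"
    using padic_residue(2)[OF Zp_minus[OF assms]] unfolding padic_cong_def by blast
  have "(of_nat CARD('p) :: 'p padic) \<noteq> 0" by simp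
  moreover have "\<alpha> + of_nat (padic_residue (- \<alpha>)) = of_nat CARD('p) * (- u)"
    using u(2) by (simp add: algebra_simps) (metis add.commute add_diff_cancel_left' minus_diff_eq diff_minus_eq_add)
  ultimately have "lambda_coeff \<alpha> = - u" unfolding lambda_coeff_def by (simp add: field_simps)
  thus ?thesis using Zp_minus[OF u(1)] by simp
qed

lemma gchoose_Zp:
  fixes s :: "'p::prime_card padic"
  assumes "s \<in> Zp"
  shows "(s gchoose k) \<in> Zp"
proof -
  have f: "padic_norm (fact k :: 'p padic) > 0"
    using padic_norm_ge_0[of "fact k :: 'p padic"] padic_norm_eq_0_iff[of "fact k :: 'p padic"]
    by (simp add: less_le)
  obtain n :: nat where n: "padic_norm (s - of_nat n) < padic_norm (fact k :: 'p padic)"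
    using Zp_approx_nat[OF assms f] .
  have prod: "(\<Prod>i<j. s - of_nat i) \<in> Zp" for j
    by (induction j) (auto intro!: Zp_mult Zp_diff assms)
  have "padic_norm ((\<Prod>i<j. s - of_nat i) - (\<Prod>i<j. of_nat n - of_nat i)) \<le> padic_norm (s - of_nat n)" for j
  proof (induction j)
    case (Suc j)
    let ?P = "\<Prod>i<j. s - of_nat i" and ?Q = "\<Prod>i<j. of_nat n - of_nat i :: 'p padic"
    have eq: "?P * (s - of_nat j) - ?Q * (of_nat n - of_nat j)
        = ?P * (s - of_nat n) + (?P - ?Q) * of_int (int n - int j)" by (simp add: algebra_simps)
    have "padic_norm (?P * (s - of_nat n)) \<le> 1 * padic_norm (s - of_nat n)"
      unfolding padic_norm_mult using prod[of j] padic_norm_ge_0 by (intro mult_right_mono) (auto simp: Zp_def)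
    moreover have "padic_norm ((?P - ?Q) * of_int (int n - int j)) \<le> padic_norm (s - of_nat n) * 1"
      unfolding padic_norm_mult
      by (rule mult_mono[OF Suc padic_norm_of_int_le_1 padic_norm_ge_0 padic_norm_ge_0])
    ultimately show ?case
      using padic_norm_add[of "?P * (s - of_nat n)" "(?P - ?Q) * of_int (int n - int j)"]
      by (simp add: eq)
  qed (simp add: padic_norm_ge_0)
  hence "padic_norm (fact k * (s gchoose k) - fact k * (of_nat n gchoose k)) < padic_norm (fact k :: 'p padic)"
    using n by (simp add: gbinomial_prod_rev atLeast0LessThan) (rule le_less_trans)
  hence "padic_norm (fact k * ((s gchoose k) - (of_nat n gchoose k))) < padic_norm (fact k :: 'p padic)"
    by (simp add: right_diff_distrib)
  hence "padic_norm ((s gchoose k) - (of_nat n gchoose k)) < 1"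
    using f by (simp add: padic_norm_mult)
  hence "(s gchoose k) - of_nat (n choose k) \<in> Zp" by (simp add: Zp_def binomial_gbinomial)
  thus ?thesis using Zp_add[OF _ Zp_of_nat[of "n choose k"]] by fastforce
qed

lemma padic_summable:
  fixes f :: "nat \<Rightarrow> 'p::prime_card padic"
  assumes "(\<lambda>n. padic_norm (f n)) \<longlonglongrightarrow> 0"
  shows "summable f"
proof -
  have "Cauchy (\<lambda>n. \<Sum>k<n. f k)"
  proof (rule metric_CauchyI)
    fix e :: real assume e: "e > 0"
    obtain N where N: "\<And>n. n \<ge> N \<Longrightarrow> padic_norm (f n) < e"
      using order_tendstoD(2)[OF assms e] by (auto simp: eventually_sequentially)
    have *: "padic_norm ((\<Sum>k<n. f k) - (\<Sum>k<N. f k)) < e" if "n \<ge> N" for n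
      using that
    proof (induction n rule: dec_induct)
      case (step n)
      thus ?case using N[of n] padic_norm_add[of "(\<Sum>k<n. f k) - (\<Sum>k<N. f k)" "f n"]
        by (simp add: algebra_simps)
    qed (use e in auto)
    have "dist (\<Sum>k<m. f k) (\<Sum>k<n. f k) < e" if "m \<ge> N" "n \<ge> N" for m n
      using *[OF that(1)] *[OF that(2)]
        padic_norm_diff[of "(\<Sum>k<m. f k) - (\<Sum>k<N. f k)" "(\<Sum>k<n. f k) - (\<Sum>k<N. f k)"]
      by (simp add: dist_padic_def)
    thus "\<exists>M. \<forall>m\<ge>M. \<forall>n\<ge>M. dist (\<Sum>k<m. f k) (\<Sum>k<n. f k) < e" by blast
  qed
  thus ?thesis unfolding summable_iff_convergent Cauchy_convergent_iff .
qed

lemma padic_power_summable: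
  fixes w s :: "'p::prime_card padic"
  assumes "w \<in> Zp" "\<not> padic_cong w 0 CARD('p)" "s \<in> Zp"
  shows "summable (\<lambda>k. (s gchoose k) * (w ^ (CARD('p) - 1) - 1) ^ k)"
proof -
  define P where "P = CARD('p)"
  have P: "prime P" using prime_card[where 'a = 'p] by (simp add: P_def)
  define r where "r = padic_residue w"
  have wr: "padic_norm (w - of_nat r) < 1"
    using padic_residue(2)[OF assms(1)] unfolding padic_cong_CARD_iff r_def .
  have "\<not> P dvd r"
  proof
    assume "P dvd r"
    hence "padic_norm (of_nat r :: 'p padic) < 1"
      using padic_norm_of_int_less_1_iff[of "int r", where 'p = 'p] by (simp add: P_def)
    hence "padic_norm w < 1" using wr padic_norm_add[of "w - of_nat r" "of_nat r"] by simp
    thus False using assms(2) by (simp add: padic_norm_less_1_iff)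
  qed
  hence "[r ^ (P - 1) = 1] (mod P)" using fermat_theorem[OF P] by blast
  hence "int P dvd int r ^ (P - 1) - 1"
    by (metis cong_iff_dvd_diff cong_int_iff of_nat_1 of_nat_power)
  hence rP: "padic_norm (of_nat r ^ (P - 1) - 1 :: 'p padic) < 1"
    using padic_norm_of_int_less_1_iff[of "int r ^ (P - 1) - 1", where 'p = 'p] by (simp add: P_def)
  have "padic_norm (w ^ n - of_nat r ^ n) < 1" for n
  proof (induction n)
    case (Suc n)
    have "padic_norm (w * (w ^ n - of_nat r ^ n)) < 1"
      unfolding padic_norm_mult
      by (rule le_less_trans[OF mult_left_le_one_le[OF padic_norm_ge_0 padic_norm_ge_0] Suc])
         (use assms(1) in \<open>simp add: Zp_def\<close>)
    moreover have "padic_norm ((w - of_nat r) * of_nat r ^ n) < 1"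
      unfolding padic_norm_mult
      by (rule le_less_trans[OF mult_right_le_one_le[OF padic_norm_ge_0 padic_norm_ge_0] wr])
         (use Zp_power[OF Zp_of_nat[of r, where 'a = 'p], of n] in \<open>simp add: Zp_def\<close>)
    moreover have "w ^ Suc n - of_nat r ^ Suc n
        = w * (w ^ n - of_nat r ^ n) + (w - of_nat r) * of_nat r ^ n" by (simp add: algebra_simps)
    ultimately show ?case
      using padic_norm_add[of "w * (w ^ n - of_nat r ^ n)" "(w - of_nat r) * of_nat r ^ n"] by simp
  qed auto
  from this[of "P - 1"] have x: "padic_norm (w ^ (P - 1) - 1) < 1"
    using rP padic_norm_add[of "w ^ (P - 1) - of_nat r ^ (P - 1)" "of_nat r ^ (P - 1) - 1"] by simp
  have "(\<lambda>k. padic_norm ((s gchoose k) * (w ^ (P - 1) - 1) ^ k)) \<longlonglongrightarrow> 0"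
  proof (rule tendsto_sandwich[OF _ _ tendsto_const])
    show "(\<lambda>k. padic_norm (w ^ (P - 1) - 1) ^ k) \<longlonglongrightarrow> 0"
      using x by (intro LIMSEQ_power_zero) (simp add: abs_of_nonneg padic_norm_ge_0)
    show "\<forall>\<^sub>F k in sequentially. padic_norm ((s gchoose k) * (w ^ (P - 1) - 1) ^ k)
        \<le> padic_norm (w ^ (P - 1) - 1) ^ k"
      using gchoose_Zp[OF assms(3)] padic_norm_ge_0
      by (intro always_eventually)
         (auto simp: padic_norm_mult padic_norm_power Zp_def intro!: mult_left_le_one_le)
  qed (auto intro!: always_eventually padic_norm_ge_0)
  thus ?thesis unfolding P_def by (rule padic_summable)
qed

end

theory Submission
  imports Defs
begin

text \<open>
  Write $\alpha = -a + ps$ with $a = \langle-\alpha\rangle_p$. Both sides of the congruence are,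
  modulo $p^2$, affine in $s$, because $(\alpha)_k \equiv (-a)_k + s((-a)_k - (-a-p)_k)$. So
  everything reduces to the parameters $-a$ and $-a-p$, where the hypergeometric sums terminate and
  the classical quadratic transformation
  ${}_2F_1(-n, b; 2b; 4z/(1+z)^2) = (1+z)^{-2n} {}_2F_1(-n, 1/2-b-n; b+1/2; z^2)$ is available. For $n = a$ it
  is used with $b = 1/2$. The difference of the two parameters is divisible by $p$, so in it $b$
  matters only modulo $p$, and $b = 1/2$ is replaced by $b = (1-p)/2$. At $n = a + p$ the
  terms of index at least $p$ of the transformed sum add up to $-C z^p$ times the instance
  $b = (1+p)/2$, $n = a$, where $C \equiv 2 + 2pH_a$ modulo $p^2$ with the harmonic number $H_a$, by
  Morley's congruence. Expanding all coefficients to first order in $p$ makes both sides agree.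
\<close>

text \<open>The sums stop at p - 1, whereas the one with parameter -a-p terminates only at a + p, so
  its terms of index at least p must be removed in closed form. The value b = (1-p)/2 is chosen for
  this purpose: moving the index by p carries its coefficient recurrence exactly to that of b =
  (1+p)/2, up to factors which the binomial coefficients cancel, so the removed part is again an
  instance of the transformation. The price is that b and 2b are negative integers. The quotient
  (b)_k / (2b)_k becomes 0/0, and the recurrence loses its leading factor just before index p, so
  the coefficient at index p has to be computed separately; this is where 2^p modulo p^2 enters. The
  sums with squared coefficients need no such correction, since their terms with a < k < p are
  divisible by p^2.\<close>

section \<open>A quadratic transformation\<close>

text \<open>
  This is $4^k (b)_k / (2b)_k$ with the common zeros of numerator and denominator cancelled, which
  keeps it meaningful for $b = (1-p)/2$.
\<close>

definition beta_moment :: "'a::field_char_0 \<Rightarrow> nat \<Rightarrow> 'a" where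
  "beta_moment b k = 2 ^ k * pochhammer (b + of_nat (Suc k div 2)) (k div 2)
     / pochhammer (b + 1 / 2) (k div 2)"

lemma beta_moment_0 [simp]: "beta_moment b 0 = 1"
  and beta_moment_1 [simp]: "beta_moment b (Suc 0) = 2"
  by (simp_all add: beta_moment_def)

text \<open>This is the ratio of consecutive terms of 4^k (b)_k / (2b)_k, left multiplied out
  because k + 2b may vanish. The proof splits by parity because the Pochhammer symbols in
  \<open>beta_moment\<close> have length \<open>k div 2\<close>.\<close>

lemma beta_moment_Suc:
  fixes b :: "'a::field_char_0"
  assumes "\<And>i. b + 1 / 2 + of_nat i \<noteq> 0"
  shows "(of_nat k + 2 * b) * beta_moment b (Suc k) = 4 * (of_nat k + b) * beta_moment b k"
proof (cases "even k")
  case True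
  then obtain i where k: "k = 2 * i" by (elim evenE)
  have "(b + of_nat i) * pochhammer (b + of_nat i + 1) i
      = pochhammer (b + of_nat i) i * (b + 2 * of_nat i)"
    using pochhammer_rec[of "b + of_nat i" i] pochhammer_rec'[of "b + of_nat i" i]
    by (simp add: algebra_simps)
  hence *: "(b + of_nat i) * pochhammer (b + of_nat (Suc i)) i
      = pochhammer (b + of_nat i) i * (b + 2 * of_nat i)" by (simp add: add_ac)
  have "(of_nat k + 2 * b) * beta_moment b (Suc k)
      = 4 * 2 ^ k * ((b + of_nat i) * pochhammer (b + of_nat (Suc i)) i) / pochhammer (b + 1 / 2) i"
    by (simp add: beta_moment_def k algebra_simps)
  thus ?thesis unfolding * by (simp add: beta_moment_def k algebra_simps)
next
  case False
  then obtain i where k: "k = 2 * i + 1" by (elim oddE)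
  have nz: "b + 1 / 2 + of_nat i \<noteq> 0" using assms .
  define G X where "G = b + 1 / 2 + of_nat i" and "X = pochhammer (b + of_nat (Suc i)) i"
  have k2: "of_nat k + 2 * b = 2 * G" by (simp add: G_def k algebra_simps)
  have q1: "beta_moment b k = 2 ^ k * X / pochhammer (b + 1 / 2) i"
    by (simp add: beta_moment_def k X_def)
  have "beta_moment b (Suc k) = 2 * 2 ^ k * (X * (b + of_nat k)) / (pochhammer (b + 1 / 2) i * G)"
    by (simp add: beta_moment_def k X_def G_def pochhammer_Suc add_ac)
  moreover have "G \<noteq> 0" unfolding G_def by (rule nz)
  ultimately show ?thesis unfolding k2 q1 by (simp add: add_ac)
qed

section \<open>Binomial sums of moments and their three-term recurrence\<close>

definition moment_sum :: "(nat \<Rightarrow> 'a::comm_ring_1) \<Rightarrow> 'a \<Rightarrow> 'a \<Rightarrow> nat \<Rightarrow> 'a" where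
  "moment_sum q x y n = (\<Sum>k\<le>n. of_nat (n choose k) * x ^ k * y ^ (n - k) * q k)"

lemma moment_sum_0 [simp]: "moment_sum q x y 0 = q 0"
  by (simp add: moment_sum_def)

text \<open>If \<open>q k\<close> is read as L(T^k) for a linear functional L, then
  \<open>moment_sum q x y n\<close> is L((xT + y)^n), and one factor is split off. For
  \<open>beta_moment b\<close> one may think of T as 4 times a Beta(b, b) variable.\<close>

lemma moment_sum_Suc:
  "moment_sum q x y (Suc n) = y * moment_sum q x y n + x * moment_sum (\<lambda>k. q (Suc k)) x y n"
proof -
  have "moment_sum q x y (Suc n) = y ^ Suc n * q 0
      + (\<Sum>k\<le>n. (of_nat (n choose k) + of_nat (n choose Suc k)) * x ^ Suc k * y ^ (n - k) * q (Suc k))"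
    unfolding moment_sum_def sum.atMost_Suc_shift by simp
  also have "\<dots> = (y ^ Suc n * q 0 + (\<Sum>k\<le>n. of_nat (n choose Suc k) * x ^ Suc k * y ^ (n - k) * q (Suc k)))
      + x * moment_sum (\<lambda>k. q (Suc k)) x y n"
    unfolding moment_sum_def sum_distrib_left by (simp add: algebra_simps sum.distrib)
  also have "y ^ Suc n * q 0 + (\<Sum>k\<le>n. of_nat (n choose Suc k) * x ^ Suc k * y ^ (n - k) * q (Suc k))
      = (\<Sum>k\<le>Suc n. of_nat (n choose k) * x ^ k * y ^ (Suc n - k) * q k)"
    unfolding sum.atMost_Suc_shift by simp
  also have "\<dots> = (\<Sum>k\<le>n. of_nat (n choose k) * x ^ k * y ^ (Suc n - k) * q k)"
    by (simp add: binomial_eq_0)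
  also have "\<dots> = y * moment_sum q x y n"
    unfolding moment_sum_def sum_distrib_left
    by (intro sum.cong) (simp_all add: Suc_diff_le mult_ac)
  finally show ?thesis .
qed

text \<open>Absorption k C(n+1,k) = (n+1) C(n,k-1); in the functional reading, T d/dT applied to (xT
  + y)^(n+1).\<close>

lemma moment_sum_of_nat_mult:
  "moment_sum (\<lambda>k. of_nat k * q k) x y (Suc n)
     = of_nat (Suc n) * x * moment_sum (\<lambda>k. q (Suc k)) x y n"
proof -
  have "moment_sum (\<lambda>k. of_nat k * q k) x y (Suc n)
      = (\<Sum>k\<le>n. (of_nat (Suc k * (Suc n choose Suc k))) * x ^ Suc k * y ^ (n - k) * q (Suc k))"
    unfolding moment_sum_def sum.atMost_Suc_shift by (simp add: algebra_simps)
  also have "\<dots> = of_nat (Suc n) * x * moment_sum (\<lambda>k. q (Suc k)) x y n"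
    unfolding moment_sum_def sum_distrib_left Suc_times_binomial
    by (simp only: of_nat_mult power_Suc mult_ac)
  finally show ?thesis .
qed

lemma moment_sum_linear:
  "moment_sum (\<lambda>k. c * q k + d * r k) x y n = c * moment_sum q x y n + d * moment_sum r x y n"
  unfolding moment_sum_def sum_distrib_left sum.distrib[symmetric]
  by (rule sum.cong) (simp_all add: algebra_simps)

text \<open>Summing the recurrence of \<open>q\<close> against the binomial weights gives a linear
  relation among shifted sums, and splitting off factors eliminates the shifts. The result is the
  recurrence of the Gegenbauer polynomials of parameter b, normalised to value 1 at 1 and made
  homogeneous.\<close>

lemma moment_sum_recurrence:
  fixes q :: "nat \<Rightarrow> 'a::comm_ring_1"
  assumes q: "\<And>k. (of_nat k + 2 * b) * q (Suc k) = 4 * (of_nat k + b) * q k"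
  shows "(of_nat (Suc n) + 2 * b) * moment_sum q x y (Suc (Suc n))
    = 2 * (of_nat (Suc n) + b) * (y + 2 * x) * moment_sum q x y (Suc n)
      - of_nat (Suc n) * (y * (y + 4 * x)) * moment_sum q x y n"
proof -
  define V V1 V2 where "V = moment_sum q x y" and "V1 = moment_sum (\<lambda>k. q (Suc k)) x y"
    and "V2 = moment_sum (\<lambda>k. q (Suc (Suc k))) x y"
  have s: "V (Suc n) = y * V n + x * V1 n" "V (Suc (Suc n)) = y * V (Suc n) + x * V1 (Suc n)"
    "V1 (Suc n) = y * V1 n + x * V2 n"
    unfolding V_def V1_def V2_def by (rule moment_sum_Suc)+
  have "(\<lambda>k. 1 * (of_nat k * q (Suc k)) + (2 * b) * q (Suc k))
      = (\<lambda>k. 4 * (of_nat k * q k) + (4 * b) * q k)"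
    using q by (simp add: fun_eq_iff algebra_simps)
  hence "moment_sum (\<lambda>k. 1 * (of_nat k * q (Suc k)) + (2 * b) * q (Suc k)) x y (Suc n)
      = moment_sum (\<lambda>k. 4 * (of_nat k * q k) + (4 * b) * q k) x y (Suc n)" by simp
  hence *: "of_nat (Suc n) * x * V2 n + 2 * b * V1 (Suc n)
      = 4 * (of_nat (Suc n) * x * V1 n) + 4 * b * V (Suc n)"
    unfolding moment_sum_linear V_def V1_def V2_def moment_sum_of_nat_mult by simp
  define N :: 'a where "N = of_nat (Suc n)"
  \<comment> \<open>Substituting \<open>s\<close> turns the defect of the recurrence into
    \<open>x\<close> times the defect of \<open>*\<close>, so no division is involved.\<close>
  have "(N + 2 * b) * V (Suc (Suc n)) - (2 * (N + b) * (y + 2 * x) * V (Suc n) - N * (y * (y + 4 * x)) * V n)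
      = x * ((N * x * V2 n + 2 * b * V1 (Suc n)) - (4 * (N * x * V1 n) + 4 * b * V (Suc n)))"
    unfolding s by (simp add: algebra_simps)
  also have "\<dots> = 0" using * unfolding N_def by simp
  finally show ?thesis unfolding V_def N_def by simp
qed

section \<open>Coefficients of a product of two Bessel-type series\<close>

definition bessel_coeff :: "'a::field_char_0 \<Rightarrow> nat \<Rightarrow> 'a" where
  "bessel_coeff g j = 1 / (fact j * pochhammer g j)"

text \<open>The coefficient of X^n in 0F1(;g;X) 0F1(;g;tX), a product of two Bessel functions up to
  normalisation.\<close>

definition bessel_product :: "'a::field_char_0 \<Rightarrow> 'a \<Rightarrow> nat \<Rightarrow> 'a" where
  "bessel_product g t n = (\<Sum>j\<le>n. bessel_coeff g (n - j) * bessel_coeff g j * t ^ j)"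

lemma bessel_coeff_Suc:
  assumes "\<And>i. g + of_nat i \<noteq> 0"
  shows "of_nat (Suc i) * (g + of_nat i) * bessel_coeff g (Suc i) = bessel_coeff g i"
proof -
  have "(of_nat (Suc i) :: 'a) \<noteq> 0" by (simp only: of_nat_eq_0_iff)
  thus ?thesis using assms[of i] unfolding bessel_coeff_def pochhammer_Suc fact_Suc by simp
qed

text \<open>The weight \<open>e i\<close> lowers the index of a coefficient, the discrete form of
  the Bessel differential equation. It lifts all three products to degree n + 2, where the
  recurrence becomes a polynomial identity in i and j with i + j = n + 2.\<close>

lemma bessel_product_recurrence:
  fixes g :: "'a::field_char_0" and n :: nat
  assumes g: "\<And>i. g + of_nat i \<noteq> 0"
  defines "N \<equiv> of_nat (Suc n)"
  shows "(N + (2 * g - 1)) * ((N + 1) * (g + N)) * (g + N - 1) * bessel_product g t (Suc (Suc n))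
     = (2 * N + (2 * g - 1)) * (g + N - 1) * (1 + t) * bessel_product g t (Suc n)
        - (1 - t)\<^sup>2 * bessel_product g t n"
proof -
  define a where "a = bessel_coeff g"
  define e :: "nat \<Rightarrow> 'a" where "e i = of_nat i * (g + of_nat i - 1)" for i
  define S where "S f m = (\<Sum>j\<le>m. f (m - j) j * (a (m - j) * a j * t ^ j))" for f m
  have a: "e (Suc i) * a (Suc i) = a i" for i
    using bessel_coeff_Suc[OF g, of i] by (simp add: a_def e_def)
  have e0: "e 0 = 0" by (simp add: e_def)
  have B: "bessel_product g t m = S (\<lambda>_ _. 1) m" for m
    by (simp add: bessel_product_def S_def a_def)
  have e_Suc: "e (Suc m - j) * a (Suc m - j) = a (m - j)" if "j \<le> m" for j m
    using a[of "m - j"] that by (simp add: Suc_diff_le)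
  \<comment> \<open>Lowering in the first factor. The summand with first index 0 drops out because
    \<open>e 0\<close> is 0, which also makes the truncated \<open>i - 1\<close> harmless.\<close>
  have S1: "S f m = S (\<lambda>i j. e i * f (i - 1) j) (Suc m)" for f m
  proof -
    have "S (\<lambda>i j. e i * f (i - 1) j) (Suc m)
        = (\<Sum>j\<le>m. f (m - j) j * ((e (Suc m - j) * a (Suc m - j)) * a j * t ^ j))"
      unfolding S_def sum.atMost_Suc by (simp add: e0 mult_ac)
    also have "\<dots> = S f m" unfolding S_def by (intro sum.cong refl) (simp add: e_Suc)
    finally show ?thesis ..
  qed
  have S2: "t * S f m = S (\<lambda>i j. e j * f i (j - 1)) (Suc m)" for f m
  proof -
    have "S (\<lambda>i j. e j * f i (j - 1)) (Suc m)
        = (\<Sum>j\<le>m. f (m - j) j * (a (m - j) * (e (Suc j) * a (Suc j)) * (t * t ^ j)))"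
      unfolding S_def sum.atMost_Suc_shift by (simp add: e0 mult_ac)
    also have "\<dots> = t * S f m"
      unfolding S_def sum_distrib_left a by (simp only: mult_ac)
    finally show ?thesis ..
  qed
  define M where "M = Suc (Suc n)"
  have 1: "bessel_product g t (Suc n) = S (\<lambda>i j. e i) M" "t * bessel_product g t (Suc n) = S (\<lambda>i j. e j) M"
    using S1[of "\<lambda>_ _. 1" "Suc n"] S2[of "\<lambda>_ _. 1" "Suc n"] unfolding B M_def by simp_all
  have 2: "bessel_product g t n = S (\<lambda>i j. e i * e (i - 1)) M"
    "t * bessel_product g t n = S (\<lambda>i j. e i * e j) M"
    "t * (t * bessel_product g t n) = S (\<lambda>i j. e j * e (j - 1)) M"
    using S1[of "\<lambda>_ _. 1" n] S2[of "\<lambda>_ _. 1" n] S1[of "\<lambda>i j. e i" "Suc n"]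
      S2[of "\<lambda>i j. e i" "Suc n"] S2[of "\<lambda>i j. e j" "Suc n"]
    unfolding B M_def by (simp_all add: mult.commute)
  have "(2 * N + (2 * g - 1)) * (g + N - 1) * (1 + t) * bessel_product g t (Suc n)
        - (1 - t)\<^sup>2 * bessel_product g t n
      = (2 * N + (2 * g - 1)) * (g + N - 1) * (S (\<lambda>i j. e i) M + S (\<lambda>i j. e j) M)
        - (S (\<lambda>i j. e i * e (i - 1)) M - 2 * S (\<lambda>i j. e i * e j) M + S (\<lambda>i j. e j * e (j - 1)) M)"
    unfolding 1[symmetric] 2[symmetric] by (simp add: algebra_simps power2_eq_square)
  also have "\<dots> = S (\<lambda>i j. (2 * N + (2 * g - 1)) * (g + N - 1) * (e i + e j)
        - (e i * e (i - 1) - 2 * (e i * e j) + e j * e (j - 1))) M"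
    unfolding S_def sum_distrib_left sum.distrib[symmetric] sum_subtractf[symmetric]
    by (rule sum.cong) (simp_all add: algebra_simps)
  also have "\<dots> = S (\<lambda>i j. (N + (2 * g - 1)) * ((N + 1) * (g + N)) * (g + N - 1)) M"
    unfolding S_def
  proof (intro sum.cong refl arg_cong2[where f = "(*)"])
    fix j assume "j \<in> {..M}"
    define i where "i = M - j"
    have N: "N = of_nat i + of_nat j - 1"
      using \<open>j \<in> {..M}\<close> unfolding i_def M_def N_def by simp
    have ee: "e k * e (k - 1) = e k * ((of_nat k - 1) * (g + of_nat k - 2))" for k
      by (cases k) (simp_all add: e_def algebra_simps)
    show "(2 * N + (2 * g - 1)) * (g + N - 1) * (e (M - j) + e j)
        - (e (M - j) * e (M - j - 1) - 2 * (e (M - j) * e j) + e j * e (j - 1))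
      = (N + (2 * g - 1)) * ((N + 1) * (g + N)) * (g + N - 1)"
      unfolding i_def[symmetric] ee unfolding e_def N by (simp add: algebra_simps)
  qed
  also have "\<dots> = (N + (2 * g - 1)) * ((N + 1) * (g + N)) * (g + N - 1) * bessel_product g t M"
    by (simp add: S_def B sum_distrib_left mult_ac)
  finally show ?thesis by (simp add: M_def)
qed

text \<open>Both sides satisfy the same three-term recurrence and agree at n = 0 and n = 1. The
  hypothesis keeps its leading factor nonzero, and it also covers the denominators because 2(b + 1/2
  + i) = 2b + 2i + 1.\<close>

lemma moment_sum_eq_bessel_product:
  fixes b z :: "'a::field_char_0"
  assumes b: "\<And>i. 2 * b + of_nat i \<noteq> 0"
  shows "moment_sum (beta_moment b) (- z) ((1 + z)\<^sup>2) n
    = fact n * pochhammer (b + 1 / 2) n * bessel_product (b + 1 / 2) (z\<^sup>2) n"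
proof -
  define g where "g = b + 1 / 2"
  have g: "g + of_nat i \<noteq> 0" for i
  proof
    assume "g + of_nat i = 0"
    moreover have "2 * b + of_nat (Suc (2 * i)) = 2 * (g + of_nat i)" by (simp add: g_def algebra_simps)
    ultimately have "2 * b + of_nat (Suc (2 * i)) = 0" by simp
    thus False using b by blast
  qed
  have q: "(of_nat k + 2 * b) * beta_moment b (Suc k) = 4 * (of_nat k + b) * beta_moment b k" for k
    by (rule beta_moment_Suc) (use g in \<open>simp add: g_def\<close>)
  define V where "V = moment_sum (beta_moment b) (- z) ((1 + z)\<^sup>2)"
  define B where "B = bessel_product g (z\<^sup>2)"
  define R where "R n = fact n * pochhammer g n * B n" for n
  have V_rec: "(of_nat (Suc n) + 2 * b) * V (Suc (Suc n))
      = 2 * (of_nat (Suc n) + b) * (1 + z\<^sup>2) * V (Suc n) - of_nat (Suc n) * (1 - z\<^sup>2)\<^sup>2 * V n" for n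
  proof -
    \<comment> \<open>For these arguments the coefficients of the recurrence depend on z only
      through z^2.\<close>
    have *: "(1 + z)\<^sup>2 + 2 * - z = 1 + z\<^sup>2" "(1 + z)\<^sup>2 * ((1 + z)\<^sup>2 + 4 * - z) = (1 - z\<^sup>2)\<^sup>2"
      by (simp_all add: power2_eq_square algebra_simps)
    show ?thesis using moment_sum_recurrence[OF q, of n "- z" "(1 + z)\<^sup>2"] unfolding * V_def .
  qed
  have "V n = R n \<and> V (Suc n) = R (Suc n)"
  proof (induction n)
    case 0
    have "g \<noteq> 0" using g[of 0] by simp
    hence "R 1 = 1 + z\<^sup>2"
      by (simp add: R_def B_def bessel_product_def bessel_coeff_def) (simp add: field_simps)
    moreover have "V 1 = 1 + z\<^sup>2"
      by (simp add: V_def moment_sum_Suc power2_eq_square algebra_simps)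
    ultimately show ?case by (simp add: R_def V_def B_def bessel_product_def bessel_coeff_def)
  next
    case (Suc n)
    define N :: 'a where "N = of_nat (Suc n)"
    define F where "F = fact n * pochhammer g n"
    have nz: "N + 2 * b \<noteq> 0" using b[of "Suc n"] by (simp add: N_def add_ac)
    have gb: "2 * g - 1 = 2 * b" by (simp add: g_def)
    have gN: "g + of_nat n = g + N - 1" "g + of_nat (Suc n) = g + N" by (simp_all add: N_def)
    have fN: "fact (Suc n) = N * fact n" "fact (Suc (Suc n)) = (N + 1) * (N * (fact n :: 'a))"
      unfolding N_def by (simp_all only: fact_Suc of_nat_Suc add_ac)
    have RS: "R n = F * B n" "R (Suc n) = N * (g + N - 1) * F * B (Suc n)"
      "R (Suc (Suc n)) = (N + 1) * (g + N) * (N * (g + N - 1) * F) * B (Suc (Suc n))"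
      unfolding R_def F_def fN pochhammer_Suc gN by (simp_all only: mult_ac)
    have B_rec: "(N + 2 * b) * ((N + 1) * (g + N)) * (g + N - 1) * B (Suc (Suc n))
        = (2 * N + 2 * b) * (g + N - 1) * (1 + z\<^sup>2) * B (Suc n) - (1 - z\<^sup>2)\<^sup>2 * B n"
      using bessel_product_recurrence[OF g, of n "z\<^sup>2"] unfolding B_def N_def gb .
    have "(N + 2 * b) * V (Suc (Suc n)) = 2 * (N + b) * (1 + z\<^sup>2) * R (Suc n) - N * (1 - z\<^sup>2)\<^sup>2 * R n"
      using V_rec[of n] Suc.IH unfolding N_def by simp
    also have "\<dots> = N * F * ((2 * N + 2 * b) * (g + N - 1) * (1 + z\<^sup>2) * B (Suc n) - (1 - z\<^sup>2)\<^sup>2 * B n)"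
      unfolding RS by (simp add: algebra_simps)
    also have "\<dots> = (N + 2 * b) * R (Suc (Suc n))"
      unfolding B_rec[symmetric] RS by (simp only: mult_ac)
    finally have "V (Suc (Suc n)) = R (Suc (Suc n))" using nz by simp
    thus ?case using Suc.IH by blast
  qed
  thus ?thesis by (simp add: V_def R_def B_def g_def)
qed

lemma poly_pochhammer: "poly (pochhammer q n) x = pochhammer (poly q x) n"
  for q :: "'a::comm_ring_1 poly"
  by (induction n) (simp_all add: pochhammer_Suc)

text \<open>This is 2F1(-n, 1-g-n; g; t), a Jacobi polynomial after a change of variable, written so
  that the symmetry of j and n - j is visible.\<close>

definition jacobi_sum :: "'a::field_char_0 \<Rightarrow> nat \<Rightarrow> 'a \<Rightarrow> 'a" where
  "jacobi_sum g n t = (\<Sum>j\<le>n. of_nat (n choose j) * pochhammer g n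
     / (pochhammer g j * pochhammer g (n - j)) * t ^ j)"

lemma jacobi_sum_eq_bessel_product:
  "jacobi_sum g n t = fact n * pochhammer g n * bessel_product g t n"
  unfolding jacobi_sum_def bessel_product_def bessel_coeff_def sum_distrib_left
  by (intro sum.cong refl) (simp add: binomial_fact mult_ac)

text \<open>
  The recurrence above degenerates when $2b + n = 0$, so the general case is deduced from positive
  integers $b$: after clearing denominators both sides are polynomials in $b$.
\<close>

lemma quadratic_transformation:
  fixes b z :: "'a::field_char_0"
  assumes b: "pochhammer (b + 1 / 2) n \<noteq> 0"
  shows "moment_sum (beta_moment b) (- z) ((1 + z)\<^sup>2) n = jacobi_sum (b + 1 / 2) n (z\<^sup>2)"
proof -
  define P :: "'a poly" where "P = (\<Sum>k\<le>n. Polynomial.smult (of_nat (n choose k) * (- z) ^ k * ((1 + z)\<^sup>2) ^ (n - k) * 2 ^ k)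
      (pochhammer [:of_nat (Suc k div 2), 1:] (k div 2) * pochhammer [:1 / 2 + of_nat (k div 2), 1:] (n - k div 2)))"
  define Q :: "'a poly" where "Q = (\<Sum>j\<le>n. Polynomial.smult (of_nat (n choose j) * (z\<^sup>2) ^ j)
      (pochhammer [:1 / 2 + of_nat j, 1:] (n - j) * pochhammer [:1 / 2 + of_nat (n - j), 1:] j))"
  have P: "poly P x = moment_sum (beta_moment x) (- z) ((1 + z)\<^sup>2) n * pochhammer (x + 1 / 2) n"
    if x: "pochhammer (x + 1 / 2) n \<noteq> 0" for x
    unfolding P_def moment_sum_def poly_sum sum_distrib_right
  proof (rule sum.cong)
    fix k assume "k \<in> {..n}"
    hence "k div 2 \<le> n" by simp
    hence split: "pochhammer (x + 1 / 2) n
        = pochhammer (x + 1 / 2) (k div 2) * pochhammer (x + 1 / 2 + of_nat (k div 2)) (n - k div 2)"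
      by (rule pochhammer_product)
    have e: "x + of_nat (Suc k div 2) = of_nat (Suc k div 2) + x"
      "x + 1 / 2 + of_nat (k div 2) = 1 / 2 + of_nat (k div 2) + x" by (simp_all only: add_ac)
    have "pochhammer (x + 1 / 2) (k div 2) \<noteq> 0" using x unfolding split by simp
    hence "beta_moment x k * pochhammer (x + 1 / 2) n
        = 2 ^ k * pochhammer (of_nat (Suc k div 2) + x) (k div 2)
            * pochhammer (1 / 2 + of_nat (k div 2) + x) (n - k div 2)"
      unfolding beta_moment_def split e by simp
    thus "poly (Polynomial.smult (of_nat (n choose k) * (- z) ^ k * ((1 + z)\<^sup>2) ^ (n - k) * 2 ^ k)
          (pochhammer [:of_nat (Suc k div 2), 1:] (k div 2)
            * pochhammer [:1 / 2 + of_nat (k div 2), 1:] (n - k div 2))) x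
        = of_nat (n choose k) * (- z) ^ k * ((1 + z)\<^sup>2) ^ (n - k) * beta_moment x k
            * pochhammer (x + 1 / 2) n"
      by (simp add: poly_pochhammer mult.assoc)
  qed simp
  have Q: "poly Q x = jacobi_sum (x + 1 / 2) n (z\<^sup>2) * pochhammer (x + 1 / 2) n"
    if x: "pochhammer (x + 1 / 2) n \<noteq> 0" for x
    unfolding Q_def jacobi_sum_def poly_sum sum_distrib_right
  proof (rule sum.cong)
    fix j assume j: "j \<in> {..n}"
    let ?g = "x + 1 / 2"
    have 1: "pochhammer ?g n = pochhammer ?g j * pochhammer (?g + of_nat j) (n - j)"
      using pochhammer_product[of j n ?g] j by simp
    have 2: "pochhammer ?g n = pochhammer ?g (n - j) * pochhammer (?g + of_nat (n - j)) j"
      using pochhammer_product[of "n - j" n ?g] j by simp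
    have e: "?g + of_nat i = 1 / 2 + of_nat i + x" for i by (simp only: add_ac)
    have nz: "pochhammer ?g j \<noteq> 0" "pochhammer ?g (n - j) \<noteq> 0" using x 1 2 by auto
    have 3: "pochhammer ?g n / pochhammer ?g j = pochhammer (1 / 2 + of_nat j + x) (n - j)"
      unfolding 1 e using nz by simp
    have 4: "pochhammer ?g n / pochhammer ?g (n - j) = pochhammer (1 / 2 + of_nat (n - j) + x) j"
      unfolding 2 e using nz by simp
    have "of_nat (n choose j) * pochhammer ?g n / (pochhammer ?g j * pochhammer ?g (n - j)) * (z\<^sup>2) ^ j * pochhammer ?g n
        = of_nat (n choose j) * (z\<^sup>2) ^ j
          * ((pochhammer ?g n / pochhammer ?g j) * (pochhammer ?g n / pochhammer ?g (n - j)))"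
      by simp
    thus "poly (Polynomial.smult (of_nat (n choose j) * (z\<^sup>2) ^ j)
          (pochhammer [:1 / 2 + of_nat j, 1:] (n - j) * pochhammer [:1 / 2 + of_nat (n - j), 1:] j)) x
        = of_nat (n choose j) * pochhammer ?g n / (pochhammer ?g j * pochhammer ?g (n - j)) * (z\<^sup>2) ^ j
            * pochhammer ?g n"
      unfolding 3 4 by (simp add: poly_pochhammer)
  qed simp
  have "P = Q"
  proof (rule ccontr)
    assume "P \<noteq> Q"
    hence "finite {x. poly (P - Q) x = 0}" by (intro poly_roots_finite) simp
    moreover have "range (\<lambda>m. of_nat (Suc m)) \<subseteq> {x. poly (P - Q) x = 0}"
    proof clarify
      fix m
      define x :: 'a where "x = of_nat (Suc m)"
      have 1: "2 * x + of_nat i \<noteq> 0" for i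
      proof -
          have "2 * x + of_nat i = of_nat (Suc (Suc (2 * m + i)))" by (simp add: x_def)
          thus ?thesis by (simp only: of_nat_eq_0_iff)
        qed
      have "pochhammer (x + 1 / 2) n \<noteq> 0"
      proof
        assume "pochhammer (x + 1 / 2) n = 0"
        then obtain k where "x + 1 / 2 = - of_nat k" by (auto simp: pochhammer_eq_0_iff)
        moreover have "2 * x + of_nat (Suc (2 * k)) = 2 * ((x + 1 / 2) + of_nat k)"
          by (simp add: algebra_simps)
        ultimately have "2 * x + of_nat (Suc (2 * k)) = 0" by simp
        thus False using 1 by blast
      qed
      thus "poly (P - Q) x = 0"
        using P[of x] Q[of x] moment_sum_eq_bessel_product[OF 1, of z n]
        by (simp add: jacobi_sum_eq_bessel_product)
    qed
    moreover have "infinite (range (\<lambda>m. of_nat (Suc m) :: 'a))"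
      by (intro range_inj_infinite injI) simp
    ultimately show False using finite_subset by blast
  qed
  thus ?thesis using P[OF b] Q[OF b] b by simp
qed

section \<open>Congruences between $p$-adic integers\<close>

text \<open>
  The modulus comes first so that \<open>\<dots>\<close> in calculations refers to the right-hand side.
\<close>

definition zcong :: "nat \<Rightarrow> 'p::prime_card padic \<Rightarrow> 'p padic \<Rightarrow> bool" where
  "zcong m x y \<longleftrightarrow> padic_cong x y m"

abbreviation cong_p :: "'p::prime_card padic \<Rightarrow> 'p padic \<Rightarrow> bool" (infix "\<equiv>\<^sub>1" 50)
  where "x \<equiv>\<^sub>1 y \<equiv> zcong CARD('p) x y"

abbreviation cong_p2 :: "'p::prime_card padic \<Rightarrow> 'p padic \<Rightarrow> bool" (infix "\<equiv>\<^sub>2" 50)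
  where "x \<equiv>\<^sub>2 y \<equiv> zcong (CARD('p)\<^sup>2) x y"

lemma zcongI: "x - y = of_nat m * u \<Longrightarrow> u \<in> Zp \<Longrightarrow> zcong m x y"
  unfolding zcong_def padic_cong_def by blast

lemma zcongE:
  assumes "zcong m x y"
  obtains u where "u \<in> Zp" "x = y + of_nat m * u"
  using assms unfolding zcong_def padic_cong_def by (metis add.commute diff_add_cancel)

lemma zcong_refl [simp]: "zcong m x x"
  by (rule zcongI[of _ _ _ 0]) simp_all

lemma zcong_diff:
  assumes "zcong m x x'" "zcong m y y'"
  shows "zcong m (x - y) (x' - y')"
proof -
  obtain u v where uv: "u \<in> Zp" "v \<in> Zp" "x = x' + of_nat m * u" "y = y' + of_nat m * v"
    using assms by (elim zcongE)
  show ?thesis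
    by (rule zcongI[of _ _ _ "u - v"]) (simp_all add: uv Zp_diff algebra_simps)
qed

lemma zcong_sym:
  assumes "zcong m x y"
  shows "zcong m y x"
proof -
  obtain u where u: "u \<in> Zp" "x = y + of_nat m * u" using assms by (elim zcongE)
  show ?thesis
    by (rule zcongI[of _ _ _ "- u"]) (simp_all add: u Zp_minus)
qed

lemma zcong_add:
  assumes "zcong m x x'" "zcong m y y'"
  shows "zcong m (x + y) (x' + y')"
proof -
  obtain u v where uv: "u \<in> Zp" "v \<in> Zp" "x = x' + of_nat m * u" "y = y' + of_nat m * v"
    using assms by (elim zcongE)
  show ?thesis
    by (rule zcongI[of _ _ _ "u + v"]) (simp_all add: uv Zp_add algebra_simps)
qed

lemma zcong_trans [trans]:
  assumes "zcong m x y" "zcong m y z"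
  shows "zcong m x z"
proof -
  obtain u v where uv: "u \<in> Zp" "v \<in> Zp" "x = y + of_nat m * u" "y = z + of_nat m * v"
    using assms by (elim zcongE)
  show ?thesis
    by (rule zcongI[of _ _ _ "u + v"]) (simp_all add: uv Zp_add algebra_simps)
qed

lemma zcong_mult:
  assumes "zcong m x x'" "zcong m y y'" "x' \<in> Zp" "y' \<in> Zp"
  shows "zcong m (x * y) (x' * y')"
proof -
  obtain u v where uv: "u \<in> Zp" "v \<in> Zp" "x = x' + of_nat m * u" "y = y' + of_nat m * v"
    using assms(1,2) by (elim zcongE)
  have "x * y - x' * y' = of_nat m * (u * y' + (x' + of_nat m * u) * v)"
    unfolding uv by (simp add: algebra_simps)
  thus ?thesis by (rule zcongI) (intro Zp_add Zp_mult uv assms Zp_of_nat)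
qed

lemma zcong_mult_left:
  assumes "zcong m x y" "c \<in> Zp"
  shows "zcong m (c * x) (c * y)"
proof -
  obtain u where u: "u \<in> Zp" "x = y + of_nat m * u" using assms(1) by (elim zcongE)
  show ?thesis
    by (rule zcongI[of _ _ _ "c * u"]) (simp_all add: u assms Zp_mult algebra_simps)
qed

lemma zcong_mult_right: "zcong m x y \<Longrightarrow> c \<in> Zp \<Longrightarrow> zcong m (x * c) (y * c)"
  using zcong_mult_left[of m x y c] by (simp add: mult.commute)

lemma zcong_Zp: "zcong m x y \<Longrightarrow> y \<in> Zp \<Longrightarrow> x \<in> Zp"
  by (elim zcongE) (auto intro!: Zp_add Zp_mult)

lemma zcong_power:
  assumes "zcong m x y" "y \<in> Zp"
  shows "zcong m (x ^ n) (y ^ n)"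
  by (induction n) (auto intro!: zcong_mult assms Zp_power)

lemma zcong_sum: "(\<And>i. i \<in> A \<Longrightarrow> zcong m (f i) (g i)) \<Longrightarrow> zcong m (sum f A) (sum g A)"
  by (induction A rule: infinite_finite_induct) (auto intro!: zcong_add)

lemma Zp_sum: "(\<And>i. i \<in> A \<Longrightarrow> f i \<in> Zp) \<Longrightarrow> sum f A \<in> Zp"
  by (induction A rule: infinite_finite_induct) (auto intro!: Zp_add)

lemma Zp_inverse: "padic_norm x = 1 \<Longrightarrow> inverse x \<in> Zp"
  by (simp add: Zp_def padic_norm_inverse)

lemma Zp_divide: "x \<in> Zp \<Longrightarrow> padic_norm y = 1 \<Longrightarrow> x / y \<in> Zp"
  by (simp add: divide_inverse Zp_mult Zp_inverse)

lemma zcong_cancel_left: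
  assumes "zcong m (c * x) (c * y)" "padic_norm c = 1"
  shows "zcong m x y"
proof -
  have "c \<noteq> 0" using assms(2) by auto
  thus ?thesis using zcong_mult_left[OF assms(1) Zp_inverse[OF assms(2)]]
    by (simp flip: mult.assoc)
qed

lemma zcong_divide_left:
  assumes "zcong m x (c * y)" "padic_norm c = 1"
  shows "zcong m (x / c) y"
proof -
  have "c \<noteq> 0" using assms(2) by auto
  hence "c * (x / c) = x" by simp
  hence "zcong m (c * (x / c)) (c * y)" using assms(1) by (simp only:)
  thus ?thesis using assms(2) by (rule zcong_cancel_left)
qed

lemma zcong_divide:
  assumes "zcong m x y" "padic_norm c = 1"
  shows "zcong m (x / c) (y / c)"
  using zcong_mult_right[OF assms(1) Zp_inverse[OF assms(2)]] by (simp add: divide_inverse)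

section \<open>Powers of p, units and Pochhammer symbols\<close>

definition harmonic :: "nat \<Rightarrow> 'a::field" where
  "harmonic n = (\<Sum>i<n. 1 / of_nat (Suc i))"

lemma harmonic_0 [simp]: "harmonic 0 = 0"
  and harmonic_Suc: "harmonic (Suc n) = harmonic n + 1 / of_nat (Suc n)"
  by (simp_all add: harmonic_def)

locale padic_prime =
  fixes P :: "'p::prime_card padic"
  assumes P_def: "P = of_nat CARD('p)"
begin

lemma cong_p2_imp_cong_p:
  assumes "x \<equiv>\<^sub>2 y"
  shows "x \<equiv>\<^sub>1 (y :: 'p padic)"
proof -
  obtain u where u: "u \<in> Zp" "x = y + of_nat (CARD('p)\<^sup>2) * u" using assms by (elim zcongE)
  show ?thesis
    by (rule zcongI[of _ _ _ "of_nat CARD('p) * u"])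
       (simp_all add: u power2_eq_square Zp_mult mult.assoc)
qed

lemma cong_p_mult_P:
  assumes "x \<equiv>\<^sub>1 y"
  shows "P * x \<equiv>\<^sub>2 P * y"
proof -
  obtain u where u: "u \<in> Zp" "x = y + of_nat CARD('p) * u" using assms by (elim zcongE)
  show ?thesis
    by (rule zcongI[of _ _ _ u]) (simp_all add: u P_def power2_eq_square algebra_simps)
qed

text \<open>Next to a factor divisible by p the other factor matters only modulo p. This permits the
  exchange of b = 1/2 for b = (1-p)/2.\<close>

lemma cong_p_0_mult:
  fixes x y z :: "'p padic"
  assumes "x \<equiv>\<^sub>1 0" "y \<equiv>\<^sub>1 z"
  shows "x * y \<equiv>\<^sub>2 x * z"
proof -
  obtain u v where "u \<in> Zp" "x = 0 + of_nat CARD('p) * u" "v \<in> Zp" "y = z + of_nat CARD('p) * v"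
    using assms by (elim zcongE)
  thus ?thesis
    by (intro zcongI[OF _ Zp_mult[of u v]]) (simp_all add: power2_eq_square algebra_simps)
qed

lemma cong_p2_P2: "u \<in> Zp \<Longrightarrow> x - y = P ^ 2 * u \<Longrightarrow> x \<equiv>\<^sub>2 y"
  by (rule zcongI) (simp_all add: P_def)

lemma cong_p_P_mult: "u \<in> Zp \<Longrightarrow> P * u \<equiv>\<^sub>1 0"
  by (rule zcongI) (simp_all add: P_def)

lemma P_Zp: "P \<in> Zp"
  by (simp add: P_def)

lemma padic_norm_of_nat_unit: "0 < k \<Longrightarrow> k < CARD('p) \<Longrightarrow> padic_norm (of_nat k :: 'p padic) = 1"
  using padic_norm_of_int_less_1_iff[of "int k", where 'p = 'p] padic_norm_of_int_le_1[of "int k", where 'a = 'p]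
    zdvd_imp_le[of "int CARD('p)" "int k"]
  by force

lemma padic_norm_fact_unit: "k < CARD('p) \<Longrightarrow> padic_norm (fact k :: 'p padic) = 1"
  by (induction k) (simp_all add: padic_norm_mult padic_norm_of_nat_unit del: of_nat_Suc)

lemma padic_norm_unit_iff: "x \<in> Zp \<Longrightarrow> padic_norm (x :: 'p padic) = 1 \<longleftrightarrow> \<not> x \<equiv>\<^sub>1 0"
  unfolding zcong_def padic_norm_less_1_iff[symmetric] Zp_def by auto

lemma padic_norm_zcong_unit:
  assumes "x \<equiv>\<^sub>1 y" "y \<in> Zp" "padic_norm y = 1"
  shows "padic_norm (x :: 'p padic) = 1"
proof -
  have x: "x \<in> Zp" using zcong_Zp assms by blast
  have "\<not> x \<equiv>\<^sub>1 0" using assms padic_norm_unit_iff zcong_sym zcong_trans by blast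
  thus ?thesis using padic_norm_unit_iff[OF x] by simp
qed

lemma pochhammer_Zp: "x \<in> Zp \<Longrightarrow> pochhammer x n \<in> Zp" for x :: "'p padic"
  by (induction n) (auto simp: pochhammer_Suc intro!: Zp_mult Zp_add)

lemma pochhammer_cong_p_0:
  assumes "x \<in> Zp" "i < n" "x + of_nat i \<equiv>\<^sub>1 (0 :: 'p padic)"
  shows "pochhammer x n \<equiv>\<^sub>1 0"
proof -
  have "pochhammer x (Suc i) \<equiv>\<^sub>1 pochhammer x i * 0"
    unfolding pochhammer_Suc by (intro zcong_mult_left assms pochhammer_Zp)
  hence "pochhammer x (Suc i) * pochhammer (x + of_nat (Suc i)) (n - Suc i) \<equiv>\<^sub>1 0"
    using zcong_mult_right[of _ _ 0 "pochhammer (x + of_nat (Suc i)) (n - Suc i)"]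
    by (simp add: pochhammer_Zp Zp_add assms del: of_nat_Suc)
  thus ?thesis using pochhammer_product[of "Suc i" n x] assms by simp
qed

lemma padic_norm_pos: "x \<noteq> 0 \<Longrightarrow> padic_norm x > 0" for x :: "'p padic"
  using padic_norm_ge_0[of x] padic_norm_eq_0_iff[of x] by (simp add: less_le)

lemma fact_Zp: "(fact k :: 'p padic) \<in> Zp"
  by (metis Zp_of_nat of_nat_fact)

lemma harmonic_Zp: "n < CARD('p) \<Longrightarrow> harmonic n \<in> (Zp :: 'p padic set)"
  by (induction n) (auto simp: harmonic_Suc padic_norm_of_nat_unit simp del: of_nat_Suc
      intro!: Zp_add Zp_divide)

text \<open>A product of factors N + Px in which N runs from c + 1 to c + j; these are units since
  they stay below p, and the logarithmic derivative contributes the sum of their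
  reciprocals.\<close>

lemma pochhammer_first_order:
  assumes "x \<in> Zp" "c + j < CARD('p)"
  shows "pochhammer (1 + of_nat c + P * x) j
    \<equiv>\<^sub>2 fact (c + j) / fact c * (1 + P * x * (harmonic (c + j) - harmonic c))"
  using assms(2)
proof (induction j)
  case (Suc j)
  define F :: "'p padic" where "F = fact (c + j) / fact c"
  define N :: "'p padic" where "N = of_nat (Suc (c + j))"
  define H :: "'p padic" where "H = harmonic (c + j) - harmonic c"
  have N: "padic_norm N = 1" "N \<noteq> 0"
    using Suc.prems padic_norm_of_nat_unit[of "Suc (c + j)"] unfolding N_def of_nat_eq_0_iff by simp_all
  have Zp: "F \<in> Zp" "H \<in> Zp" "N \<in> Zp"
    unfolding F_def H_def N_def using Suc.prems
    by (intro Zp_divide Zp_diff harmonic_Zp padic_norm_fact_unit fact_Zp Zp_of_nat; simp)+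
  have "pochhammer (1 + of_nat c + P * x) (Suc j)
      = pochhammer (1 + of_nat c + P * x) j * (N + P * x)"
    by (simp add: pochhammer_Suc N_def algebra_simps)
  also have "\<dots> \<equiv>\<^sub>2 F * (1 + P * x * H) * (N + P * x)"
    using Suc.IH Suc.prems unfolding F_def H_def
    by (intro zcong_mult_right Zp_add Zp_mult Zp P_Zp assms(1)) simp
  also have "\<dots> \<equiv>\<^sub>2 N * F * (1 + P * x * (H + 1 / N))"
  proof (rule cong_p2_P2[of "x * x * H * F"])
    show "x * x * H * F \<in> Zp" by (intro Zp_mult Zp assms(1))
    have "N * (H + 1 / N) = N * H + 1" using N(2) by (simp add: distrib_left)
    moreover have "N * F * (1 + P * x * (H + 1 / N)) = F * (N + P * x * (N * (H + 1 / N)))"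
      by (simp only: distrib_left mult_ac mult_1_right mult_1_left)
    ultimately have "N * F * (1 + P * x * (H + 1 / N)) = F * (N + P * x * (N * H + 1))" by simp
    thus "F * (1 + P * x * H) * (N + P * x) - N * F * (1 + P * x * (H + 1 / N)) = P\<^sup>2 * (x * x * H * F)"
      by (simp add: power2_eq_square algebra_simps)
  qed
  also have "N * F = fact (c + Suc j) / fact c"
    by (simp add: F_def N_def)
  also have "H + 1 / N = harmonic (c + Suc j) - harmonic c"
    by (simp add: H_def N_def harmonic_Suc)
  finally show ?case .
qed auto

text \<open>The slope \<open>d\<close> does not depend on \<open>s\<close>, so it can later be
  recovered from the single value at s = -1.\<close>

lemma pochhammer_linear:
  assumes "x \<in> Zp"
  obtains d where "d \<in> Zp" "\<And>s. s \<in> Zp \<Longrightarrow> pochhammer (x + P * s) k \<equiv>\<^sub>2 pochhammer x k + P * s * d"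
proof -
  have "\<exists>d\<in>Zp. \<forall>s\<in>Zp. pochhammer (x + P * s) k \<equiv>\<^sub>2 pochhammer x k + P * s * d"
  proof (induction k)
    case (Suc k)
    then obtain d where d: "d \<in> Zp"
      "\<And>s. s \<in> Zp \<Longrightarrow> pochhammer (x + P * s) k \<equiv>\<^sub>2 pochhammer x k + P * s * d" by blast
    have "pochhammer (x + P * s) (Suc k)
        \<equiv>\<^sub>2 pochhammer x (Suc k) + P * s * (d * (x + of_nat k) + pochhammer x k)" if s: "s \<in> Zp" for s
    proof -
      have "pochhammer (x + P * s) (Suc k) \<equiv>\<^sub>2 (pochhammer x k + P * s * d) * (x + P * s + of_nat k)"
        unfolding pochhammer_Suc
        by (intro zcong_mult_right d Zp_add Zp_mult Zp_of_nat assms s P_Zp)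
      also have "\<dots> \<equiv>\<^sub>2 pochhammer x (Suc k) + P * s * (d * (x + of_nat k) + pochhammer x k)"
        by (rule cong_p2_P2[of "s * s * d"])
           (simp_all add: d s Zp_mult pochhammer_Suc power2_eq_square algebra_simps)
      finally show ?thesis .
    qed
    moreover have "d * (x + of_nat k) + pochhammer x k \<in> Zp"
      using d assms by (intro Zp_add Zp_mult pochhammer_Zp) auto
    ultimately show ?case by blast
  qed (auto intro!: bexI[of _ 0])
  thus ?thesis using that by blast
qed

section \<open>Fermat's little theorem and p-adic powers\<close>

lemma fermat_cong: "x \<in> Zp \<Longrightarrow> x ^ CARD('p) \<equiv>\<^sub>1 (x :: 'p padic)"
proof -
  assume x: "x \<in> Zp"
  define r where "r = padic_residue x"
  have xr: "x \<equiv>\<^sub>1 of_nat r" using padic_residue(2)[OF x] by (simp add: r_def zcong_def)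
  have pr: "prime CARD('p)" by (rule prime_card)
  have "[r ^ CARD('p) = r] (mod CARD('p))"
  proof (cases "CARD('p) dvd r")
    case True
    thus ?thesis using pr by (simp add: cong_def prime_gt_0_nat dvd_trans[OF _ dvd_power])
  next
    case False
    hence "[r ^ (CARD('p) - 1) * r = 1 * r] (mod CARD('p))"
      by (intro cong_scalar_right fermat_theorem pr)
    moreover have "r ^ (CARD('p) - 1) * r = r ^ CARD('p)"
      using pr by (metis power_minus_mult prime_gt_0_nat)
    ultimately show ?thesis by simp
  qed
  hence "int CARD('p) dvd int (r ^ CARD('p)) - int r"
    by (metis cong_iff_dvd_diff cong_int_iff)
  then obtain t where t: "int (r ^ CARD('p)) - int r = int CARD('p) * t" by (elim dvdE)
  have "of_nat (r ^ CARD('p)) - of_nat r = (of_int (int (r ^ CARD('p)) - int r) :: 'p padic)" by simp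
  also have "\<dots> = of_nat CARD('p) * of_int t" unfolding t by simp
  finally have rr: "of_nat (r ^ CARD('p)) \<equiv>\<^sub>1 (of_nat r :: 'p padic)"
    by (rule zcongI) simp
  have "x ^ CARD('p) \<equiv>\<^sub>1 of_nat (r ^ CARD('p))"
    using zcong_power[OF xr Zp_of_nat] by simp
  also note rr
  also have "of_nat r \<equiv>\<^sub>1 x" using xr by (rule zcong_sym)
  finally show ?thesis .
qed

lemma fermat_cong_unit:
  assumes "x \<in> Zp" "padic_norm (x :: 'p padic) = 1"
  shows "x ^ (CARD('p) - 1) \<equiv>\<^sub>1 1"
proof (rule zcong_cancel_left[OF _ assms(2)])
  have "x * x ^ (CARD('p) - 1) = x ^ CARD('p)"
    using prime_card[where 'a = 'p] by (metis power_eq_if prime_gt_0_nat less_numeral_extra(3))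
  thus "x * x ^ (CARD('p) - 1) \<equiv>\<^sub>1 x * 1" using fermat_cong[OF assms(1)] by simp
qed

lemma padic_norm_le_imp_cong_p2:
  assumes "padic_norm (x - y :: 'p padic) \<le> padic_norm (P ^ 2)"
  shows "x \<equiv>\<^sub>2 y"
proof (rule cong_p2_P2[of "(x - y) / P ^ 2"])
  have P: "P \<noteq> 0" "P ^ 2 \<noteq> 0" by (simp_all add: P_def)
  hence "padic_norm (P ^ 2) > 0"
    by (intro padic_norm_pos)
  thus "(x - y) / P ^ 2 \<in> Zp" using assms
    by (simp add: Zp_def divide_inverse padic_norm_mult padic_norm_inverse)
       (simp add: field_simps)
  show "x - y = P ^ 2 * ((x - y) / P ^ 2)" using P by simp
qed

text \<open>The series may be cut after its linear term: w^(p-1) - 1 is divisible by p, and binomial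
  coefficients of p-adic integers are p-adic integers.\<close>

lemma padic_power_cong:
  fixes w s :: "'p padic"
  assumes w: "w \<in> Zp" "padic_norm w = 1" and s: "s \<in> Zp"
  shows "padic_power w (int n) s \<equiv>\<^sub>2 w ^ n * (1 + s * (w ^ (CARD('p) - 1) - 1))"
proof -
  define e where "e = w ^ (CARD('p) - 1) - 1"
  define f where "f k = (s gchoose k) * e ^ k" for k
  have "w ^ (CARD('p) - 1) \<equiv>\<^sub>1 1" by (rule fermat_cong_unit[OF w])
  then obtain u where u: "u \<in> Zp" "e = P * u" by (auto elim!: zcongE simp: e_def P_def)
  have "summable f" unfolding f_def e_def
    using padic_power_summable[OF w(1) _ s] padic_norm_unit_iff[OF w(1)] w(2) by (simp add: zcong_def)
  hence lim: "(\<lambda>n. \<Sum>k<n. f k) \<longlonglongrightarrow> suminf f" by (simp add: summable_LIMSEQ)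
  have f2: "f (Suc (Suc k)) \<equiv>\<^sub>2 0" for k
  proof (rule cong_p2_P2)
    show "(s gchoose Suc (Suc k)) * P ^ k * u ^ Suc (Suc k) \<in> Zp"
      by (intro Zp_mult Zp_power gchoose_Zp s u P_Zp)
  qed (simp add: f_def u power_mult_distrib power2_eq_square)
  have part: "(\<Sum>k<Suc (Suc n). f k) \<equiv>\<^sub>2 1 + s * e" for n
  proof (induction n)
    case (Suc n)
    have "(\<Sum>k<Suc (Suc n). f k) + f (Suc (Suc n)) \<equiv>\<^sub>2 1 + s * e + 0"
      by (intro zcong_add Suc f2)
    thus ?case by simp
  qed (simp add: f_def)
  have "padic_norm (P ^ 2) > 0" by (intro padic_norm_pos) (simp add: P_def)
  \<comment> \<open>A partial sum closer to the limit than the norm of p^2 is congruent to it, so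
    the congruence passes to the infinite sum.\<close>
  from metric_LIMSEQ_D[OF lim this] obtain N
    where N: "\<And>n. n \<ge> N \<Longrightarrow> dist (\<Sum>k<n. f k) (suminf f) < padic_norm (P ^ 2)" by blast
  have "suminf f \<equiv>\<^sub>2 (\<Sum>k<Suc (Suc N). f k)"
  proof (rule zcong_sym, rule padic_norm_le_imp_cong_p2, rule less_imp_le)
    show "padic_norm ((\<Sum>k<Suc (Suc N). f k) - suminf f) < padic_norm (P\<^sup>2)"
      unfolding dist_padic_def[symmetric] by (rule N) simp
  qed
  also note part
  finally have "suminf f \<equiv>\<^sub>2 1 + s * e" .
  thus ?thesis unfolding padic_power_def f_def e_def
    by (simp add: zcong_mult_left Zp_power w)
qed

end

section \<open>Harmonic numbers and beta moments modulo $p$ and $p^2$\<close>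

locale odd_padic_prime = padic_prime P
  for P :: "'p::prime_card padic" +
  fixes m :: nat
  assumes odd_card: "CARD('p) = Suc (2 * m)"
begin

lemma P_eq: "P = 2 * of_nat m + 1"
  by (simp add: P_def odd_card)

lemma padic_norm_2: "padic_norm (2 :: 'p padic) = 1"
proof -
  have "CARD('p) > 1" using prime_card prime_gt_1_nat by blast
  hence "2 < CARD('p)" using odd_card by presburger
  thus ?thesis using padic_norm_of_nat_unit[of 2] by simp
qed

section \<open>Products and quotients in the form A(1 + Px)\<close>

lemma half_Zp: "1 / 2 \<in> (Zp :: 'p padic set)"
  by (intro Zp_divide padic_norm_2) simp

text \<open>With the leading part kept outside, the first-order parts behave like logarithms: they
  add under products and subtract under quotients.\<close>

lemma first_order_mult:
  assumes "X \<equiv>\<^sub>2 A * (1 + P * x)" "Y \<equiv>\<^sub>2 B * (1 + P * y)"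
    and Zp: "A \<in> Zp" "B \<in> Zp" "x \<in> Zp" "y \<in> Zp"
  shows "X * Y \<equiv>\<^sub>2 A * B * (1 + P * (x + y))"
proof -
  have "X * Y \<equiv>\<^sub>2 (A * (1 + P * x)) * (B * (1 + P * y))"
    by (intro zcong_mult assms Zp_mult Zp_add Zp_1 P_Zp)
  also have "\<dots> \<equiv>\<^sub>2 A * B * (1 + P * (x + y))"
    by (rule cong_p2_P2[of "A * B * x * y"], intro Zp_mult Zp)
       (simp add: power2_eq_square algebra_simps)
  finally show ?thesis .
qed

lemma first_order_unit:
  assumes "Y \<equiv>\<^sub>2 B * (1 + P * y)" "B \<in> Zp" "y \<in> Zp" "padic_norm B = 1"
  shows "padic_norm Y = 1"
proof -
  have "Y \<equiv>\<^sub>1 B * (1 + P * y)" by (intro cong_p2_imp_cong_p assms)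
  also have "B * (1 + P * y) = B + P * (B * y)" by (simp add: algebra_simps)
  also have "\<dots> \<equiv>\<^sub>1 B + 0"
    by (intro zcong_add zcong_refl cong_p_P_mult Zp_mult assms)
  finally have "Y \<equiv>\<^sub>1 B" by simp
  thus ?thesis using padic_norm_zcong_unit assms by blast
qed

lemma first_order_divide:
  assumes X: "X \<equiv>\<^sub>2 A * (1 + P * x)" and Y: "Y \<equiv>\<^sub>2 B * (1 + P * y)" and B: "padic_norm B = 1"
    and Zp: "A \<in> Zp" "B \<in> Zp" "x \<in> Zp" "y \<in> Zp"
  shows "X / Y \<equiv>\<^sub>2 A / B * (1 + P * (x - y))"
proof (rule zcong_divide_left)
  show "padic_norm Y = 1" by (rule first_order_unit[OF Y]) (use Zp B in auto)
  have "Y * (A / B * (1 + P * (x - y))) \<equiv>\<^sub>2 B * (A / B) * (1 + P * (y + (x - y)))"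
    by (intro first_order_mult Y zcong_refl Zp Zp_divide B Zp_diff)
  also have "B * (A / B) = A" using B by auto
  also have "y + (x - y) = x" by simp
  finally have "Y * (A / B * (1 + P * (x - y))) \<equiv>\<^sub>2 A * (1 + P * x)" .
  thus "X \<equiv>\<^sub>2 Y * (A / B * (1 + P * (x - y)))"
    using X zcong_sym zcong_trans by blast
qed

text \<open>Pair i with p - i: the sum 1/i + 1/(p-i) is p times a p-adic integer.\<close>

lemma harmonic_card: "harmonic (2 * m) \<equiv>\<^sub>1 (0 :: 'p padic)"
proof -
  define f :: "nat \<Rightarrow> 'p padic" where "f i = 1 / of_nat (Suc i)" for i
  have "2 * harmonic (2 * m) = (\<Sum>i<2 * m. f i) + (\<Sum>i<2 * m. f (2 * m - Suc i))"
    unfolding sum.nat_diff_reindex by (simp add: harmonic_def f_def)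
  also have "\<dots> = (\<Sum>i<2 * m. P * (f i * f (2 * m - Suc i)))"
    unfolding sum.distrib[symmetric]
  proof (intro sum.cong refl)
    fix i assume i: "i \<in> {..<2 * m}"
    define x y :: "'p padic" where "x = of_nat (Suc i)" and "y = of_nat (Suc (2 * m - Suc i))"
    have "x \<noteq> 0" "y \<noteq> 0" unfolding x_def y_def of_nat_eq_0_iff by auto
    moreover have "Suc i + Suc (2 * m - Suc i) = CARD('p)" using i by (simp add: odd_card)
    hence "x + y = P" unfolding x_def y_def P_def by (metis of_nat_add)
    ultimately have "1 / x + 1 / y = P * (1 / x * (1 / y))" by (simp add: field_simps)
    thus "f i + f (2 * m - Suc i) = P * (f i * f (2 * m - Suc i))" by (simp add: f_def x_def y_def)
  qed
  also have "\<dots> \<equiv>\<^sub>1 (\<Sum>i<2 * m. 0)"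
    unfolding f_def by (intro zcong_sum cong_p_P_mult Zp_mult Zp_divide Zp_1 padic_norm_of_nat_unit)
      (auto simp: odd_card)
  finally have "2 * harmonic (2 * m) \<equiv>\<^sub>1 2 * (0 :: 'p padic)" by simp
  thus ?thesis using padic_norm_2 by (rule zcong_cancel_left)
qed

lemma alternating_harmonic: "(\<Sum>i<2 * n. (- 1) ^ i / of_nat (Suc i)) = harmonic (2 * n) - (harmonic n :: 'p padic)"
proof (induction n)
  case (Suc n)
  have "2 * (1 / of_nat (2 * Suc n) :: 'p padic) = 1 / of_nat (Suc n)"
    unfolding of_nat_mult by (simp del: of_nat_Suc)
  hence *: "1 / of_nat (Suc n) = 1 / of_nat (Suc (Suc (2 * n))) + (1 / of_nat (Suc (Suc (2 * n))) :: 'p padic)"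
    by (simp del: of_nat_Suc)
  have "(\<Sum>i<2 * Suc n. (- 1) ^ i / of_nat (Suc i)) = harmonic (2 * n) - harmonic n
      + 1 / of_nat (Suc (2 * n)) - (1 / of_nat (Suc (Suc (2 * n))) :: 'p padic)"
    by (simp add: Suc.IH del: of_nat_Suc)
  thus ?case by (simp add: harmonic_Suc * del: of_nat_Suc)
qed auto

text \<open>Row p of Pascal's triangle is divisible by p away from its ends, so consecutive entries
  of row p - 1 are negatives of each other modulo p.\<close>

lemma binomial_pred_card:
  assumes "k \<le> 2 * m"
  shows "of_nat (2 * m choose k) \<equiv>\<^sub>1 ((- 1) ^ k :: 'p padic)"
  using assms
proof (induction k)
  case (Suc k)
  have "CARD('p) dvd (CARD('p) choose Suc k)"
    using Suc.prems by (intro dvd_choose_prime prime_card) (auto simp: odd_card)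
  then obtain t where "CARD('p) choose Suc k = CARD('p) * t" by (elim dvdE)
  hence "(2 * m choose k) + (2 * m choose Suc k) = CARD('p) * t" by (simp add: odd_card)
  hence "of_nat (2 * m choose k) + of_nat (2 * m choose Suc k) = (P * of_nat t :: 'p padic)"
    unfolding P_def by (metis of_nat_add of_nat_mult)
  hence "of_nat (2 * m choose Suc k) = P * of_nat t - of_nat (2 * m choose k)"
    by (simp add: algebra_simps)
  also have "\<dots> \<equiv>\<^sub>1 0 - (- 1) ^ k"
    using Suc by (intro zcong_diff cong_p_P_mult) auto
  finally show ?case by simp
qed auto

text \<open>Modulo $p^2$ this is equivalent to Morley's congruence for the middle binomial coefficient.\<close>

lemma two_power_card: "(2 :: 'p padic) ^ CARD('p) \<equiv>\<^sub>2 2 - P * harmonic m"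
proof -
  \<comment> \<open>2^p is the sum of row p, whose inner entries are C(p,k+1) = p C(p-1,k)/(k+1).
    Because of the explicit p, C(p-1,k) is needed only modulo p.\<close>
  have "(2 :: 'p padic) ^ CARD('p) = of_nat (\<Sum>k\<le>CARD('p). CARD('p) choose k)"
    unfolding choose_row_sum by simp
  also have "(\<Sum>k\<le>CARD('p). CARD('p) choose k) = 2 + (\<Sum>k<2 * m. CARD('p) choose Suc k)"
    unfolding odd_card sum.atMost_Suc sum.atMost_shift by simp
  also have "of_nat \<dots> = 2 + (\<Sum>k<2 * m. P * (of_nat (2 * m choose k) / of_nat (Suc k)))"
  proof -
    have "of_nat (CARD('p) choose Suc k) = P * (of_nat (2 * m choose k) / of_nat (Suc k))" for k
    proof -
      have "Suc k * (CARD('p) choose Suc k) = CARD('p) * (2 * m choose k)"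
        unfolding odd_card by (rule Suc_times_binomial)
      hence "of_nat (Suc k) * of_nat (CARD('p) choose Suc k) = P * of_nat (2 * m choose k)"
        unfolding P_def by (metis of_nat_mult)
      moreover have "(of_nat (Suc k) :: 'p padic) \<noteq> 0" unfolding of_nat_eq_0_iff by simp
      ultimately show ?thesis by (simp add: field_simps del: of_nat_Suc)
    qed
    thus ?thesis by simp
  qed
  also have "(\<Sum>k<2 * m. P * (of_nat (2 * m choose k) / of_nat (Suc k)))
      = P * (\<Sum>k<2 * m. of_nat (2 * m choose k) / of_nat (Suc k))"
    by (simp add: sum_distrib_left)
  also have "2 + \<dots> \<equiv>\<^sub>2 2 + P * (- harmonic m)"
  proof (intro zcong_add zcong_refl cong_p_mult_P)
    have "(\<Sum>k<2 * m. of_nat (2 * m choose k) / of_nat (Suc k))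
        \<equiv>\<^sub>1 (\<Sum>k<2 * m. (- 1) ^ k / (of_nat (Suc k) :: 'p padic))"
      by (intro zcong_sum zcong_divide binomial_pred_card padic_norm_of_nat_unit) (auto simp: odd_card)
    also have "\<dots> = harmonic (2 * m) - harmonic m" by (rule alternating_harmonic)
    also have "\<dots> \<equiv>\<^sub>1 0 - harmonic m" by (intro zcong_diff harmonic_card zcong_refl)
    finally show "(\<Sum>k<2 * m. of_nat (2 * m choose k) / of_nat (Suc k)) \<equiv>\<^sub>1 - (harmonic m :: 'p padic)" by simp
  qed
  finally show ?thesis by simp
qed

section \<open>The moments at b = (1-p)/2, 1/2 and (1+p)/2\<close>

lemma minus_gamma_nonzero: "(1 - P) / 2 + 1 / 2 + of_nat i \<noteq> 0"
proof
  assume "(1 - P) / 2 + 1 / 2 + of_nat i = 0"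
  hence "of_nat (2 * Suc i) = P" by (simp add: field_simps)
  hence "2 * Suc i = CARD('p)" unfolding P_def of_nat_eq_iff .
  thus False using odd_card by presburger
qed

lemma plus_gamma_nonzero: "(1 + P) / 2 + 1 / 2 + of_nat i \<noteq> 0"
proof
  assume "(1 + P) / 2 + 1 / 2 + of_nat i = 0"
  hence "of_nat (2 * Suc i + CARD('p)) = (0 :: 'p padic)" by (simp add: P_def field_simps)
  thus False unfolding of_nat_eq_0_iff by simp
qed

lemma beta_moment_minus_Suc:
  "(of_nat (Suc k) - P) * beta_moment ((1 - P) / 2) (Suc k)
     = (4 * of_nat k + 2 - 2 * P) * beta_moment ((1 - P) / 2) k"
proof -
  have *: "of_nat k + 2 * ((1 - P) / 2) = of_nat (Suc k) - P"
    "4 * (of_nat k + (1 - P) / 2) = 4 * of_nat k + 2 - 2 * P" by (simp_all add: field_simps)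
  show ?thesis using beta_moment_Suc[OF minus_gamma_nonzero, of k] unfolding * .
qed

lemma beta_moment_plus_Suc:
  "(of_nat (Suc k) + P) * beta_moment ((1 + P) / 2) (Suc k)
     = (4 * of_nat k + 2 + 2 * P) * beta_moment ((1 + P) / 2) k"
proof -
  have *: "of_nat k + 2 * ((1 + P) / 2) = of_nat (Suc k) + P"
    "4 * (of_nat k + (1 + P) / 2) = 4 * of_nat k + 2 + 2 * P" by (simp_all add: field_simps)
  show ?thesis using beta_moment_Suc[OF plus_gamma_nonzero, of k] unfolding * .
qed

lemma beta_moment_half_Suc:
  "of_nat (Suc k) * beta_moment (1 / 2) (Suc k) = (4 * of_nat k + 2) * (beta_moment (1 / 2) k :: 'p padic)"
proof -
  have "1 / 2 + 1 / 2 + of_nat i \<noteq> (0 :: 'p padic)" for i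
    using of_nat_eq_0_iff[of "Suc i", where 'a = "'p padic"] by (simp add: add.commute)
  from beta_moment_Suc[OF this, of k] show ?thesis by (simp add: algebra_simps)
qed

text \<open>Both sides are the central binomial coefficient C(2k,k). This identifies the
  coefficients of the sum with parameter 1/2 as the moments at b = 1/2.\<close>

lemma beta_moment_half:
  "pochhammer (1 / 2) k / fact k * 4 ^ k = (beta_moment (1 / 2) k :: 'p padic)"
proof (induction k)
  case (Suc k)
  have nz: "(of_nat (Suc k) :: 'p padic) \<noteq> 0" unfolding of_nat_eq_0_iff by simp
  have "of_nat (Suc k) * (pochhammer (1 / 2) (Suc k) / fact (Suc k) * 4 ^ Suc k)
      = (4 * of_nat k + 2) * (pochhammer (1 / 2) k / fact k * 4 ^ k :: 'p padic)"
    using nz unfolding fact_Suc pochhammer_Suc by (simp add: field_simps del: of_nat_Suc)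
  also have "\<dots> = of_nat (Suc k) * (beta_moment (1 / 2) (Suc k) :: 'p padic)"
    unfolding Suc.IH beta_moment_half_Suc ..
  finally show ?case using nz by (simp only: mult_cancel_left simp_thms)
qed simp

text \<open>The two recurrences agree modulo p, and their divisors k + 1 and k + 1 - p are units as
  long as the new index stays below p. At index p the divisor \<open>N - P\<close> would be
  0.\<close>

lemma beta_moment_cong:
  assumes "k < CARD('p)"
  shows "beta_moment (1 / 2) k \<in> (Zp :: 'p padic set)"
    "beta_moment ((1 - P) / 2) k \<equiv>\<^sub>1 beta_moment (1 / 2) k"
proof -
  have "beta_moment (1 / 2) k \<in> (Zp :: 'p padic set)
      \<and> beta_moment ((1 - P) / 2) k \<equiv>\<^sub>1 beta_moment (1 / 2) k"
    using assms
  proof (induction k)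
    case (Suc k)
    define q w where "q = beta_moment ((1 - P) / 2)" and "w = (beta_moment (1 / 2) :: nat \<Rightarrow> 'p padic)"
    define N :: "'p padic" where "N = of_nat (Suc k)"
    have N: "padic_norm N = 1" "N \<in> Zp" using Suc.prems by (simp_all add: N_def padic_norm_of_nat_unit del: of_nat_Suc)
    have N0: "N \<noteq> 0" using N(1) by auto
    have IH: "w k \<in> Zp" "q k \<equiv>\<^sub>1 w k" using Suc by (simp_all add: q_def w_def)
    have w: "w (Suc k) = (4 * of_nat k + 2) * w k / N"
      using beta_moment_half_Suc[of k] N0 by (simp add: w_def N_def field_simps del: of_nat_Suc)
    have four: "4 * of_nat k + 2 \<in> (Zp :: 'p padic set)"
      using Zp_of_nat[of "4 * k + 2", where 'a = 'p] by (simp add: add.commute)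
    have NP: "N - P \<equiv>\<^sub>1 N" using zcong_diff[OF zcong_refl[of _ N] cong_p_P_mult[OF Zp_1]] by (simp add: P_def)
    have wZ: "w (Suc k) \<in> Zp" unfolding w by (intro Zp_divide Zp_mult four IH N)
    have "(N - P) * q (Suc k) = (4 * of_nat k + 2) * q k + P * (- 2 * q k)"
      using beta_moment_minus_Suc[of k] by (simp add: q_def N_def algebra_simps)
    also have "\<dots> \<equiv>\<^sub>1 (4 * of_nat k + 2) * w k + 0"
      using Zp_of_int[of "- 2", where 'a = 'p] zcong_Zp[OF IH(2,1)]
      by (intro zcong_add zcong_mult_left four IH cong_p_P_mult Zp_mult) simp_all
    also have "\<dots> = N * w (Suc k)" using N0 by (simp add: w)
    also have "\<dots> \<equiv>\<^sub>1 (N - P) * w (Suc k)"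
      using zcong_mult_right[OF zcong_sym[OF NP] wZ] .
    finally have "q (Suc k) \<equiv>\<^sub>1 w (Suc k)"
      by (rule zcong_cancel_left) (rule padic_norm_zcong_unit[OF NP N(2,1)])
    thus ?case using wZ by (simp add: q_def w_def)
  qed simp
  thus "beta_moment (1 / 2) k \<in> (Zp :: 'p padic set)"
    "beta_moment ((1 - P) / 2) k \<equiv>\<^sub>1 beta_moment (1 / 2) k" by auto
qed

text \<open>On passing to index p + i + 1 the divisor for b = (1-p)/2 is i + 1 and the numerator is
  that of b = (1+p)/2. The divisor for the latter is i + 1 + p; this difference accounts for
  \<open>fact i\<close> and \<open>pochhammer (1 + P) i\<close>.\<close>

lemma beta_moment_shift:
  "beta_moment ((1 - P) / 2) (CARD('p) + i) * fact i
     = beta_moment ((1 - P) / 2) CARD('p) * pochhammer (1 + P) i * beta_moment ((1 + P) / 2) i"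
proof (induction i)
  case (Suc i)
  define q q' where "q = beta_moment ((1 - P) / 2)" and "q' = beta_moment ((1 + P) / 2)"
  have "of_nat (Suc (CARD('p) + i)) - P = of_nat (Suc i)" by (simp add: P_def)
  hence 1: "of_nat (Suc i) * q (CARD('p) + Suc i) = (4 * of_nat i + 2 + 2 * P) * q (CARD('p) + i)"
    using beta_moment_minus_Suc[of "CARD('p) + i"] unfolding q_def by (simp add: P_def algebra_simps)
  have 2: "(1 + P + of_nat i) * q' (Suc i) = (4 * of_nat i + 2 + 2 * P) * q' i"
    using beta_moment_plus_Suc[of i] unfolding q'_def by (simp add: algebra_simps)
  have "q (CARD('p) + Suc i) * fact (Suc i) = (of_nat (Suc i) * q (CARD('p) + Suc i)) * fact i"
    by (simp only: fact_Suc mult_ac)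
  also have "\<dots> = (4 * of_nat i + 2 + 2 * P) * (q (CARD('p) + i) * fact i)"
    unfolding 1 by (simp only: mult_ac)
  also have "\<dots> = q CARD('p) * pochhammer (1 + P) i * ((4 * of_nat i + 2 + 2 * P) * q' i)"
    unfolding q_def Suc.IH q'_def by (simp only: mult_ac)
  also have "\<dots> = q CARD('p) * pochhammer (1 + P) (Suc i) * q' (Suc i)"
    unfolding 2[symmetric] pochhammer_Suc by (simp only: mult_ac)
  finally show ?case unfolding q_def q'_def .
qed simp

text \<open>The recurrence degenerates on reaching index p, so the value is read off the definition
  as 2^p m! / (1 - p/2)_m. The harmonic number in 2^p cancels against the one from the
  denominator.\<close>

lemma beta_moment_card: "beta_moment ((1 - P) / 2) CARD('p) \<equiv>\<^sub>2 2"
proof -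
  define D where "D = pochhammer (1 + of_nat 0 + P * (- (1 / 2))) m"
  have mlt: "m < CARD('p)" by (simp add: odd_card)
  have h: "- (1 / 2) \<in> (Zp :: 'p padic set)" by (intro Zp_minus half_Zp)
  have D: "D \<equiv>\<^sub>2 fact (0 + m) / fact 0 * (1 + P * (- (1 / 2)) * (harmonic (0 + m) - harmonic 0))"
    unfolding D_def by (rule pochhammer_first_order[folded P_def, OF h]) (use mlt in simp)
  hence D': "D \<equiv>\<^sub>2 fact m * (1 + P * (- (1 / 2) * harmonic m))" by (simp add: mult.assoc)
  have "(1 - P) / 2 + of_nat (Suc m) = 1" by (simp add: P_eq field_simps)
  hence "beta_moment ((1 - P) / 2) CARD('p) = 2 ^ CARD('p) * fact m / D"
    unfolding beta_moment_def D_def odd_card by (simp add: pochhammer_fact diff_divide_distrib)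
  also have "\<dots> \<equiv>\<^sub>2 2"
  proof (rule zcong_divide_left)
    show "padic_norm D = 1"
      by (rule first_order_unit[OF D']) (intro fact_Zp Zp_mult h harmonic_Zp mlt padic_norm_fact_unit)+
    have "2 ^ CARD('p) * fact m \<equiv>\<^sub>2 (2 - P * harmonic m) * fact m"
      by (intro zcong_mult_right two_power_card fact_Zp)
    also have "\<dots> = fact m * (1 + P * (- (1 / 2) * harmonic m)) * 2" by (simp add: algebra_simps)
    also have "\<dots> \<equiv>\<^sub>2 D * 2" using Zp_of_nat[of 2, where 'a = 'p]
      by (intro zcong_mult_right zcong_sym[OF D']) simp
    finally show "2 ^ CARD('p) * fact m \<equiv>\<^sub>2 D * 2" .
  qed
  finally show ?thesis .
qed

end

section \<open>First-order expansions of the hypergeometric sums\<close>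

lemma sum_atMost_add: "(\<Sum>k\<le>n + a. g k) = (\<Sum>k<n. g k) + (\<Sum>i\<le>a. g (n + i))"
  for g :: "nat \<Rightarrow> 'a::comm_monoid_add"
  by (induction a) (simp_all add: add.assoc flip: lessThan_Suc_atMost)

lemma sum_atMost_rev: "(\<Sum>i\<le>a. g (a - i)) = (\<Sum>i\<le>a. g i)"
  for g :: "nat \<Rightarrow> 'a::comm_monoid_add"
  using sum.nat_diff_reindex[of g "Suc a"] by (simp add: lessThan_Suc_atMost)

lemma zcong_sum_truncate:
  fixes a n :: nat
  assumes "a < n" "\<And>j. j \<le> a \<Longrightarrow> zcong m (f j) (g j)" "\<And>j. a < j \<Longrightarrow> j < n \<Longrightarrow> zcong m (f j) 0"
  shows "zcong m (\<Sum>j<n. f j) (\<Sum>j\<le>a. g j)"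
proof -
  have "zcong m (\<Sum>j<n. f j) (\<Sum>j<n. if j \<in> {..a} then g j else 0)"
  proof (intro zcong_sum)
    fix j assume "j \<in> {..<n}"
    thus "zcong m (f j) (if j \<in> {..a} then g j else 0)"
      using assms(2)[of j] assms(3)[of j] by (cases "j \<le> a") auto
  qed
  also have "(\<Sum>j<n. if j \<in> {..a} then g j else 0) = (\<Sum>j\<in>{..<n} \<inter> {..a}. g j)"
    by (rule sum.inter_restrict[symmetric]) simp
  also have "{..<n} \<inter> {..a} = {..a}" using assms(1) by auto
  finally show ?thesis .
qed

lemma zcong_mult_0: "zcong m x 0 \<Longrightarrow> c \<in> Zp \<Longrightarrow> zcong m (x * c) 0"
  using zcong_mult_right[of m x 0 c] by simp

context odd_padic_prime
begin

section \<open>Expansion of the transformed sums\<close>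

lemma Zp_numeral: "numeral n \<in> (Zp :: 'p padic set)"
  using Zp_of_nat[of "numeral n", where 'a = 'p] by simp

lemmas Zp_intros = Zp_add Zp_mult Zp_diff Zp_minus Zp_0 Zp_1 Zp_of_nat Zp_numeral Zp_power Zp_sum
  half_Zp P_Zp fact_Zp harmonic_Zp Zp_divide padic_norm_fact_unit

text \<open>The common shape modulo p^2 of the coefficients in all the expanded sums. Their
  first-order parts are carried by the harmonic numbers of a, j and a - j, so that each sum is
  recorded by three numbers.\<close>

definition weight :: "nat \<Rightarrow> 'p padic \<Rightarrow> 'p padic \<Rightarrow> 'p padic \<Rightarrow> nat \<Rightarrow> 'p padic" where
  "weight a u v w j = (of_nat (a choose j))\<^sup>2
     * (1 + P * (u * harmonic a + v * harmonic j + w * harmonic (a - j)))"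

lemma weight_rev: "j \<le> a \<Longrightarrow> weight a u v w (a - j) = weight a u w v j"
  by (simp add: weight_def add_ac flip: binomial_symmetric)

lemma sum_weight:
  "(\<Sum>j\<le>a. weight a u v w j * t ^ j) = (\<Sum>j\<le>a. (of_nat (a choose j))\<^sup>2 * t ^ j)
     + P * (u * harmonic a * (\<Sum>j\<le>a. (of_nat (a choose j))\<^sup>2 * t ^ j)
       + v * (\<Sum>j\<le>a. (of_nat (a choose j))\<^sup>2 * harmonic j * t ^ j)
       + w * (\<Sum>j\<le>a. (of_nat (a choose j))\<^sup>2 * harmonic (a - j) * t ^ j))"
  unfolding weight_def sum_distrib_left sum.distrib[symmetric]
  by (intro sum.cong refl) (simp add: algebra_simps)

lemma pochhammer_one_cong:
  assumes "e \<in> Zp" "k < CARD('p)"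
  shows "pochhammer (1 + P * e) k \<equiv>\<^sub>2 fact k * (1 + P * (e * harmonic k))"
  using pochhammer_first_order[of e 0 k] assms by (simp add: mult.assoc)

lemma pochhammer_first_order_diff:
  assumes "e \<in> Zp" "j \<le> a" "a < CARD('p)"
  shows "pochhammer (1 + of_nat (a - j) + P * e) j
    \<equiv>\<^sub>2 fact a / fact (a - j) * (1 + P * (e * (harmonic a - harmonic (a - j))))"
  using pochhammer_first_order[of e "a - j" j] assms by (simp add: mult.assoc)

lemma jacobi_sum_cong:
  assumes e: "e \<in> Zp" and a: "a < CARD('p)" and t: "t \<in> Zp"
  shows "jacobi_sum (1 + P * e) a t \<equiv>\<^sub>2 (\<Sum>j\<le>a. weight a e (- e) (- e) j * t ^ j)"
  unfolding jacobi_sum_def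
proof (intro zcong_sum zcong_mult_right Zp_power t)
  fix j assume "j \<in> {..a}"
  hence j: "j \<le> a" "j < CARD('p)" "a - j < CARD('p)" using a by auto
  define g where "g = 1 + P * e"
  have 1: "pochhammer g j * pochhammer g (a - j) \<equiv>\<^sub>2
      fact j * fact (a - j) * (1 + P * (e * harmonic j + e * harmonic (a - j)))"
    unfolding g_def by (intro first_order_mult pochhammer_one_cong Zp_intros e j)
  have 2: "of_nat (a choose j) * pochhammer g a \<equiv>\<^sub>2
      of_nat (a choose j) * (fact a * (1 + P * (e * harmonic a)))"
    unfolding g_def by (intro zcong_mult_left pochhammer_one_cong e a Zp_of_nat)
  have "of_nat (a choose j) * pochhammer g a / (pochhammer g j * pochhammer g (a - j))
      \<equiv>\<^sub>2 (of_nat (a choose j) * fact a) / (fact j * fact (a - j))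
        * (1 + P * (e * harmonic a - (e * harmonic j + e * harmonic (a - j))))"
  proof (rule first_order_divide[OF _ 1])
    show "padic_norm (fact j * fact (a - j) :: 'p padic) = 1"
      using j by (simp add: padic_norm_mult padic_norm_fact_unit)
  qed (use 2 in \<open>simp add: mult.assoc\<close>, (intro Zp_intros e a j)+)
  also have "\<dots> = weight a e (- e) (- e) j"
    using j(1) by (simp add: weight_def binomial_fact power2_eq_square algebra_simps)
  finally show "of_nat (a choose j) * pochhammer (1 + P * e) a
      / (pochhammer (1 + P * e) j * pochhammer (1 + P * e) (a - j)) \<equiv>\<^sub>2 weight a e (- e) (- e) j"
    unfolding g_def .
qed

lemma binomial_pochhammer:
  "of_nat (n choose j) = pochhammer (1 + of_nat n - of_nat j) j / (fact j :: 'p padic)"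
proof -
  have "of_nat n - of_nat j + 1 = (1 + of_nat n - of_nat j :: 'p padic)" by simp
  thus ?thesis unfolding binomial_gbinomial gbinomial_pochhammer' by (simp only:)
qed

lemma gamma_plus_nonzero: "1 + P * (- (1 / 2)) + of_nat i \<noteq> 0"
  using minus_gamma_nonzero[of i] by (simp add: diff_divide_distrib)

lemma pochhammer_gamma_nonzero: "pochhammer (1 + P * (- (1 / 2))) n \<noteq> 0"
  using gamma_plus_nonzero by (auto simp: pochhammer_eq_0_iff) (metis add.right_inverse add_0 add.commute)

text \<open>The coefficients form two blocks of length a + 1, interchanged by the symmetry of j and
  p + a - j. Between the blocks each coefficient is a product of two factors divisible by p.\<close>

lemma jacobi_sum_shift_cong:
  assumes a: "a < CARD('p)" and t: "t \<in> Zp"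
  shows "jacobi_sum (1 + P * (- (1 / 2))) (CARD('p) + a) t
    \<equiv>\<^sub>2 (\<Sum>j\<le>a. weight a (3 * (1 / 2)) (1 / 2) (- 3 * (1 / 2)) j * t ^ j)
      + t ^ CARD('p) * (\<Sum>j\<le>a. weight a (3 * (1 / 2)) (- 3 * (1 / 2)) (1 / 2) j * t ^ j)"
proof -
  define g where "g = 1 + P * (- (1 / 2))"
  define n where "n = CARD('p) + a"
  define e where "e j = of_nat (n choose j) * pochhammer g n / (pochhammer g j * pochhammer g (n - j))" for j
  define f where "f = weight a (3 * (1 / 2)) (1 / 2) (- 3 * (1 / 2))"
  have g0: "pochhammer g k \<noteq> 0" for k unfolding g_def by (rule pochhammer_gamma_nonzero)
  have h: "- (1 / 2) \<in> (Zp :: 'p padic set)" by (intro Zp_intros)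
  have gZ: "g \<in> Zp" unfolding g_def by (intro Zp_intros)
  have gu: "pochhammer g j \<equiv>\<^sub>2 fact j * (1 + P * (- (1 / 2) * harmonic j))" if "j < CARD('p)" for j
    unfolding g_def by (rule pochhammer_one_cong[OF h that])
  have e_eq: "e j = (pochhammer (1 + of_nat n - of_nat j) j / fact j)
      * (pochhammer (g + of_nat (n - j)) j / pochhammer g j)" if "j \<le> n" for j
  proof -
    have "pochhammer g n = pochhammer g (n - j) * pochhammer (g + of_nat (n - j)) j"
      using pochhammer_product[of "n - j" n g] that by simp
    thus ?thesis unfolding e_def using binomial_pochhammer g0 by simp
  qed
  \<comment> \<open>Both numerators are Pochhammer symbols starting at 1 + (a-j) plus a multiple of
    p: once p from the binomial coefficient, p/2 from the shifted parameter. Together they give the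
    3/2 in \<open>f\<close>; the division by \<open>pochhammer g j\<close> gives the 1/2.\<close>
  have small: "e j \<equiv>\<^sub>2 f j" if j: "j \<le> a" for j
  proof -
    have lt: "j < CARD('p)" "a - j < CARD('p)" using j a by auto
    have "n - j = CARD('p) + (a - j)" using j by (simp add: n_def)
    hence nj: "of_nat (n - j) = P + of_nat (a - j)" by (simp add: P_def)
    have "1 + of_nat n - of_nat j = 1 + (of_nat (n - j) :: 'p padic)" using j by (simp add: n_def of_nat_diff)
    hence 1: "1 + of_nat n - of_nat j = 1 + of_nat (a - j) + P * 1" unfolding nj by simp
    have 2: "g + of_nat (n - j) = 1 + of_nat (a - j) + P * (1 / 2)" unfolding nj g_def by simp
    have b1: "pochhammer (1 + of_nat (a - j) + P * 1) j / fact j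
        \<equiv>\<^sub>2 fact a / fact (a - j) / fact j * (1 + P * (1 * (harmonic a - harmonic (a - j)) - 0))"
      using lt by (intro first_order_divide pochhammer_first_order_diff Zp_intros j a) simp_all
    have b2: "pochhammer (1 + of_nat (a - j) + P * (1 / 2)) j / pochhammer g j
        \<equiv>\<^sub>2 fact a / fact (a - j) / fact j
          * (1 + P * (1 / 2 * (harmonic a - harmonic (a - j)) - - (1 / 2) * harmonic j))"
      by (intro first_order_divide pochhammer_first_order_diff gu Zp_intros j a lt)
    have "e j \<equiv>\<^sub>2 (fact a / fact (a - j) / fact j) * (fact a / fact (a - j) / fact j)
        * (1 + P * ((1 * (harmonic a - harmonic (a - j)) - 0)
          + (1 / 2 * (harmonic a - harmonic (a - j)) - - (1 / 2) * harmonic j)))"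
      using j unfolding e_eq[OF trans_le_add2[OF j, of "CARD('p)", folded n_def]] 1 2
      by (intro first_order_mult b1 b2 Zp_intros lt a)
    also have "\<dots> = f j"
      using j by (simp add: f_def weight_def binomial_fact power2_eq_square field_simps)
    finally show ?thesis .
  qed
  have middle: "e j \<equiv>\<^sub>2 0" if j: "a < j" "j < CARD('p)" for j
  proof -
    \<comment> \<open>The position of the factor divisible by p in both Pochhammer symbols, as n - j
      + i + 1 = p.\<close>
    define i where "i = j - Suc a"
    have i: "i < j" "i + Suc a = j" using j by (auto simp: i_def)
    have jn: "j \<le> n" using j by (simp add: n_def)
    have nj: "of_nat (n - j) + of_nat i + 1 = P"
    proof -
      have "n - j + i + 1 = CARD('p)" using i j by (simp add: n_def)
      thus ?thesis unfolding P_def by (metis of_nat_add of_nat_1)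
    qed
    have "pochhammer (1 + of_nat n - of_nat j) j / fact j \<equiv>\<^sub>1 0 / (fact j :: 'p padic)"
    proof (intro zcong_divide pochhammer_cong_p_0)
      show "1 + of_nat n - of_nat j + of_nat i \<equiv>\<^sub>1 (0 :: 'p padic)"
        using nj cong_p_P_mult[OF Zp_1] jn by (simp add: of_nat_diff algebra_simps)
    qed (use i j in \<open>auto intro!: Zp_intros\<close>)
    moreover have "pochhammer (g + of_nat (n - j)) j / pochhammer g j \<equiv>\<^sub>1 0 / pochhammer g j"
    proof (intro zcong_divide pochhammer_cong_p_0)
      have "g + of_nat (n - j) + of_nat i = (of_nat (n - j) + of_nat i + 1) + P * (- (1 / 2))"
        unfolding g_def by (simp only: add_ac)
      also have "\<dots> = P * (1 / 2)" unfolding nj by simp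
      finally have eq: "g + of_nat (n - j) + of_nat i = P * (1 / 2)" .
      show "g + of_nat (n - j) + of_nat i \<equiv>\<^sub>1 0" unfolding eq by (rule cong_p_P_mult[OF half_Zp])
      show "padic_norm (pochhammer g j) = 1"
        by (rule first_order_unit[OF gu]) (intro Zp_intros h j)+
    qed (use i j in \<open>auto intro!: Zp_intros gZ\<close>)
    ultimately have "(pochhammer (1 + of_nat n - of_nat j) j / fact j)
      * (pochhammer (g + of_nat (n - j)) j / pochhammer g j)
      \<equiv>\<^sub>2 (pochhammer (1 + of_nat n - of_nat j) j / fact j) * 0"
      by (intro cong_p_0_mult) simp_all
    thus ?thesis unfolding e_eq[OF jn] by simp
  qed
  have large: "e (CARD('p) + i) \<equiv>\<^sub>2 weight a (3 * (1 / 2)) (- 3 * (1 / 2)) (1 / 2) i" if i: "i \<le> a" for i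
  proof -
    have "n - (CARD('p) + i) = a - i" "n - (a - i) = CARD('p) + i" "a - i \<le> n" "CARD('p) + i \<le> n"
      using i by (auto simp: n_def)
    hence "e (CARD('p) + i) = e (a - i)"
      unfolding e_def using binomial_symmetric[of "a - i" n] by (simp add: mult.commute)
    also have "\<dots> \<equiv>\<^sub>2 f (a - i)" by (rule small) simp
    finally show ?thesis unfolding f_def weight_rev[OF i] .
  qed
  have 1: "jacobi_sum g n t = (\<Sum>j<CARD('p). e j * t ^ j) + (\<Sum>i\<le>a. e (CARD('p) + i) * t ^ (CARD('p) + i))"
    unfolding jacobi_sum_def e_def[symmetric] unfolding n_def by (rule sum_atMost_add)
  have 2: "(\<Sum>j<CARD('p). e j * t ^ j) \<equiv>\<^sub>2 (\<Sum>j\<le>a. f j * t ^ j)"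
    using t by (intro zcong_sum_truncate zcong_mult_right zcong_mult_0 small middle a Zp_power)
  have "(\<Sum>i\<le>a. e (CARD('p) + i) * t ^ (CARD('p) + i))
      = t ^ CARD('p) * (\<Sum>i\<le>a. e (CARD('p) + i) * t ^ i)"
    unfolding sum_distrib_left power_add by (simp only: mult_ac)
  moreover have "t ^ CARD('p) * (\<Sum>i\<le>a. e (CARD('p) + i) * t ^ i)
      \<equiv>\<^sub>2 t ^ CARD('p) * (\<Sum>j\<le>a. weight a (3 * (1 / 2)) (- 3 * (1 / 2)) (1 / 2) j * t ^ j)"
    using t by (intro zcong_mult_left zcong_sum zcong_mult_right large Zp_power) auto
  ultimately show ?thesis
    using zcong_add[OF 2] 1 unfolding f_def g_def n_def by simp
qed

section \<open>The sums with squared coefficients\<close>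

lemma trunc_hyp2F1_square:
  "trunc_hyp2F1 x x 1 t (CARD('p) - 1) = (\<Sum>k<CARD('p). (pochhammer x k / fact k)\<^sup>2 * (t :: 'p padic) ^ k)"
proof -
  have "{..CARD('p) - 1} = {..<CARD('p)}" by (auto simp: odd_card)
  thus ?thesis
    unfolding trunc_hyp2F1_def
    by (simp add: power2_eq_square mult_ac flip: pochhammer_fact cong: sum.cong)
qed

text \<open>For j at most a the symbol is reversed into one with positive start, and the sign
  disappears in the square. For larger j below p it contains the factor ps at position a, so the
  square is divisible by p^2.\<close>

lemma pochhammer_square_cong:
  assumes a: "a < CARD('p)" and s: "s \<in> Zp"
  shows "j \<le> a \<Longrightarrow> (pochhammer (- of_nat a + P * s) j / fact j)\<^sup>2 \<equiv>\<^sub>2 weight a (- 2 * s) 0 (2 * s) j"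
    and "a < j \<Longrightarrow> j < CARD('p) \<Longrightarrow> pochhammer (- of_nat a + P * s) j / fact j \<equiv>\<^sub>1 0"
    and "a < j \<Longrightarrow> j < CARD('p) \<Longrightarrow> (pochhammer (- of_nat a + P * s) j / fact j)\<^sup>2 \<equiv>\<^sub>2 0"
proof -
  assume j: "j \<le> a"
  hence lt: "j < CARD('p)" "a - j < CARD('p)" using a by auto
  define Y where "Y = pochhammer (1 + of_nat (a - j) + P * (- s)) j / fact j"
  have "pochhammer (- (of_nat a - P * s)) j = (- 1) ^ j * pochhammer (of_nat a - P * s - of_nat j + 1) j"
    by (rule pochhammer_minus)
  moreover have "of_nat a - P * s - of_nat j + 1 = 1 + of_nat (a - j) + P * (- s)"
    using j by (simp add: of_nat_diff)
  ultimately have "(pochhammer (- of_nat a + P * s) j / fact j)\<^sup>2 = Y * Y"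
    by (simp add: Y_def power2_eq_square flip: power_mult_distrib)
  also have "\<dots> \<equiv>\<^sub>2 (fact a / fact (a - j) / fact j) * (fact a / fact (a - j) / fact j)
      * (1 + P * ((- s * (harmonic a - harmonic (a - j)) - 0) + (- s * (harmonic a - harmonic (a - j)) - 0)))"
  proof -
    have "Y \<equiv>\<^sub>2 fact a / fact (a - j) / fact j * (1 + P * (- s * (harmonic a - harmonic (a - j)) - 0))"
      unfolding Y_def using lt
      by (intro first_order_divide pochhammer_first_order_diff Zp_intros j a s) simp_all
    thus ?thesis by (intro first_order_mult Zp_intros s lt a)
  qed
  also have "\<dots> = weight a (- 2 * s) 0 (2 * s) j"
    using j by (simp add: weight_def binomial_fact power2_eq_square field_simps)
  finally show "(pochhammer (- of_nat a + P * s) j / fact j)\<^sup>2 \<equiv>\<^sub>2 weight a (- 2 * s) 0 (2 * s) j" .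
next
  assume j: "a < j" "j < CARD('p)"
  have "pochhammer (- of_nat a + P * s) j / fact j \<equiv>\<^sub>1 0 / fact j"
  proof (intro zcong_divide pochhammer_cong_p_0)
    show "- of_nat a + P * s + of_nat a \<equiv>\<^sub>1 0" using cong_p_P_mult[OF s] by simp
  qed (use j in \<open>auto intro!: Zp_intros s\<close>)
  thus *: "pochhammer (- of_nat a + P * s) j / fact j \<equiv>\<^sub>1 0" by simp
  show "(pochhammer (- of_nat a + P * s) j / fact j)\<^sup>2 \<equiv>\<^sub>2 0"
    using cong_p_0_mult[OF * *] by (simp add: power2_eq_square)
qed

lemma trunc_square_cong:
  assumes a: "a < CARD('p)" and s: "s \<in> Zp" and t: "t \<in> Zp"
  shows "trunc_hyp2F1 (- of_nat a + P * s) (- of_nat a + P * s) 1 t (CARD('p) - 1)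
    \<equiv>\<^sub>2 (\<Sum>j\<le>a. weight a (- 2 * s) 0 (2 * s) j * t ^ j)"
  unfolding trunc_hyp2F1_square
  by (intro zcong_sum_truncate zcong_mult_right zcong_mult_0 pochhammer_square_cong a s t Zp_power)

text \<open>Multiplying by \<open>t ^ a\<close> and reversing the sum returns to powers of
  \<open>t\<close>, at the cost of interchanging the weights of j and a - j.\<close>

lemma trunc_square_inverse_cong:
  assumes a: "a < CARD('p)" and s: "s \<in> Zp" and t: "t \<in> Zp" "padic_norm t = 1"
  shows "t ^ a * trunc_hyp2F1 (- of_nat a + P * s) (- of_nat a + P * s) 1 (1 / t) (CARD('p) - 1)
    \<equiv>\<^sub>2 (\<Sum>j\<le>a. weight a (- 2 * s) (2 * s) 0 j * t ^ j)"
proof -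
  have t0: "t \<noteq> 0" using t by auto
  have "t ^ a * trunc_hyp2F1 (- of_nat a + P * s) (- of_nat a + P * s) 1 (1 / t) (CARD('p) - 1)
    \<equiv>\<^sub>2 t ^ a * (\<Sum>j\<le>a. weight a (- 2 * s) 0 (2 * s) j * (1 / t) ^ j)"
    by (intro zcong_mult_left trunc_square_cong a s Zp_divide t Zp_power Zp_1)
  also have "\<dots> = (\<Sum>j\<le>a. weight a (- 2 * s) (2 * s) 0 (a - j) * t ^ (a - j))"
    unfolding sum_distrib_left
  proof (intro sum.cong refl)
    fix j assume "j \<in> {..a}"
    hence j: "j \<le> a" by simp
    hence "t ^ a * (1 / t) ^ j = t ^ (a - j)" using t0 by (simp add: power_diff field_simps)
    thus "t ^ a * (weight a (- 2 * s) 0 (2 * s) j * (1 / t) ^ j)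
        = weight a (- 2 * s) (2 * s) 0 (a - j) * t ^ (a - j)"
      unfolding weight_rev[OF j] by (subst mult.left_commute) simp
  qed
  also have "\<dots> = (\<Sum>j\<le>a. weight a (- 2 * s) (2 * s) 0 j * t ^ j)" by (rule sum_atMost_rev)
  finally show ?thesis .
qed

end

section \<open>The terms of index at least $p$ and the final comparison\<close>

lemma pochhammer_binomial_scaled:
  fixes z v :: "'a::field_char_0"
  assumes "v \<noteq> 0"
  shows "v ^ n * (pochhammer (- of_nat n) k / fact k * (z / v) ^ k)
    = of_nat (n choose k) * (- z) ^ k * v ^ (n - k)"
proof (cases "k \<le> n")
  case True
  have "pochhammer (- of_nat n) k / fact k = (- 1) ^ k * (of_nat (n choose k) :: 'a)"
    unfolding binomial_gbinomial gbinomial_pochhammer by (simp flip: power_mult_distrib)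
  moreover have "v ^ n = v ^ k * v ^ (n - k)" using True by (simp flip: power_add)
  moreover have "(- z) ^ k = (- 1) ^ k * z ^ k" by (simp flip: power_mult_distrib)
  ultimately show ?thesis using assms by (simp add: power_divide)
next
  case False
  thus ?thesis by (simp add: pochhammer_of_nat_eq_0_lemma binomial_eq_0)
qed

lemma scaled_sum_eq_moment_sum:
  fixes z v :: "'a::field_char_0"
  assumes "a < n" "v \<noteq> 0"
  shows "v ^ a * (\<Sum>k<n. pochhammer (- of_nat a) k / fact k * q k * (z / v) ^ k) = moment_sum q (- z) v a"
proof -
  have "v ^ a * (\<Sum>k<n. pochhammer (- of_nat a) k / fact k * q k * (z / v) ^ k)
      = (\<Sum>k<n. v ^ a * (pochhammer (- of_nat a) k / fact k * (z / v) ^ k) * q k)"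
    unfolding sum_distrib_left by (simp only: mult_ac)
  also have "\<dots> = (\<Sum>k<n. of_nat (a choose k) * (- z) ^ k * v ^ (a - k) * q k)"
    unfolding pochhammer_binomial_scaled[OF assms(2)] ..
  also have "\<dots> = moment_sum q (- z) v a"
    unfolding moment_sum_def using assms(1) by (intro sum.mono_neutral_right) (auto simp: binomial_eq_0)
  finally show ?thesis .
qed

lemma scaled_sum_split:
  fixes z v :: "'a::field_char_0"
  assumes "v \<noteq> 0"
  shows "v ^ (n + a) * (\<Sum>k<n. pochhammer (- of_nat (n + a)) k / fact k * q k * (z / v) ^ k)
    = moment_sum q (- z) v (n + a)
      - (\<Sum>i\<le>a. of_nat (n + a choose (n + i)) * (- z) ^ (n + i) * v ^ (a - i) * q (n + i))"
proof -
  have "v ^ (n + a) * (\<Sum>k<n. pochhammer (- of_nat (n + a)) k / fact k * q k * (z / v) ^ k)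
      = (\<Sum>k<n. v ^ (n + a) * (pochhammer (- of_nat (n + a)) k / fact k * (z / v) ^ k) * q k)"
    unfolding sum_distrib_left by (simp only: mult_ac)
  also have "\<dots> = (\<Sum>k<n. of_nat (n + a choose k) * (- z) ^ k * v ^ (n + a - k) * q k)"
    unfolding pochhammer_binomial_scaled[OF assms] ..
  finally show ?thesis unfolding moment_sum_def sum_atMost_add by simp
qed

lemma binomial_shift:
  assumes "i \<le> a"
  shows "of_nat (n + a choose (n + i)) * pochhammer (1 + of_nat n) i
    = of_nat (n + a choose n) * of_nat (a choose i) * (fact i :: 'a::field_char_0)"
proof -
  have "fact n * pochhammer (1 + of_nat n) i = (fact (n + i) :: 'a)"
    using pochhammer_product'[of "1 :: 'a" n i] by (simp add: pochhammer_fact)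
  hence "pochhammer (1 + of_nat n) i = (fact (n + i) / fact n :: 'a)" by (simp add: field_simps)
  thus ?thesis using assms by (simp add: binomial_fact)
qed

section \<open>Arithmetic of dual numbers modulo p^2\<close>

context odd_padic_prime
begin

text \<open>\<open>P\<close> plays the infinitesimal. This is a relation because \<open>x\<close>
  and \<open>y\<close> are not determined by \<open>X\<close>: a multiple of \<open>P\<close> can be
  moved between the two parts.\<close>

definition dual :: "'p padic \<Rightarrow> 'p padic \<Rightarrow> 'p padic \<Rightarrow> bool" where
  "dual X x y \<longleftrightarrow> X \<equiv>\<^sub>2 x + P * y \<and> x \<in> Zp \<and> y \<in> Zp"

lemma dual_const: "x \<in> Zp \<Longrightarrow> dual x x 0"
  by (simp add: dual_def)

lemma dual_exact: "x \<in> Zp \<Longrightarrow> y \<in> Zp \<Longrightarrow> dual (x + P * y) x y"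
  by (simp add: dual_def)

lemma dual_add: "dual X x y \<Longrightarrow> dual X' x' y' \<Longrightarrow> dual (X + X') (x + x') (y + y')"
  using zcong_add[of _ X "x + P * y" X' "x' + P * y'"]
  by (auto simp: dual_def Zp_add algebra_simps)

lemma dual_diff: "dual X x y \<Longrightarrow> dual X' x' y' \<Longrightarrow> dual (X - X') (x - x') (y - y')"
  using zcong_diff[of _ X "x + P * y" X' "x' + P * y'"]
  by (auto simp: dual_def Zp_diff algebra_simps)

lemma dual_mult:
  assumes "dual X x y" "dual X' x' y'"
  shows "dual (X * X') (x * x') (x * y' + y * x')"
proof -
  have Zp: "x \<in> Zp" "y \<in> Zp" "x' \<in> Zp" "y' \<in> Zp" using assms by (auto simp: dual_def)
  have "X * X' \<equiv>\<^sub>2 (x + P * y) * (x' + P * y')"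
    using assms unfolding dual_def by (intro zcong_mult Zp_intros) auto
  also have "\<dots> \<equiv>\<^sub>2 x * x' + P * (x * y' + y * x')"
    by (rule cong_p2_P2[of "y * y'"], intro Zp_mult Zp) (simp add: power2_eq_square algebra_simps)
  finally show ?thesis unfolding dual_def by (intro conjI Zp_intros Zp)
qed

lemma dual_cong:
  assumes "dual X x y" "dual Y x' y'" "x = x'" "y = y'"
  shows "X \<equiv>\<^sub>2 Y"
  using assms zcong_trans[OF _ zcong_sym] unfolding dual_def by blast

lemma dual_zcong: "X \<equiv>\<^sub>2 Y \<Longrightarrow> dual Y x y \<Longrightarrow> dual X x y"
  using zcong_trans unfolding dual_def by blast

lemma dual_Zp: "dual X x y \<Longrightarrow> X \<in> Zp"
  unfolding dual_def using zcong_Zp Zp_add Zp_mult P_Zp by blast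

lemma Zp_cancel_unit: "u * x \<in> Zp \<Longrightarrow> padic_norm u = 1 \<Longrightarrow> x \<in> Zp"
  by (simp add: Zp_def padic_norm_mult)

section \<open>The three instances of the transformation and the tail\<close>

lemma jacobi_sum_one: "jacobi_sum 1 a t = (\<Sum>j\<le>a. (of_nat (a choose j))\<^sup>2 * (t :: 'p padic) ^ j)"
  unfolding jacobi_sum_def
  by (intro sum.cong refl) (simp add: binomial_fact power2_eq_square flip: pochhammer_fact)

lemma moment_sum_half:
  "moment_sum (beta_moment (1 / 2)) (- z) ((1 + z)\<^sup>2) a
     = (\<Sum>j\<le>a. (of_nat (a choose j))\<^sup>2 * ((z :: 'p padic)\<^sup>2) ^ j)"
proof -
  have "(1 / 2 + 1 / 2 :: 'p padic) = 1" by simp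
  moreover have "pochhammer (1 / 2 + 1 / 2) a \<noteq> (0 :: 'p padic)" by (simp flip: pochhammer_fact)
  ultimately show ?thesis using quadratic_transformation jacobi_sum_one by metis
qed

lemma moment_sum_minus:
  "moment_sum (beta_moment ((1 - P) / 2)) (- z) ((1 + z)\<^sup>2) n = jacobi_sum (1 + P * (- (1 / 2))) n (z\<^sup>2)"
proof -
  have e: "(1 - P) / 2 + 1 / 2 = 1 + P * (- (1 / 2))" by (simp add: diff_divide_distrib)
  have "pochhammer ((1 - P) / 2 + 1 / 2) n \<noteq> 0" unfolding e by (rule pochhammer_gamma_nonzero)
  from quadratic_transformation[OF this] show ?thesis unfolding e .
qed

lemma moment_sum_plus:
  "moment_sum (beta_moment ((1 + P) / 2)) (- z) ((1 + z)\<^sup>2) n = jacobi_sum (1 + P * (1 / 2)) n (z\<^sup>2)"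
proof -
  have e: "(1 + P) / 2 + 1 / 2 = 1 + P * (1 / 2)" by (simp add: add_divide_distrib)
  have "pochhammer ((1 + P) / 2 + 1 / 2) n \<noteq> 0"
  proof
    assume "pochhammer ((1 + P) / 2 + 1 / 2) n = 0"
    then obtain k where "(1 + P) / 2 + 1 / 2 = - of_nat k" by (auto simp: pochhammer_eq_0_iff)
    hence "(1 + P) / 2 + 1 / 2 + of_nat k = 0" by simp
    thus False using plus_gamma_nonzero by blast
  qed
  from quadratic_transformation[OF this] show ?thesis unfolding e .
qed

text \<open>The factor (1+p)_i / i! from shifting the moments is cancelled by its inverse from
  shifting the binomial coefficients. The sign comes from p being odd.\<close>

lemma tail_sum:
  defines "q \<equiv> beta_moment ((1 - P) / 2)"
  shows "(\<Sum>i\<le>a. of_nat (CARD('p) + a choose (CARD('p) + i)) * (- z) ^ (CARD('p) + i) * v ^ (a - i) * q (CARD('p) + i))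
    = - (of_nat (CARD('p) + a choose CARD('p)) * q CARD('p) * z ^ CARD('p)
        * moment_sum (beta_moment ((1 + P) / 2)) (- z) v a)"
proof -
  define D where "D = of_nat (CARD('p) + a choose CARD('p)) * q CARD('p)"
  have z: "(- z) ^ CARD('p) = - (z ^ CARD('p))" by (simp add: odd_card)
  have "of_nat (CARD('p) + a choose (CARD('p) + i)) * q (CARD('p) + i)
      = D * (of_nat (a choose i) * beta_moment ((1 + P) / 2) i)" if "i \<le> a" for i
  proof -
    define f where "f = pochhammer (1 + P) i"
    have "f \<noteq> 0"
    proof
      assume "f = 0"
      then obtain k where "1 + P = - of_nat k" by (auto simp: f_def pochhammer_eq_0_iff)
      hence "1 + P + of_nat k = 0" by simp
      hence "of_nat (Suc (CARD('p) + k)) = (0 :: 'p padic)" by (simp add: P_def add.assoc)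
      thus False unfolding of_nat_eq_0_iff by simp
    qed
    have 1: "of_nat (CARD('p) + a choose (CARD('p) + i)) * f
        = of_nat (CARD('p) + a choose CARD('p)) * of_nat (a choose i) * fact i"
      unfolding f_def P_def by (rule binomial_shift[OF that])
    have 2: "q (CARD('p) + i) * fact i = q CARD('p) * f * beta_moment ((1 + P) / 2) i"
      unfolding q_def f_def by (rule beta_moment_shift)
    have "f * fact i * (of_nat (CARD('p) + a choose (CARD('p) + i)) * q (CARD('p) + i))
        = (of_nat (CARD('p) + a choose (CARD('p) + i)) * f) * (q (CARD('p) + i) * fact i)"
      by (simp only: mult_ac)
    also have "\<dots> = f * fact i * (D * (of_nat (a choose i) * beta_moment ((1 + P) / 2) i))"
      unfolding 1 2 D_def by (simp only: mult_ac)
    finally have "f * fact i * (of_nat (CARD('p) + a choose (CARD('p) + i)) * q (CARD('p) + i))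
        = f * fact i * (D * (of_nat (a choose i) * beta_moment ((1 + P) / 2) i))" .
    thus ?thesis using \<open>f \<noteq> 0\<close> by simp
  qed
  hence "(\<Sum>i\<le>a. of_nat (CARD('p) + a choose (CARD('p) + i)) * (- z) ^ (CARD('p) + i) * v ^ (a - i) * q (CARD('p) + i))
      = (\<Sum>i\<le>a. - (D * z ^ CARD('p)) * (of_nat (a choose i) * (- z) ^ i * v ^ (a - i) * beta_moment ((1 + P) / 2) i))"
    unfolding power_add z by (intro sum.cong refl) (simp, algebra)
  thus ?thesis unfolding moment_sum_def D_def sum_distrib_left[symmetric] by simp
qed

text \<open>C(p+a, a) = (1+p)_a / a! contributes 1 + pH_a, and the moment at index p contributes
  2.\<close>

lemma tail_coeff:
  assumes "a < CARD('p)"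
  shows "dual (of_nat (CARD('p) + a choose CARD('p)) * beta_moment ((1 - P) / 2) CARD('p)) 2 (2 * harmonic a)"
proof -
  have "CARD('p) + a choose CARD('p) = CARD('p) + a choose a"
    using binomial_symmetric[of a "CARD('p) + a"] by simp
  hence 1: "of_nat (CARD('p) + a choose CARD('p)) = pochhammer (1 + P * 1) a / fact a"
    using binomial_pochhammer[of "CARD('p) + a" a] by (simp add: P_def)
  have "pochhammer (1 + P * 1) a / fact a \<equiv>\<^sub>2 fact a / fact a * (1 + P * (1 * harmonic a - 0))"
    using assms by (intro first_order_divide pochhammer_one_cong Zp_intros) simp_all
  hence "dual (of_nat (CARD('p) + a choose CARD('p))) 1 (harmonic a)"
    using assms unfolding 1 dual_def by (simp add: harmonic_Zp)
  moreover have "dual (beta_moment ((1 - P) / 2) CARD('p)) 2 0"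
    unfolding dual_def using beta_moment_card by (simp add: Zp_numeral)
  ultimately show ?thesis using dual_mult[of _ 1 "harmonic a" _ 2 0] by (simp add: mult.commute)
qed

lemma dual_sum_weight:
  fixes a :: nat and t :: "'p padic"
  defines "A \<equiv> \<Sum>j\<le>a. (of_nat (a choose j))\<^sup>2 * t ^ j"
    and "J \<equiv> \<Sum>j\<le>a. (of_nat (a choose j))\<^sup>2 * harmonic j * t ^ j"
    and "K \<equiv> \<Sum>j\<le>a. (of_nat (a choose j))\<^sup>2 * harmonic (a - j) * t ^ j"
  assumes "a < CARD('p)" "t \<in> Zp" "u \<in> Zp" "v \<in> Zp" "w \<in> Zp"
  shows "dual (\<Sum>j\<le>a. weight a u v w j * t ^ j) A (u * harmonic a * A + v * J + w * K)"
  unfolding sum_weight A_def J_def K_def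
  by (intro dual_exact Zp_intros assms) (use assms in auto)

text \<open>Modulo p^2 each term is affine in s, and s = -1 gives the terminating parameter -a-p;
  the slope is therefore the difference of the terms for -a and for -a-p. The power of
  \<open>v\<close> clears the denominators of both.\<close>

lemma trunc_half_cong:
  fixes z s :: "'p padic"
  defines "v \<equiv> (1 + z)\<^sup>2"
  assumes a: "a < CARD('p)" and s: "s \<in> Zp" and z: "z \<in> Zp" and v: "padic_norm v = 1"
  shows "v ^ (CARD('p) + a) * trunc_hyp2F1 (- of_nat a + P * s) (1 / 2) 1 (4 * z / v) (CARD('p) - 1)
    \<equiv>\<^sub>2 v ^ CARD('p) * moment_sum (beta_moment (1 / 2)) (- z) v a
      + s * (v ^ CARD('p) * moment_sum (beta_moment ((1 - P) / 2)) (- z) v a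
        - (moment_sum (beta_moment ((1 - P) / 2)) (- z) v (CARD('p) + a)
          + of_nat (CARD('p) + a choose CARD('p)) * beta_moment ((1 - P) / 2) CARD('p) * z ^ CARD('p)
            * moment_sum (beta_moment ((1 + P) / 2)) (- z) v a))"
proof -
  define y where "y = z / v"
  define q w where "q = beta_moment ((1 - P) / 2)" and "w = (beta_moment (1 / 2) :: nat \<Rightarrow> 'p padic)"
  define B where "B n k = pochhammer (- of_nat n) k / (fact k :: 'p padic)" for n k
  define N where "N = CARD('p) + a"
  have vZ: "v \<in> Zp" unfolding v_def by (intro Zp_intros z)
  have v0: "v \<noteq> 0" using v by auto
  have yZ: "y \<in> Zp" unfolding y_def by (intro Zp_divide z v)
  have range: "{..CARD('p) - 1} = {..<CARD('p)}" by (auto simp: odd_card)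
  have "trunc_hyp2F1 (- of_nat a + P * s) (1 / 2) 1 (4 * z / v) (CARD('p) - 1)
      = (\<Sum>k<CARD('p). pochhammer (- of_nat a + P * s) k / fact k * w k * y ^ k)"
    unfolding trunc_hyp2F1_def range
  proof (intro sum.cong refl)
    fix k
    have "(4 * z / v) ^ k = 4 ^ k * y ^ k" by (simp add: y_def power_mult_distrib flip: times_divide_eq_right)
    thus "pochhammer (- of_nat a + P * s) k * pochhammer (1 / 2) k / pochhammer 1 k * ((4 * z / v) ^ k / fact k)
        = pochhammer (- of_nat a + P * s) k / fact k * w k * y ^ k"
      unfolding w_def beta_moment_half[symmetric] by (simp add: mult_ac flip: pochhammer_fact)
  qed
  also have "\<dots> \<equiv>\<^sub>2 (\<Sum>k<CARD('p). (B a k * w k + s * (B a k * q k - B N k * q k)) * y ^ k)"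
  proof (intro zcong_sum zcong_mult_right Zp_power yZ)
    fix k assume k: "k \<in> {..<CARD('p)}"
    obtain d where d: "d \<in> Zp"
      "\<And>s. s \<in> Zp \<Longrightarrow> pochhammer (- of_nat a + P * s) k \<equiv>\<^sub>2 pochhammer (- of_nat a) k + P * s * d"
      using pochhammer_linear[of "- of_nat a" k] by (metis Zp_minus Zp_of_nat)
    define e where "e = d / fact k"
    have fk: "padic_norm (fact k :: 'p padic) = 1" using k by (intro padic_norm_fact_unit) simp
    have eZ: "e \<in> Zp" unfolding e_def by (intro Zp_divide d fk)
    have BZ: "B n k \<in> Zp" for n unfolding B_def by (intro Zp_divide fk pochhammer_Zp Zp_minus Zp_of_nat)
    have lin: "pochhammer (- of_nat a + P * r) k / fact k \<equiv>\<^sub>2 B a k + P * r * e" if "r \<in> Zp" for r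
      using zcong_divide[OF d(2)[OF that] fk] by (simp add: B_def e_def add_divide_distrib)
    have wZ: "w k \<in> Zp" and qw: "w k \<equiv>\<^sub>1 q k"
      using beta_moment_cong[of k] k by (auto simp: w_def q_def intro: zcong_sym)
    \<comment> \<open>Evaluation at s = -1 identifies the slope \<open>P * e\<close> as
      \<open>B a k - B N k\<close>.\<close>
    have "- of_nat N = - of_nat a + P * (- 1)" by (simp add: N_def P_def)
    hence BN: "B N k \<equiv>\<^sub>2 B a k + P * (- 1) * e"
      unfolding B_def by (metis B_def Zp_1 Zp_minus lin)
    have diff: "P * e \<equiv>\<^sub>2 B a k - B N k"
      using zcong_diff[OF zcong_refl[of _ "B a k"] BN] by (simp add: zcong_sym)
    have "pochhammer (- of_nat a + P * s) k / fact k * w k \<equiv>\<^sub>2 (B a k + P * s * e) * w k"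
      by (intro zcong_mult_right lin s wZ)
    also have "(B a k + P * s * e) * w k = B a k * w k + s * ((P * e) * w k)"
      by (simp add: algebra_simps)
    \<comment> \<open>Only the slope carries a factor p, so \<open>w\<close> becomes
      \<open>q\<close> there, while \<open>B a k * w k\<close> keeps b = 1/2.\<close>
    also have "\<dots> \<equiv>\<^sub>2 B a k * w k + s * ((P * e) * q k)"
      by (intro zcong_add zcong_refl zcong_mult_left s cong_p_0_mult cong_p_P_mult eZ qw)
    also have "\<dots> \<equiv>\<^sub>2 B a k * w k + s * ((B a k - B N k) * q k)"
      by (intro zcong_add zcong_refl zcong_mult_left s zcong_mult_right diff zcong_Zp[OF zcong_sym[OF qw] wZ])
    finally show "pochhammer (- of_nat a + P * s) k / fact k * w k
        \<equiv>\<^sub>2 B a k * w k + s * (B a k * q k - B N k * q k)"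
      by (simp only: left_diff_distrib)
  qed
  also have "\<dots> = (\<Sum>k<CARD('p). B a k * w k * y ^ k)
      + s * ((\<Sum>k<CARD('p). B a k * q k * y ^ k) - (\<Sum>k<CARD('p). B N k * q k * y ^ k))"
    unfolding sum_distrib_left sum_subtractf[symmetric] sum.distrib[symmetric]
    by (intro sum.cong refl) (simp add: algebra_simps)
  finally have "v ^ N * trunc_hyp2F1 (- of_nat a + P * s) (1 / 2) 1 (4 * z / v) (CARD('p) - 1)
      \<equiv>\<^sub>2 v ^ N * \<dots>"
    by (intro zcong_mult_left Zp_power vZ)
  also have "v ^ N * ((\<Sum>k<CARD('p). B a k * w k * y ^ k)
      + s * ((\<Sum>k<CARD('p). B a k * q k * y ^ k) - (\<Sum>k<CARD('p). B N k * q k * y ^ k)))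
    = v ^ CARD('p) * (v ^ a * (\<Sum>k<CARD('p). B a k * w k * y ^ k))
      + s * (v ^ CARD('p) * (v ^ a * (\<Sum>k<CARD('p). B a k * q k * y ^ k))
        - v ^ N * (\<Sum>k<CARD('p). B N k * q k * y ^ k))"
    unfolding N_def power_add by (simp add: algebra_simps)
  finally show ?thesis
    unfolding B_def y_def scaled_sum_eq_moment_sum[OF a v0] N_def scaled_sum_split[OF v0]
    unfolding q_def w_def tail_sum by simp
qed

text \<open>All quantities become dual numbers over the shared data \<open>A\<close>,
  \<open>J\<close>, \<open>K\<close>, \<open>h\<close>, \<open>n\<close>, \<open>w\<close>. After
  multiplication by the unit \<open>V\<close> the claim is a polynomial identity in these,
  \<open>s\<close> and \<open>z\<close>.\<close>

lemma quadratic_congruence: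
  fixes z s :: "'p padic"
  assumes a: "a < CARD('p)" and s: "s \<in> Zp" and z: "z \<in> Zp" "padic_norm z = 1" "padic_norm (1 + z) = 1"
  defines "x \<equiv> - of_nat a + P * s"
  shows "trunc_hyp2F1 x x 1 (z\<^sup>2) (CARD('p) - 1)
      + padic_power z (int (1 + 2 * a)) (- 2 * s) * trunc_hyp2F1 x x 1 (1 / z\<^sup>2) (CARD('p) - 1)
    \<equiv>\<^sub>2 padic_power (1 + z) (int (1 + 2 * a)) (- 2 * s)
      * trunc_hyp2F1 x (1 / 2) 1 (4 * z / (1 + z)\<^sup>2) (CARD('p) - 1)"
proof -
  define Z where "Z = 1 + z"
  have Z: "Z \<in> Zp" "padic_norm Z = 1" unfolding Z_def using z by (auto intro: Zp_intros)
  \<comment> \<open>\<open>n\<close> and \<open>w\<close> are the quotients (Z^p - Z)/p and (z^p -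
    z)/p. They need no evaluation, as they occur equally on both sides of the final
    identity.\<close>
  obtain n where n: "n \<in> Zp" "Z ^ CARD('p) = Z + P * n"
    using fermat_cong[OF Z(1)] by (elim zcongE) (simp add: P_def)
  obtain w where w: "w \<in> Zp" "z ^ CARD('p) = z + P * w"
    using fermat_cong[OF z(1)] by (elim zcongE) (simp add: P_def)
  define F1 F2 R where "F1 = trunc_hyp2F1 x x 1 (z\<^sup>2) (CARD('p) - 1)"
    and "F2 = trunc_hyp2F1 x x 1 (1 / z\<^sup>2) (CARD('p) - 1)"
    and "R = trunc_hyp2F1 x (1 / 2) 1 (4 * z / Z\<^sup>2) (CARD('p) - 1)"
  define t where "t = z\<^sup>2"
  define A J K where "A = (\<Sum>j\<le>a. (of_nat (a choose j))\<^sup>2 * t ^ j)"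
    and "J = (\<Sum>j\<le>a. (of_nat (a choose j))\<^sup>2 * harmonic j * t ^ j)"
    and "K = (\<Sum>j\<le>a. (of_nat (a choose j))\<^sup>2 * harmonic (a - j) * t ^ j)"
  define h where "h = (harmonic a :: 'p padic)"
  define V where "V = (Z ^ CARD('p))\<^sup>2"
  define C where "C = of_nat (CARD('p) + a choose CARD('p)) * beta_moment ((1 - P) / 2) CARD('p)"
  have tZ: "t \<in> Zp" "padic_norm t = 1" unfolding t_def using z by (auto intro: Zp_intros simp: padic_norm_power)
  have AZ: "A \<in> Zp" unfolding A_def by (intro Zp_intros tZ)
  have sZ: "2 * s \<in> Zp" "- 2 * s \<in> Zp" using s Zp_mult[of "- 2" s] Zp_numeral Zp_minus by (auto intro: Zp_mult)
  have k: "1 / 2 \<in> (Zp :: 'p padic set)" "- (1 / 2) \<in> (Zp :: 'p padic set)"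
    "3 * (1 / 2) \<in> (Zp :: 'p padic set)" "- 3 * (1 / 2) \<in> (Zp :: 'p padic set)"
    by (intro Zp_mult Zp_minus Zp_numeral half_Zp)+
  have weights: "dual (\<Sum>j\<le>a. weight a u u' u'' j * t ^ j) A (u * h * A + u' * J + u'' * K)"
    if "u \<in> Zp" "u' \<in> Zp" "u'' \<in> Zp" for u u' u''
    unfolding A_def J_def K_def h_def by (rule dual_sum_weight[OF a tZ(1) that])
  have dF1: "dual F1 A (- 2 * s * h * A + 0 * J + 2 * s * K)"
    unfolding F1_def x_def t_def[symmetric]
    by (rule dual_zcong[OF trunc_square_cong[OF a s tZ(1)] weights]) (intro sZ Zp_0)+
  have dF2: "dual (t ^ a * F2) A (- 2 * s * h * A + 2 * s * J + 0 * K)"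
    unfolding F2_def x_def t_def[symmetric]
    by (rule dual_zcong[OF trunc_square_inverse_cong[OF a s tZ] weights]) (intro sZ Zp_0)+
  have dT: "dual (jacobi_sum (1 + P * (- (1 / 2))) a t) A (- (1 / 2) * h * A + - (- (1 / 2)) * J + - (- (1 / 2)) * K)"
    by (rule dual_zcong[OF jacobi_sum_cong[OF k(2) a tZ(1)] weights]) (use k in auto)
  have dO: "dual (jacobi_sum (1 + P * (1 / 2)) a t) A (1 / 2 * h * A + - (1 / 2) * J + - (1 / 2) * K)"
    by (rule dual_zcong[OF jacobi_sum_cong[OF k(1) a tZ(1)] weights]) (use k in auto)
  have dz: "dual (z ^ CARD('p)) z w" unfolding w(2) by (intro dual_exact z w)
  have dZ: "dual (Z ^ CARD('p)) Z n" unfolding n(2) by (intro dual_exact Z n)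
  have tp: "t ^ CARD('p) = z ^ CARD('p) * z ^ CARD('p)" by (simp add: t_def power2_eq_square power_mult_distrib)
  have dr: "dual (jacobi_sum (1 + P * (- (1 / 2))) (CARD('p) + a) t)
      (A + z * z * A)
      ((3 * (1 / 2) * h * A + 1 / 2 * J + - 3 * (1 / 2) * K)
        + (z * z * (3 * (1 / 2) * h * A + - 3 * (1 / 2) * J + 1 / 2 * K) + (z * w + w * z) * A))"
    by (rule dual_zcong[OF jacobi_sum_shift_cong[OF a tZ(1)]], unfold tp)
       (intro dual_add dual_mult weights dz k)
  have dC: "dual C 2 (2 * h)" unfolding C_def h_def by (rule tail_coeff[OF a])
  have VR: "(Z\<^sup>2) ^ (CARD('p) + a) * R \<equiv>\<^sub>2 V * A + s * (V * jacobi_sum (1 + P * (- (1 / 2))) a t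
      - (jacobi_sum (1 + P * (- (1 / 2))) (CARD('p) + a) t
        + C * z ^ CARD('p) * jacobi_sum (1 + P * (1 / 2)) a t))"
  proof -
    have "padic_norm ((1 + z)\<^sup>2) = 1" using z by (simp add: padic_norm_power)
    moreover have "(Z\<^sup>2) ^ CARD('p) = V" by (simp add: V_def mult.commute flip: power_mult)
    ultimately show ?thesis
      using trunc_half_cong[OF a s z(1), folded Z_def]
      unfolding x_def[symmetric] R_def[symmetric] C_def[symmetric]
      unfolding Z_def moment_sum_half moment_sum_minus moment_sum_plus t_def[symmetric] A_def[symmetric]
      unfolding Z_def[symmetric] by simp
  qed
  \<comment> \<open>Absorbing one factor \<open>X\<close> turns the exponent p - 1 into p, so that
    the correction involves X^p - X, which for \<open>z\<close> and \<open>Z\<close> is p times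
    \<open>w\<close> and \<open>n\<close>.\<close>
  have pow: "X ^ Suc (2 * b) * (1 + - 2 * s * (X ^ (CARD('p) - 1) - 1))
      = (X - 2 * s * (X ^ CARD('p) - X)) * (X\<^sup>2) ^ b" for X b
  proof -
    have "X ^ CARD('p) = X * X ^ (CARD('p) - 1)" by (simp add: odd_card)
    moreover define c e where "c = (X\<^sup>2) ^ b" and "e = X ^ (CARD('p) - 1)"
    moreover have "X ^ Suc (2 * b) = X * c" by (simp add: c_def power_mult)
    ultimately show ?thesis by (simp only:) (simp add: algebra_simps)
  qed
  have pow_cong: "padic_power X (int (1 + 2 * a)) (- 2 * s)
      \<equiv>\<^sub>2 (X - 2 * s * (X ^ CARD('p) - X)) * (X\<^sup>2) ^ a" if "X \<in> Zp" "padic_norm X = 1" for X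
    using padic_power_cong[OF that sZ(2), of "Suc (2 * a)"] unfolding pow by simp
  have dF2': "dual (padic_power z (int (1 + 2 * a)) (- 2 * s) * F2) (z * A)
      (z * (- 2 * s * h * A + 2 * s * J + 0 * K) + (0 - 2 * s * w) * A)"
  proof (rule dual_zcong)
    have "F2 \<in> Zp"
      using dual_Zp[OF dF2] by (rule Zp_cancel_unit) (simp add: padic_norm_power tZ)
    moreover have "z - 2 * s * (z ^ CARD('p) - z) = z + P * (0 - 2 * s * w)"
      unfolding w(2) by (simp add: algebra_simps)
    ultimately show "padic_power z (int (1 + 2 * a)) (- 2 * s) * F2
      \<equiv>\<^sub>2 (z + P * (0 - 2 * s * w)) * (t ^ a * F2)"
      using zcong_mult_right[OF pow_cong[OF z(1,2)], of F2] by (simp only: t_def mult.assoc)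
    show "dual ((z + P * (0 - 2 * s * w)) * (t ^ a * F2)) (z * A)
      (z * (- 2 * s * h * A + 2 * s * J + 0 * K) + (0 - 2 * s * w) * A)"
      by (intro dual_mult dF2 dual_exact z w Zp_diff Zp_0 Zp_mult sZ)
  qed
  have dV: "dual V (Z * Z) (Z * n + n * Z)"
    unfolding V_def power2_eq_square by (intro dual_mult dZ)
  define M where "M = V * A + s * (V * jacobi_sum (1 + P * (- (1 / 2))) a t
      - (jacobi_sum (1 + P * (- (1 / 2))) (CARD('p) + a) t
        + C * z ^ CARD('p) * jacobi_sum (1 + P * (1 / 2)) a t))"
  note dM = dual_add[OF dual_mult[OF dV dual_const[OF AZ]] dual_mult[OF dual_const[OF s]
      dual_diff[OF dual_mult[OF dV dT] dual_add[OF dr dual_mult[OF dual_mult[OF dC dz] dO]]]],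
      folded M_def]
  define G where "G = padic_power Z (int (1 + 2 * a)) (- 2 * s) * R"
  have RZ: "R \<in> Zp"
    using zcong_Zp[OF VR[folded M_def] dual_Zp[OF dM]]
    by (rule Zp_cancel_unit) (simp add: padic_norm_power Z)
  \<comment> \<open>\<open>R\<close> is known only after multiplication by (Z^2)^(p+a). The p-adic
    power supplies (Z^2)^a, and \<open>V\<close> supplies the missing (Z^2)^p.\<close>
  have "V * G \<equiv>\<^sub>2 V * ((Z - 2 * s * (Z ^ CARD('p) - Z)) * (Z\<^sup>2) ^ a * R)"
    unfolding G_def by (intro zcong_mult_left zcong_mult_right pow_cong Z RZ dual_Zp[OF dV])
  also have "\<dots> = (Z + P * (0 - 2 * s * n)) * ((Z\<^sup>2) ^ (CARD('p) + a) * R)"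
  proof -
    have "(Z\<^sup>2) ^ (CARD('p) + a) = V * (Z\<^sup>2) ^ a"
      unfolding V_def power_add by (simp add: mult.commute flip: power_mult)
    moreover have "Z - 2 * s * (Z ^ CARD('p) - Z) = Z + P * (0 - 2 * s * n)"
      unfolding n(2) by (simp add: algebra_simps)
    ultimately show ?thesis by (simp only: mult_ac)
  qed
  also have "\<dots> \<equiv>\<^sub>2 (Z + P * (0 - 2 * s * n)) * M"
    unfolding M_def by (intro zcong_mult_left VR Zp_intros Z n s)
  finally have VG: "V * G \<equiv>\<^sub>2 (Z + P * (0 - 2 * s * n)) * M" .
  \<comment> \<open>The leading parts agree because 1 + z^2 + 2z = Z^2 makes the coefficient of s in
    \<open>M\<close> vanish modulo p; in the first-order parts the coefficients of
    \<open>h * A\<close>, \<open>J\<close>, \<open>K\<close>, \<open>n * A\<close> and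
    \<open>w * A\<close> match.\<close>
  have "V * (F1 + padic_power z (int (1 + 2 * a)) (- 2 * s) * F2) \<equiv>\<^sub>2 V * G"
  proof (rule dual_cong[OF dual_mult[OF dV dual_add[OF dF1 dF2']] dual_zcong[OF VG dual_mult[OF dual_exact dM]]])
    show "Z \<in> Zp" "0 - 2 * s * n \<in> Zp" by (intro Zp_intros Z n s)+
  qed (simp_all add: Z_def field_simps)
  moreover have "padic_norm V = 1" unfolding V_def by (simp add: padic_norm_power Z)
  ultimately show ?thesis
    unfolding F1_def F2_def G_def R_def Z_def by (rule zcong_cancel_left)
qed

end

theorem theorem2p7:
  fixes p :: nat and \<alpha> z :: "'p::prime_card padic"
  assumes "p = CARD('p)" and "odd p"
    and "\<alpha> \<in> Zp" and "z \<in> Zp" and "\<not> padic_cong (z * (1 + z)) 0 p"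
  shows "padic_cong
    (trunc_hyp2F1 \<alpha> \<alpha> 1 (z\<^sup>2) (p - 1)
      + padic_power z (1 - 2 * lambda_int \<alpha>) (- 2 * lambda_coeff \<alpha>)
        * trunc_hyp2F1 \<alpha> \<alpha> 1 (1 / z\<^sup>2) (p - 1))
    (padic_power (1 + z) (1 - 2 * lambda_int \<alpha>) (- 2 * lambda_coeff \<alpha>)
        * trunc_hyp2F1 \<alpha> (1 / 2) 1 (4 * z / (1 + z)\<^sup>2) (p - 1))
    (p\<^sup>2)"
proof -
  obtain m where m: "CARD('p) = Suc (2 * m)"
    using assms(1,2) by (auto elim: oddE)
  interpret odd_padic_prime "of_nat CARD('p) :: 'p padic" m
    by unfold_locales (use m in auto)
  define a where "a = padic_residue (- \<alpha>)"
  define s where "s = lambda_coeff \<alpha>"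
  have a: "a < CARD('p)" unfolding a_def by (intro padic_residue Zp_minus assms)
  have s: "s \<in> Zp" unfolding s_def by (intro lambda_coeff_Zp assms)
  have \<alpha>: "- of_nat a + of_nat CARD('p) * s = \<alpha>"
    by (simp add: s_def lambda_coeff_def a_def)
  \<comment> \<open>The integer exponent is nonnegative, so \<open>powi\<close> is an ordinary power
    here.\<close>
  have l: "1 - 2 * lambda_int \<alpha> = int (1 + 2 * a)"
    by (simp add: lambda_int_def a_def)
  have z1: "1 + z \<in> Zp" by (intro Zp_add Zp_1 assms)
  \<comment> \<open>Both norms are at most 1 and their product is not below 1, which forces both to
    be 1.\<close>
  have "\<not> padic_norm (z * (1 + z)) < 1"
    using assms(1,5) by (simp add: padic_norm_less_1_iff)
  moreover have "padic_norm z \<le> 1" "padic_norm (1 + z) \<le> 1" using assms(4) z1 by (simp_all add: Zp_def)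
  moreover have "padic_norm z * padic_norm (1 + z) \<le> padic_norm z"
    "padic_norm z * padic_norm (1 + z) \<le> padic_norm (1 + z)"
    using calculation by (simp_all add: mult_left_le mult_left_le_one_le padic_norm_ge_0)
  ultimately have "padic_norm z = 1" "padic_norm (1 + z) = 1" by (simp_all add: padic_norm_mult)
  from quadratic_congruence[OF a s assms(4) this] show ?thesis
    unfolding \<alpha> l assms(1) zcong_def unfolding s_def .
qed

end
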